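(* Let $E$ be the self-affine Moran set with frequency $\mathbf{f}=\{f_\gamma\}_{\gamma\in\Gamma}$, suppose that $\zeta\le 1$, and suppose that $E$ satisfies either the row separation condition (RSC) or the top or bottom separation condition (TBSC). Let $\mu$ be the self-affine Moran measure on $E$ given by the positive probability vectors $(p_\gamma(w))_{w\in\mathcal{D}_\gamma}$, $\gamma\in\Gamma$. Then for every $\alpha\in(\alpha_{\min},\alpha_{\max})$, $$H(\alpha)=\inf_{t\in\mathbb{R}}\{\alpha t+\beta(t)\}.$$ Furthermore, $H(\alpha)$ is differentiable with respect to $\alpha$ and is concave.
   Context: Setting. Let $\{(n_k,m_k)\}_{k\ge1}$ be integer pairs with $n_k\ge2$, $m_k\ge2$ and $\sup_k\{n_k,m_k\}<\infty$, and let $\mathcal{D}_k\subset\{0,\dots,n_k-1\}\times\{0,\dots,m_k-1\}$ with $\operatorname{card}\mathcal{D}_k\ge2$. Let $\Gamma$ be the finite set of all patterns $\gamma=(n_\gamma,m_\gamma,\mathcal{D}_\gamma)$ occurring in the sequence $\{(n_k,m_k,\mathcal{D}_k)\}_{k\ge1}$. Assume that for each $\gamma\in\Gamma$ the limit $f_\gamma=\lim_{n\to\infty}\frac1n\operatorname{card}\{1\le k\le n:(n_k,m_k,\mathcal{D}_k)=\gamma\}$ exists and $\sum_{\gamma\in\Gamma}f_\gamma=1$. Let $\Sigma^\infty=\prod_{k\ge1}\mathcal{D}_k$; write $\mathbf{w}=w_1w_2\cdots\in\Sigma^\infty$ with $w_k=(i_k,j_k)$. Define $\Pi:\Sigma^\infty\to\mathbb{R}^2$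 by $\Pi(\mathbf{w})=\sum_{k\ge1}\big(\frac{i_k}{n_1\cdots n_k},\frac{j_k}{m_1\cdots m_k}\big)$. The set $E=\Pi(\Sigma^\infty)$ is the self-affine Moran set with frequency $\mathbf{f}=\{f_\gamma\}$. For each $\gamma\in\Gamma$ let $(p_\gamma(w))_{w\in\mathcal{D}_\gamma}$ be a probability vector with all $p_\gamma(w)>0$; put $p_k=p_\gamma$ when $(n_k,m_k,\mathcal{D}_k)=\gamma$. Let $\widetilde\mu$ be the product Borel probability measure on $\Sigma^\infty$ with $\widetilde\mu(\{\mathbf{v}:v_1=w_1,\dots,v_k=w_k\})=p_1(w_1)\cdots p_k(w_k)$, and $\mu=\widetilde\mu\circ\Pi^{-1}$ (the self-affine Moran measure). For $w=(i,j)\in\mathcal{D}_\gamma$ let $q_\gamma(w)=q_\gamma(j)=\sum_{i':(i',j)\in\mathcal{D}_\gamma}p_\gamma(i',j)$. Let $\zeta=\frac{\sum_\gamma f_\gamma\log m_\gamma}{\sum_\gamma f_\gamma\log n_\gamma}$. For $t\in\mathbb{R}$ let $u_\gamma(j)=\frac{q_\gamma(j)^t}{\sum_{i':(i',j)\in\mathcal{D}_\gamma}p_\gamma(i',j)^t}$. For $\zeta\le1$, let $\beta_\gamma(t)$ be the unique solution of $m_\gamma^{-\beta_\gamma(t)}\sum_{(i,j)\in\mathcal{D}_\gamma}p_\gamma(i,j)^t\,u_\gamma(j)^{1-\zeta}=1$, and $\beta(t)=\frac{\sum_\gamma f_\gamma\beta_\gamma(t)\log m_\gamma}{\sum_\gamma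 f_\gamma\log m_\gamma}$. Let $\alpha_{\min}=\frac{\sum_\gamma f_\gamma\min_{w\in\mathcal{D}_\gamma}\{-\zeta\log p_\gamma(w)-(1-\zeta)\log q_\gamma(w)\}}{\sum_\gamma f_\gamma\log m_\gamma}$ and let $\alpha_{\max}$ be the same expression with $\max$ in place of $\min$. The local dimension of $\mu$ at $x$ is $\dim_{\rm loc}\mu(x)=\lim_{r\to0}\frac{\log\mu(B(x,r))}{\log r}$ when the limit exists; $E_\alpha=\{x\in\mathbb{R}^2:\dim_{\rm loc}\mu(x)=\alpha\}$; $H(\alpha)=\dim_{\rm H}E_\alpha$ (Hausdorff dimension). Separation conditions. For $w\in\mathcal{D}_\gamma$ let $\Psi_w(x)=\operatorname{diag}(n_\gamma^{-1},m_\gamma^{-1})(x+w)$ and $J=[0,1]^2$. RSC: for all $\gamma\in\Gamma$ and all distinct $(i,j),(i',j')\in\mathcal{D}_\gamma$, $\Psi_{(i,j)}(J)\cap\Psi_{(i',j')}(J)=\emptyset$ and $|j-j'|\ne1$. TBSC: there is $\gamma\in\Gamma$ with $f_\gamma>0$ such that at least one of the following holds: (1) $j\ne0$ for all $(i,j)\in\mathcal{D}_\gamma$; (2) $j\ne m_\gamma-1$ for all $(i,j)\in\mathcal{D}_\gamma$. *)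

theory Defs
  imports "HOL-Probability.Probability"
begin

text \<open>The convention is \<open>0\<^sup>0 = 1\<close> for nonempty sets, whereas \<open>0 powr 0 = 0\<close>.\<close>

definition diam_pow :: "real \<Rightarrow> 'a::metric_space set \<Rightarrow> ennreal" where
  "diam_pow s U = (if U = {} then 0 else if s = 0 then 1 else ennreal (diameter U powr s))"

text \<open>Boundedness is required because \<open>diameter\<close> is \<open>0\<close> on unbounded sets.\<close>

definition hausdorff_pre_measure :: "real \<Rightarrow> real \<Rightarrow> 'a::metric_space set \<Rightarrow> ennreal" where
  "hausdorff_pre_measure s \<delta> A =
     (INF U \<in> {U :: nat \<Rightarrow> 'a set. A \<subseteq> (\<Union>i. U i) \<and> (\<forall>i. bounded (U i) \<and> diameter (U i) \<le> \<delta>)}.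
        \<Sum>i. diam_pow s (U i))"

definition hausdorff_measure :: "real \<Rightarrow> 'a::metric_space set \<Rightarrow> ennreal" where
  "hausdorff_measure s A = (SUP \<delta> \<in> {0<..}. hausdorff_pre_measure s \<delta> A)"

definition hausdorff_dim :: "'a::metric_space set \<Rightarrow> ereal" where
  "hausdorff_dim A = (INF s \<in> {s. 0 \<le> s \<and> hausdorff_measure s A = 0}. ereal s)"

text \<open>
  Since \<open>ln 0 = 0\<close>, points outside the support of \<open>\<mu>\<close> (where the local dimension is infinite)
  have to be excluded explicitly.
\<close>

definition has_local_dim :: "'a::metric_space measure \<Rightarrow> 'a \<Rightarrow> real \<Rightarrow> bool" where
  "has_local_dim \<mu> x \<alpha> \<longleftrightarrow>
     (\<forall>r>0. measure \<mu> (cball x r) > 0) \<and>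
     ((\<lambda>r. ln (measure \<mu> (cball x r)) / ln r) \<longlongrightarrow> \<alpha>) (at_right 0)"

definition local_dim_level :: "'a::metric_space measure \<Rightarrow> real \<Rightarrow> 'a set" where
  "local_dim_level \<mu> \<alpha> = {x. has_local_dim \<mu> x \<alpha>}"

text \<open>
  A pattern \<open>(n, m, D)\<close>; a digit \<open>(i, j) \<in> D\<close> has column index \<open>i < n\<close> and row index \<open>j < m\<close>.
\<close>

datatype pattern = Pattern (ncols: nat) (nrows: nat) (digits: "(nat \<times> nat) set")

definition valid_pattern :: "pattern \<Rightarrow> bool" where
  "valid_pattern \<gamma> \<longleftrightarrow> ncols \<gamma> \<ge> 2 \<and> nrows \<gamma> \<ge> 2 \<and>
     digits \<gamma> \<subseteq> {..<ncols \<gamma>} \<times> {..<nrows \<gamma>} \<and> card (digits \<gamma>) \<ge> 2"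

text \<open>
  Sequences are indexed from \<open>0\<close>: \<open>pat k\<close> is the pattern \<open>(n\<^bsub>k+1\<^esub>, m\<^bsub>k+1\<^esub>, D\<^bsub>k+1\<^esub>)\<close>.
  The set \<open>\<Gamma>\<close> of occurring patterns is \<open>range pat\<close>.
\<close>

definition moran_with_frequency :: "(nat \<Rightarrow> pattern) \<Rightarrow> (pattern \<Rightarrow> real) \<Rightarrow> bool" where
  "moran_with_frequency pat f \<longleftrightarrow>
     (\<forall>k. valid_pattern (pat k)) \<and>
     bdd_above (range (\<lambda>k. ncols (pat k))) \<and> bdd_above (range (\<lambda>k. nrows (pat k))) \<and>
     (\<forall>\<gamma> \<in> range pat. (\<lambda>N. real (card {k. k < N \<and> pat k = \<gamma>}) / real N) \<longlonglongrightarrow> f \<gamma>) \<and>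
     (\<Sum>\<gamma> \<in> range pat. f \<gamma>) = 1"

definition code_space :: "(nat \<Rightarrow> pattern) \<Rightarrow> (nat \<Rightarrow> nat \<times> nat) set" where
  "code_space pat = (\<Pi>\<^sub>E k\<in>UNIV. digits (pat k))"

definition coding_map :: "(nat \<Rightarrow> pattern) \<Rightarrow> (nat \<Rightarrow> nat \<times> nat) \<Rightarrow> real \<times> real" where
  "coding_map pat w =
     (\<Sum>k. (real (fst (w k)) / (\<Prod>l\<le>k. real (ncols (pat l))),
           real (snd (w k)) / (\<Prod>l\<le>k. real (nrows (pat l)))))"

definition moran_set :: "(nat \<Rightarrow> pattern) \<Rightarrow> (real \<times> real) set" where
  "moran_set pat = coding_map pat ` code_space pat"

definition positive_prob_vectors ::
    "(nat \<Rightarrow> pattern) \<Rightarrow> (pattern \<Rightarrow> nat \<times> nat \<Rightarrow> real) \<Rightarrow> bool" where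
  "positive_prob_vectors pat p \<longleftrightarrow>
     (\<forall>\<gamma> \<in> range pat. (\<forall>w \<in> digits \<gamma>. p \<gamma> w > 0) \<and> (\<Sum>w \<in> digits \<gamma>. p \<gamma> w) = 1)"

definition code_measure ::
    "(nat \<Rightarrow> pattern) \<Rightarrow> (pattern \<Rightarrow> nat \<times> nat \<Rightarrow> real) \<Rightarrow> (nat \<Rightarrow> nat \<times> nat) measure" where
  "code_measure pat p =
     (\<Pi>\<^sub>M k\<in>UNIV. point_measure (digits (pat k)) (\<lambda>w. ennreal (p (pat k) w)))"

definition moran_measure ::
    "(nat \<Rightarrow> pattern) \<Rightarrow> (pattern \<Rightarrow> nat \<times> nat \<Rightarrow> real) \<Rightarrow> (real \<times> real) measure" where
  "moran_measure pat p = distr (code_measure pat p) borel (coding_map pat)"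

lemma space_code_measure: "space (code_measure pat p) = code_space pat"
  by (simp add: code_measure_def code_space_def space_PiM space_point_measure)

lemma emeasure_code_measure_cylinder:
  assumes "\<And>k. valid_pattern (pat k)" "positive_prob_vectors pat p" "w \<in> code_space pat"
  shows "emeasure (code_measure pat p) {v \<in> code_space pat. \<forall>l<k. v l = w l} =
           ennreal (\<Prod>l<k. p (pat l) (w l))"
proof -
  let ?M = "\<lambda>k. point_measure (digits (pat k)) (\<lambda>w. ennreal (p (pat k) w))"
  have fin: "finite (digits (pat k))" for k
    using assms(1)[of k] finite_subset[of "digits (pat k)"] by (auto simp: valid_pattern_def)
  have pos: "p (pat k) v > 0" if "v \<in> digits (pat k)" for k v
    using assms(2) that by (auto simp: positive_prob_vectors_def)
  have one: "(\<Sum>v\<in>digits (pat k). p (pat k) v) = 1" for k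
    using assms(2) by (auto simp: positive_prob_vectors_def)
  have prob: "prob_space (?M k)" for k
  proof
    have "emeasure (?M k) (digits (pat k)) = (\<Sum>v\<in>digits (pat k). ennreal (p (pat k) v))"
      using fin by (subst emeasure_point_measure_finite) auto
    also have "\<dots> = ennreal (\<Sum>v\<in>digits (pat k). p (pat k) v)"
      using pos by (intro sum_ennreal) (auto intro: less_imp_le)
    finally show "emeasure (?M k) (space (?M k)) = 1"
      by (simp add: one space_point_measure)
  qed
  interpret product_prob_space ?M UNIV
    by (simp add: product_prob_spaceI prob)
  have wD: "w l \<in> digits (pat l)" for l
    using assms(3) by (auto simp: code_space_def)
  have eq: "{v \<in> code_space pat. \<forall>l<k. v l = w l} = prod_emb UNIV ?M {..<k} (\<Pi>\<^sub>E l\<in>{..<k}. {w l})"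
    by (auto simp: prod_emb_def code_space_def space_point_measure space_PiM PiE_iff)
  have "emeasure (code_measure pat p) {v \<in> code_space pat. \<forall>l<k. v l = w l} =
      (\<Prod>l<k. emeasure (?M l) {w l})"
    unfolding code_measure_def eq
    by (rule emeasure_PiM_emb) (auto simp: sets_point_measure wD)
  also have "\<dots> = (\<Prod>l<k. ennreal (p (pat l) (w l)))"
    by (rule prod.cong) (auto simp: emeasure_point_measure_finite fin wD)
  also have "\<dots> = ennreal (\<Prod>l<k. p (pat l) (w l))"
    using pos[OF wD] by (intro prod_ennreal) (simp add: less_imp_le)
  finally show ?thesis .
qed

lemma measurable_coding_map: "coding_map pat \<in> borel_measurable (code_measure pat p)"
proof -
  have comp: "(\<lambda>w. g (w k)) \<in> borel_measurable (code_measure pat p)"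
    for g :: "nat \<times> nat \<Rightarrow> real" and k
  proof -
    have "(\<lambda>w. w k) \<in> measurable (code_measure pat p)
        (point_measure (digits (pat k)) (\<lambda>w. ennreal (p (pat k) w)))"
      unfolding code_measure_def by (rule measurable_component_singleton) simp
    moreover have "g \<in> borel_measurable (point_measure (digits (pat k)) (\<lambda>w. ennreal (p (pat k) w)))"
      by (simp add: measurable_point_measure_eq1)
    ultimately show ?thesis by (rule measurable_compose)
  qed
  show ?thesis
    unfolding coding_map_def
    by (intro borel_measurable_suminf borel_measurable_Pair
        comp[of "\<lambda>v. real (fst v) / _"] comp[of "\<lambda>v. real (snd v) / _"])
qed

definition q_row :: "(pattern \<Rightarrow> nat \<times> nat \<Rightarrow> real) \<Rightarrow> pattern \<Rightarrow> nat \<Rightarrow> real" where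
  "q_row p \<gamma> j = (\<Sum>i | (i, j) \<in> digits \<gamma>. p \<gamma> (i, j))"

definition zeta_ratio :: "(nat \<Rightarrow> pattern) \<Rightarrow> (pattern \<Rightarrow> real) \<Rightarrow> real" where
  "zeta_ratio pat f =
     (\<Sum>\<gamma>\<in>range pat. f \<gamma> * ln (real (nrows \<gamma>))) / (\<Sum>\<gamma>\<in>range pat. f \<gamma> * ln (real (ncols \<gamma>)))"

definition u_row :: "(pattern \<Rightarrow> nat \<times> nat \<Rightarrow> real) \<Rightarrow> real \<Rightarrow> pattern \<Rightarrow> nat \<Rightarrow> real" where
  "u_row p t \<gamma> j = q_row p \<gamma> j powr t / (\<Sum>i | (i, j) \<in> digits \<gamma>. p \<gamma> (i, j) powr t)"

definition beta_pattern ::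
    "(pattern \<Rightarrow> nat \<times> nat \<Rightarrow> real) \<Rightarrow> real \<Rightarrow> pattern \<Rightarrow> real \<Rightarrow> real" where
  "beta_pattern p \<zeta> \<gamma> t =
     (THE b. real (nrows \<gamma>) powr (- b) *
        (\<Sum>(i, j)\<in>digits \<gamma>. p \<gamma> (i, j) powr t * u_row p t \<gamma> j powr (1 - \<zeta>)) = 1)"

definition beta_fun ::
    "(nat \<Rightarrow> pattern) \<Rightarrow> (pattern \<Rightarrow> real) \<Rightarrow> (pattern \<Rightarrow> nat \<times> nat \<Rightarrow> real) \<Rightarrow> real \<Rightarrow> real" where
  "beta_fun pat f p t =
     (\<Sum>\<gamma>\<in>range pat. f \<gamma> * beta_pattern p (zeta_ratio pat f) \<gamma> t * ln (real (nrows \<gamma>))) /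
     (\<Sum>\<gamma>\<in>range pat. f \<gamma> * ln (real (nrows \<gamma>)))"

definition digit_weight ::
    "(pattern \<Rightarrow> nat \<times> nat \<Rightarrow> real) \<Rightarrow> real \<Rightarrow> pattern \<Rightarrow> nat \<times> nat \<Rightarrow> real" where
  "digit_weight p \<zeta> \<gamma> w = - \<zeta> * ln (p \<gamma> w) - (1 - \<zeta>) * ln (q_row p \<gamma> (snd w))"

definition alpha_min ::
    "(nat \<Rightarrow> pattern) \<Rightarrow> (pattern \<Rightarrow> real) \<Rightarrow> (pattern \<Rightarrow> nat \<times> nat \<Rightarrow> real) \<Rightarrow> real" where
  "alpha_min pat f p =
     (\<Sum>\<gamma>\<in>range pat. f \<gamma> * Min (digit_weight p (zeta_ratio pat f) \<gamma> ` digits \<gamma>)) /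
     (\<Sum>\<gamma>\<in>range pat. f \<gamma> * ln (real (nrows \<gamma>)))"

definition alpha_max ::
    "(nat \<Rightarrow> pattern) \<Rightarrow> (pattern \<Rightarrow> real) \<Rightarrow> (pattern \<Rightarrow> nat \<times> nat \<Rightarrow> real) \<Rightarrow> real" where
  "alpha_max pat f p =
     (\<Sum>\<gamma>\<in>range pat. f \<gamma> * Max (digit_weight p (zeta_ratio pat f) \<gamma> ` digits \<gamma>)) /
     (\<Sum>\<gamma>\<in>range pat. f \<gamma> * ln (real (nrows \<gamma>)))"

definition spectrum_dim ::
    "(nat \<Rightarrow> pattern) \<Rightarrow> (pattern \<Rightarrow> nat \<times> nat \<Rightarrow> real) \<Rightarrow> real \<Rightarrow> ereal" where
  "spectrum_dim pat p \<alpha> = hausdorff_dim (local_dim_level (moran_measure pat p) \<alpha>)"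

definition affine_digit_map :: "pattern \<Rightarrow> nat \<times> nat \<Rightarrow> real \<times> real \<Rightarrow> real \<times> real" where
  "affine_digit_map \<gamma> w x =
     ((fst x + real (fst w)) / real (ncols \<gamma>), (snd x + real (snd w)) / real (nrows \<gamma>))"

definition RSC :: "(nat \<Rightarrow> pattern) \<Rightarrow> bool" where
  "RSC pat \<longleftrightarrow>
     (\<forall>\<gamma> \<in> range pat. \<forall>(i, j) \<in> digits \<gamma>. \<forall>(i', j') \<in> digits \<gamma>. (i, j) \<noteq> (i', j') \<longrightarrow>
        affine_digit_map \<gamma> (i, j) ` ({0..1} \<times> {0..1}) \<inter>
          affine_digit_map \<gamma> (i', j') ` ({0..1} \<times> {0..1}) = {} \<and>
        \<bar>int j - int j'\<bar> \<noteq> 1)"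

definition TBSC :: "(nat \<Rightarrow> pattern) \<Rightarrow> (pattern \<Rightarrow> real) \<Rightarrow> bool" where
  "TBSC pat f \<longleftrightarrow>
     (\<exists>\<gamma> \<in> range pat. f \<gamma> > 0 \<and>
        ((\<forall>(i, j) \<in> digits \<gamma>. j \<noteq> 0) \<or> (\<forall>(i, j) \<in> digits \<gamma>. j \<noteq> nrows \<gamma> - 1)))"

end

theory Submission
  imports Defs
begin

text \<open>
  Let \<open>L = log_height\<close>, the exponential rate at which row cells shrink.  A point whose code is \<open>w\<close>
  is studied at scale \<open>exp (- L k)\<close> through its approximate square: the codes that share the first
  \<open>level k\<close>, that is about \<open>zeta * k\<close>, digits with \<open>w\<close> and the rows of the first \<open>k\<close> digits.  Its
  width and height agree up to a subexponential factor.  Such factors never affect a dimension, so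
  all geometric comparisons are made up to factors \<open>exp (\<epsilon> k)\<close>.

  For real \<open>t\<close>, the measure is compared with the product measure given by the tilted weights
  \<open>P = p powr t * u powr (1 - zeta) / S\<close>, where \<open>u\<close> depends on the row only and \<open>S\<close> normalises, so
  that the mean of \<open>ln S\<close> is \<open>L * beta t\<close>.  The exponents are chosen such that on every approximate
  square the logarithm of the tilted mass is
  \<open>t * ln (mass) + (U (level k) - zeta * U k) - (sum of ln S)\<close>, where \<open>U\<close> sums \<open>ln u\<close> along the code
  (lemma \<open>tilted_square\<close>).

  Upper bound.  The bracket is at least \<open>- \<epsilon> k\<close> for infinitely many \<open>k\<close>, whatever the code is
  (\<open>frequently_average_scaled_level\<close>, an argument that goes back to McMullen).  Hence each point of
  local dimension \<open>\<alpha>\<close> is, at infinitely many scales, close to an approximate square of tilted mass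
  at least about \<open>exp (- L k (\<alpha> t + beta t))\<close>; there are few such squares, and they cover the level
  set efficiently.  The local dimension is defined by balls, not by squares.  Both separation
  conditions make a small ball meet a single row word (\<open>rows_separated\<close>); it may still meet a few
  neighbouring columns, but the bracket does not depend on them (\<open>square_near_level_point\<close>).

  Lower bound.  By the strong law the bracket is \<open>o(k)\<close> for almost every code under the tilted
  measure, and such codes stay away from the column boundaries (\<open>AE_columns_separated\<close>).  So the
  tilted measure lives on points of local dimension \<open>typical_dim t\<close>, has itself local dimension
  \<open>typical_dim t * t + beta t\<close> there, and the mass distribution principle applies.

  It remains to see that every \<open>\<alpha>\<close> between \<open>alpha_min\<close> and \<open>alpha_max\<close> is \<open>typical_dim t\<close> for some
  \<open>t\<close>.  Gibbs' inequality for the tilted weights shows that \<open>beta\<close> has the tangent of slope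
  \<open>- typical_dim t\<close> at \<open>t\<close>, and that it touches \<open>beta\<close> only at \<open>t\<close> if \<open>alpha_min < alpha_max\<close>
  (\<open>pressure_tangent\<close>, \<open>tangent_beta\<close>).  The formula, the concavity and the differentiability of the
  spectrum then follow from elementary facts about Legendre transforms (\<open>strict_tangents\<close>).
\<close>

section \<open>Hausdorff measure and dimension\<close>

lemma hausdorff_measure_eq_0I:
  assumes "\<And>\<delta> e. \<delta> > 0 \<Longrightarrow> e > 0 \<Longrightarrow>
    \<exists>U :: nat \<Rightarrow> 'a::metric_space set. A \<subseteq> (\<Union>i. U i) \<and>
      (\<forall>i. bounded (U i) \<and> diameter (U i) \<le> \<delta>) \<and> (\<Sum>i. diam_pow s (U i)) \<le> ennreal e"
  shows "hausdorff_measure s A = 0"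
proof -
  have "hausdorff_pre_measure s \<delta> A \<le> 0" if pos: "\<delta> > 0" for \<delta>
  proof (rule ennreal_le_epsilon)
    fix e :: real assume "e > 0"
    then obtain U :: "nat \<Rightarrow> 'a set" where U: "A \<subseteq> (\<Union>i. U i)"
      "\<forall>i. bounded (U i) \<and> diameter (U i) \<le> \<delta>" "(\<Sum>i. diam_pow s (U i)) \<le> ennreal e"
      using assms[OF pos] by blast
    have "hausdorff_pre_measure s \<delta> A \<le> (\<Sum>i. diam_pow s (U i))"
      unfolding hausdorff_pre_measure_def by (rule INF_lower) (use U in auto)
    with U(3) show "hausdorff_pre_measure s \<delta> A \<le> 0 + ennreal e" by simp
  qed
  then have "hausdorff_measure s A \<le> 0"
    unfolding hausdorff_measure_def by (intro SUP_least) auto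
  then show ?thesis by simp
qed

text \<open>
  A Borel--Cantelli principle for covers: the points that lie in members of infinitely many
  \<open>F k\<close> can be covered using only the families beyond any given index, and the cost of these is a
  tail of a convergent series.
\<close>

lemma hausdorff_measure_eq_0_limsup_cover:
  fixes F :: "nat \<Rightarrow> 'a::metric_space set set" and \<delta> :: "nat \<Rightarrow> real"
  assumes "s > 0"
    and fin: "\<And>k. finite (F k)"
    and diam: "\<forall>\<^sub>F k in sequentially. \<forall>U\<in>F k. bounded U \<and> diameter U \<le> \<delta> k"
    and \<delta>: "\<delta> \<longlonglongrightarrow> 0" "\<And>k. \<delta> k > 0"
    and sum: "summable (\<lambda>k. real (card (F k)) * \<delta> k powr s)"
    and cover: "\<And>x. x \<in> A \<Longrightarrow> \<exists>\<^sub>F k in sequentially. x \<in> \<Union>(F k)"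
  shows "hausdorff_measure s A = 0"
proof (rule hausdorff_measure_eq_0I)
  fix d e :: real assume "d > 0" "e > 0"
  let ?a = "\<lambda>k. real (card (F k)) * \<delta> k powr s"
  have "\<forall>\<^sub>F k in sequentially. \<delta> k < d"
    using \<delta>(1) \<open>d > 0\<close> by (rule order_tendstoD)
  with diam have "\<forall>\<^sub>F k in sequentially. (\<forall>U\<in>F k. bounded U \<and> diameter U \<le> \<delta> k) \<and> \<delta> k < d"
    by (rule eventually_conj)
  then obtain K0 where K0: "\<And>k. k \<ge> K0 \<Longrightarrow> (\<forall>U\<in>F k. bounded U \<and> diameter U \<le> \<delta> k) \<and> \<delta> k < d"
    unfolding eventually_sequentially by blast
  obtain K1 where K1: "\<And>k. k \<ge> K1 \<Longrightarrow> \<bar>\<Sum>i. ?a (i + k)\<bar> < e"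
    using suminf_exist_split[OF \<open>e > 0\<close> sum] by auto
  define K where "K = max K0 K1"
  define U where "U i = (let (k, j) = prod_decode i in if j < card (F (k + K)) then
      (SOME g. bij_betw g {..<card (F (k + K))} (F (k + K))) j else {})" for i
  have U_pair: "\<exists>g. bij_betw g {..<card (F (k + K))} (F (k + K)) \<and>
      (\<forall>j. U (prod_encode (k, j)) = (if j < card (F (k + K)) then g j else {}))" for k
  proof -
    have "\<exists>g. bij_betw g {..<card (F (k + K))} (F (k + K))"
      using ex_bij_betw_nat_finite[OF fin[of "k + K"]] by (simp add: atLeast0LessThan)
    then have "bij_betw (SOME g. bij_betw g {..<card (F (k + K))} (F (k + K)))
        {..<card (F (k + K))} (F (k + K))" by (rule someI_ex)
    then show ?thesis by (intro exI conjI) (assumption, simp add: U_def)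
  qed
  show "\<exists>U :: nat \<Rightarrow> 'a set. A \<subseteq> (\<Union>i. U i) \<and> (\<forall>i. bounded (U i) \<and> diameter (U i) \<le> d) \<and>
      (\<Sum>i. diam_pow s (U i)) \<le> ennreal e"
  proof (intro exI[of _ U] conjI allI)
    show "A \<subseteq> (\<Union>i. U i)"
    proof
      fix x assume "x \<in> A"
      then have "\<exists>\<^sub>F k in sequentially. x \<in> \<Union>(F k)" by (rule cover)
      then obtain k where "k \<ge> K" "x \<in> \<Union>(F k)"
        unfolding frequently_sequentially by blast
      then obtain k' V where k': "x \<in> V" "V \<in> F (k' + K)"
        by (metis UnionE le_Suc_ex add.commute)
      obtain g where g: "bij_betw g {..<card (F (k' + K))} (F (k' + K))"
        "\<And>j. U (prod_encode (k', j)) = (if j < card (F (k' + K)) then g j else {})"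
        using U_pair by blast
      obtain j where "j < card (F (k' + K))" "g j = V"
        using g(1) k'(2) unfolding bij_betw_def by (metis imageE lessThan_iff)
      then have "x \<in> U (prod_encode (k', j))" using g(2) k' by simp
      then show "x \<in> (\<Union>i. U i)" by blast
    qed
    fix i
    obtain k j where i: "i = prod_encode (k, j)" by (metis prod_decode_inverse surj_pair)
    obtain g where g: "bij_betw g {..<card (F (k + K))} (F (k + K))"
      "\<And>j. U (prod_encode (k, j)) = (if j < card (F (k + K)) then g j else {})"
      using U_pair by blast
    have "U i = {} \<or> U i \<in> F (k + K)"
      using g unfolding i bij_betw_def by auto
    moreover have "\<forall>U\<in>F (k + K). bounded U \<and> diameter U \<le> d"
      using K0[of "k + K"] by (force simp: K_def)
    ultimately show "bounded (U i)" "diameter (U i) \<le> d"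
      using \<open>d > 0\<close> by auto
  next
    have row: "(\<Sum>j. diam_pow s (U (prod_encode (k, j)))) \<le> ennreal (?a (k + K))" for k
    proof -
      obtain g where g: "bij_betw g {..<card (F (k + K))} (F (k + K))"
        "\<And>j. U (prod_encode (k, j)) = (if j < card (F (k + K)) then g j else {})"
        using U_pair by blast
      have "(\<Sum>j. diam_pow s (U (prod_encode (k, j)))) =
          (\<Sum>j<card (F (k + K)). diam_pow s (U (prod_encode (k, j))))"
        by (rule suminf_finite) (auto simp: g(2) diam_pow_def)
      also have "\<dots> \<le> (\<Sum>j<card (F (k + K)). ennreal (\<delta> (k + K) powr s))"
      proof (rule sum_mono)
        fix j assume "j \<in> {..<card (F (k + K))}"
        then have "U (prod_encode (k, j)) \<in> F (k + K)"
          using g unfolding bij_betw_def by auto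
        then have "bounded (U (prod_encode (k, j)))" "diameter (U (prod_encode (k, j))) \<le> \<delta> (k + K)"
          using K0[of "k + K"] by (auto simp: K_def)
        then show "diam_pow s (U (prod_encode (k, j))) \<le> ennreal (\<delta> (k + K) powr s)"
          using \<open>s > 0\<close> by (auto simp: diam_pow_def intro!: ennreal_leI powr_mono2 diameter_ge_0)
      qed
      also have "\<dots> = ennreal (?a (k + K))"
        by (simp add: ennreal_mult'' ennreal_of_nat_eq_real_of_nat)
      finally show ?thesis .
    qed
    have sumK: "summable (\<lambda>k. ?a (k + K))" using sum by (subst summable_iff_shift)
    have "(\<Sum>i. diam_pow s (U i)) = (\<Sum>k. \<Sum>j. diam_pow s (U (prod_encode (k, j))))"
      using suminf_ennreal_2dimen[where f = "\<lambda>x. diam_pow s (U (prod_encode x))", OF refl]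
      by (simp add: o_def)
    also have "\<dots> \<le> (\<Sum>k. ennreal (?a (k + K)))"
      by (intro suminf_le row) auto
    also have "\<dots> = ennreal (\<Sum>k. ?a (k + K))"
      using sumK by (intro suminf_ennreal2) auto
    also have "\<dots> \<le> ennreal e"
      using K1[of K] by (intro ennreal_leI) (auto simp: K_def)
    finally show "(\<Sum>i. diam_pow s (U i)) \<le> ennreal e" .
  qed
qed

lemma hausdorff_measure_0_coverE:
  assumes "hausdorff_measure s A = 0" "\<delta> > 0" "e > 0"
  obtains U :: "nat \<Rightarrow> 'a::metric_space set" where "A \<subseteq> (\<Union>i. U i)"
    "\<And>i. bounded (U i)" "\<And>i. diameter (U i) \<le> \<delta>" "(\<Sum>i. diam_pow s (U i)) < ennreal e"
proof -
  have "hausdorff_pre_measure s \<delta> A \<le> hausdorff_measure s A"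
    unfolding hausdorff_measure_def by (rule SUP_upper) (use assms in auto)
  also have "\<dots> < ennreal e" using assms by simp
  finally show ?thesis
    unfolding hausdorff_pre_measure_def INF_less_iff using that by auto
qed

text \<open>
  The mass distribution principle.  Each member of a cover that contains a typical point lies in a
  ball around that point whose radius is the diameter of the member, so its mass is bounded by its
  contribution to the Hausdorff sum.  The set of typical points for which the mass bound holds below
  a given radius need not be measurable; it is enclosed in measurable sets of small mass.
\<close>

lemma mass_distribution_principle:
  fixes \<pi> :: "'b \<Rightarrow> 'a::metric_space"
  assumes "prob_space M" and meas: "\<And>x r. {v \<in> space M. \<pi> v \<in> cball x r} \<in> sets M"
    and AE: "AE w in M. \<pi> w \<in> A \<and>
       (\<forall>\<^sub>F r in at_right 0. measure M {v \<in> space M. \<pi> v \<in> cball (\<pi> w) r} \<le> r powr s')"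
    and s: "0 \<le> s" "s < s'"
  shows "hausdorff_measure s A \<noteq> 0"
proof
  interpret prob_space M by fact
  assume null: "hausdorff_measure s A = 0"
  define B where "B x r = {v \<in> space M. \<pi> v \<in> cball x r}" for x r
  define G where "G n = {w \<in> space M. \<pi> w \<in> A \<and>
     (\<forall>r. 0 < r \<and> r \<le> 1 / real (Suc n) \<longrightarrow> measure M (B (\<pi> w) r) \<le> r powr s')}" for n
  have B_meas: "B x r \<in> sets M" for x r unfolding B_def by (rule meas)
  have cover: "\<exists>C \<in> sets M. G n \<subseteq> C \<and> emeasure M C \<le> ennreal e" if "e > 0" for n e
  proof -
    obtain U :: "nat \<Rightarrow> 'a set" where U: "A \<subseteq> (\<Union>i. U i)" "\<And>i. bounded (U i)"
      "\<And>i. diameter (U i) \<le> 1 / real (Suc n)" "(\<Sum>i. diam_pow s (U i)) < ennreal e"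
      by (rule hausdorff_measure_0_coverE[OF null, of "1 / real (Suc n)" e]) (use \<open>e > 0\<close> in auto)
    have piece: "\<exists>C \<in> sets M. {w \<in> G n. \<pi> w \<in> U i} \<subseteq> C \<and> emeasure M C \<le> diam_pow s (U i)" for i
    proof (cases "\<exists>w \<in> G n. \<pi> w \<in> U i")
      case False
      then show ?thesis by (intro bexI[of _ "{}"]) auto
    next
      case True
      then obtain w where w: "w \<in> G n" "\<pi> w \<in> U i" by blast
      define d where "d = diameter (U i)"
      have d: "0 \<le> d" "d \<le> 1 / real (Suc n)" unfolding d_def using U by (auto intro: diameter_ge_0)
      have "{w' \<in> G n. \<pi> w' \<in> U i} \<subseteq> B (\<pi> w) d"
      proof
        fix w' assume "w' \<in> {w' \<in> G n. \<pi> w' \<in> U i}"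
        moreover from this have "dist (\<pi> w) (\<pi> w') \<le> d"
          unfolding d_def using w U(2)[of i] by (intro diameter_bounded_bound) auto
        ultimately show "w' \<in> B (\<pi> w) d" by (auto simp: B_def G_def)
      qed
      moreover have "measure M (B (\<pi> w) d) \<le> (if s = 0 then 1 else d powr s)"
      proof (cases "s = 0 \<or> d > 0")
        case True
        show ?thesis
        proof (cases "s = 0")
          case False
          with True have "d > 0" by simp
          then have "measure M (B (\<pi> w) d) \<le> d powr s'" using w d by (simp add: G_def)
          also have "\<dots> \<le> d powr s"
            using \<open>d > 0\<close> d(2) s order_trans[OF d(2), of 1] by (intro powr_mono') auto
          finally show ?thesis using False by simp
        qed simp
      next
        case False
        then have "d = 0" "s > 0" using d s by auto
        \<comment> \<open>A member of diameter \<open>0\<close> contributes nothing, so its point must have mass \<open>0\<close>.\<close>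
        have "((\<lambda>r. r powr s') \<longlongrightarrow> 0 powr s') (at_right (0::real))"
          by (intro tendsto_powr2 tendsto_intros) (use s in \<open>auto simp: eventually_at_filter\<close>)
        moreover have "\<forall>\<^sub>F r in at_right 0. measure M (B (\<pi> w) d) \<le> r powr s'"
          unfolding eventually_at_right_field
        proof (intro exI[of _ "1 / real (Suc n)"] conjI allI impI)
          fix r :: real assume r: "0 < r" "r < 1 / real (Suc n)"
          have "measure M (B (\<pi> w) d) \<le> measure M (B (\<pi> w) r)"
            using B_meas r \<open>d = 0\<close> by (intro finite_measure_mono) (auto simp: B_def)
          also have "\<dots> \<le> r powr s'" using w r by (auto simp: G_def)
          finally show "measure M (B (\<pi> w) d) \<le> r powr s'" .
        qed simp
        ultimately have "measure M (B (\<pi> w) d) \<le> 0 powr s'"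
          by (intro tendsto_le[OF _ _ tendsto_const]) auto
        then show ?thesis using \<open>s > 0\<close> \<open>d = 0\<close> by simp
      qed
      then have "emeasure M (B (\<pi> w) d) \<le> diam_pow s (U i)"
        using w unfolding emeasure_eq_measure diam_pow_def d_def
        by (auto simp: ennreal_leI simp flip: ennreal_1)
      ultimately show ?thesis using B_meas by blast
    qed
    then obtain C where C: "\<And>i. C i \<in> sets M" "\<And>i. {w \<in> G n. \<pi> w \<in> U i} \<subseteq> C i"
      "\<And>i. emeasure M (C i) \<le> diam_pow s (U i)" by metis
    have "emeasure M (\<Union>i. C i) \<le> (\<Sum>i. emeasure M (C i))"
      using C by (intro emeasure_subadditive_countably) auto
    also have "\<dots> \<le> (\<Sum>i. diam_pow s (U i))" by (intro suminf_le C) auto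
    also have "\<dots> \<le> ennreal e" using U(4) by simp
    finally have "emeasure M (\<Union>i. C i) \<le> ennreal e" .
    moreover have "G n \<subseteq> (\<Union>i. C i)"
    proof
      fix w assume "w \<in> G n"
      moreover from this obtain i where "\<pi> w \<in> U i" using U(1) by (auto simp: G_def)
      ultimately show "w \<in> (\<Union>i. C i)" using C(2) by blast
    qed
    ultimately show ?thesis using C(1) by blast
  qed
  have "\<exists>N\<in>null_sets M. G n \<subseteq> N" for n
  proof -
    obtain C where C: "\<And>i::nat. C i \<in> sets M" "\<And>i. G n \<subseteq> C i"
       "\<And>i. emeasure M (C i) \<le> ennreal (1 / Suc i)"
      using cover[of "1 / Suc _" n] by (metis divide_pos_pos of_nat_0_less_iff zero_less_Suc zero_less_one)
    have "emeasure M (\<Inter>i. C i) \<le> 0"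
    proof (rule ennreal_le_epsilon)
      fix e :: real assume "e > 0"
      then obtain i where i: "1 / real (Suc i) < e" using nat_approx_posE by blast
      have "emeasure M (\<Inter>i. C i) \<le> emeasure M (C i)" using C by (intro emeasure_mono) auto
      also have "\<dots> \<le> ennreal (1 / Suc i)" by (rule C)
      also have "\<dots> \<le> ennreal e" using i by (intro ennreal_leI) auto
      finally show "emeasure M (\<Inter>i. C i) \<le> 0 + ennreal e" by simp
    qed
    then show ?thesis using C by (intro bexI[of _ "\<Inter>i. C i"]) (auto simp: null_sets_def)
  qed
  then have "AE w in M. w \<notin> G n" for n
    using AE_I'[of _ M "\<lambda>w. w \<notin> G n"] by (metis (mono_tags, lifting) mem_Collect_eq subset_eq)
  then have "AE w in M. \<forall>n. w \<notin> G n"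
    unfolding AE_all_countable by blast
  moreover have "AE w in M. \<exists>n. w \<in> G n"
    using AE
  proof (rule AE_mp, intro AE_I2 impI)
    fix w assume w: "w \<in> space M" "\<pi> w \<in> A \<and>
       (\<forall>\<^sub>F r in at_right 0. measure M {v \<in> space M. \<pi> v \<in> cball (\<pi> w) r} \<le> r powr s')"
    then obtain b where "b > 0" and b: "\<And>r. 0 < r \<Longrightarrow> r < b \<Longrightarrow> measure M (B (\<pi> w) r) \<le> r powr s'"
      unfolding eventually_at_right_field B_def by auto
    then obtain n where "1 / real (Suc n) < b" using nat_approx_posE by blast
    then have "w \<in> G n" unfolding G_def using w b by auto
    then show "\<exists>n. w \<in> G n" ..
  qed
  ultimately have "AE w in M. False" by eventually_elim auto
  then show False by simp
qed

lemma hausdorff_dim_eqI: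
  assumes "0 \<le> d" "\<And>s. s > d \<Longrightarrow> hausdorff_measure s A = 0"
    and "\<And>s. 0 \<le> s \<Longrightarrow> s < d \<Longrightarrow> hausdorff_measure s A \<noteq> 0"
  shows "hausdorff_dim A = ereal d"
  unfolding hausdorff_dim_def
proof (rule antisym)
  show "(INF s \<in> {s. 0 \<le> s \<and> hausdorff_measure s A = 0}. ereal s) \<le> ereal d"
  proof (rule ereal_le_epsilon2)
    fix e :: real assume "0 < e"
    then show "(INF s \<in> {s. 0 \<le> s \<and> hausdorff_measure s A = 0}. ereal s) \<le> ereal d + ereal e"
      using assms(1,2) by (auto intro!: INF_lower2[of "d + e"])
  qed
  show "ereal d \<le> (INF s \<in> {s. 0 \<le> s \<and> hausdorff_measure s A = 0}. ereal s)"
    using assms(3) by (intro INF_greatest) (force simp: not_less[symmetric])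
qed

section \<open>Expansions with variable bases\<close>

definition base_prod :: "(nat \<Rightarrow> nat) \<Rightarrow> nat \<Rightarrow> real" where
  "base_prod b k = (\<Prod>l<k. real (b l))"

definition digit_value :: "(nat \<Rightarrow> nat) \<Rightarrow> (nat \<Rightarrow> nat) \<Rightarrow> real" where
  "digit_value b d = (\<Sum>l. real (d l) / base_prod b (Suc l))"

text \<open>
  The number of the cell of order \<open>k\<close>, counted from \<open>0\<close>: a value whose expansion begins with
  \<open>d 0, \<dots>, d (k - 1)\<close> lies in the cell \<open>[c / base_prod b k, (c + 1) / base_prod b k]\<close>.
\<close>

fun cell_number :: "(nat \<Rightarrow> nat) \<Rightarrow> (nat \<Rightarrow> nat) \<Rightarrow> nat \<Rightarrow> nat" where
  "cell_number b d 0 = 0"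
| "cell_number b d (Suc k) = cell_number b d k * b k + d k"

definition expansion :: "(nat \<Rightarrow> nat) \<Rightarrow> (nat \<Rightarrow> nat) \<Rightarrow> bool" where
  "expansion b d \<longleftrightarrow> (\<forall>l. 2 \<le> b l \<and> d l < b l)"

definition expansion_tail :: "(nat \<Rightarrow> nat) \<Rightarrow> (nat \<Rightarrow> nat) \<Rightarrow> nat \<Rightarrow> real" where
  "expansion_tail b d k = (\<Sum>l. real (d (l + k)) / base_prod b (Suc (l + k)))"

lemma base_prod_Suc: "base_prod b (Suc k) = base_prod b k * real (b k)"
  by (simp add: base_prod_def)

lemma base_prod_pos: "expansion b d \<Longrightarrow> base_prod b k > 0"
  unfolding base_prod_def expansion_def by (intro prod_pos) (metis of_nat_0_less_iff zero_less_numeral order_less_le_trans)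

lemma base_prod_ge: "expansion b d \<Longrightarrow> base_prod b k \<ge> 2 ^ k"
proof (induction k)
  case (Suc k)
  then have "2 ^ k * 2 \<le> base_prod b k * real (b k)"
    by (intro mult_mono less_imp_le[OF base_prod_pos]) (auto simp: expansion_def)
  then show ?case by (simp add: base_prod_Suc mult.commute)
qed (simp add: base_prod_def)

lemma tendsto_inverse_base_prod: "expansion b d \<Longrightarrow> (\<lambda>k. 1 / base_prod b k) \<longlonglongrightarrow> 0"
proof (rule tendsto_sandwich[of "\<lambda>_. 0" _ _ "\<lambda>k. (1 / 2) ^ k"])
  assume d: "expansion b d"
  show "\<forall>\<^sub>F k in sequentially. 0 \<le> 1 / base_prod b k"
    using base_prod_pos[OF d] by (simp add: less_imp_le)
  show "\<forall>\<^sub>F k in sequentially. 1 / base_prod b k \<le> (1 / 2) ^ k"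
    using base_prod_ge[OF d] base_prod_pos[OF d] by (intro always_eventually allI) (simp add: power_one_over divide_simps)
qed (auto intro: LIMSEQ_power_zero)

lemma full_digits_sums:
  assumes "expansion b d"
  shows "(\<lambda>l. real (b (l + k) - 1) / base_prod b (Suc (l + k))) sums (1 / base_prod b k)"
proof -
  have "(\<lambda>l. 1 / base_prod b (l + k)) \<longlonglongrightarrow> 0"
    using tendsto_inverse_base_prod[OF assms] by (rule LIMSEQ_ignore_initial_segment)
  from telescope_sums'[OF this] have
    "(\<lambda>l. 1 / base_prod b (l + k) - 1 / base_prod b (Suc l + k)) sums (1 / base_prod b k)" by simp
  moreover have "1 / base_prod b (l + k) - 1 / base_prod b (Suc l + k) =
      real (b (l + k) - 1) / base_prod b (Suc (l + k))" for l
  proof -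
    have "b (l + k) \<ge> 2" using assms by (auto simp: expansion_def)
    then show ?thesis
      using base_prod_pos[OF assms, of "l + k"] by (simp add: base_prod_Suc of_nat_diff field_simps)
  qed
  ultimately show ?thesis by simp
qed

lemma summable_expansion:
  assumes "expansion b d"
  shows "summable (\<lambda>l. real (d (l + k)) / base_prod b (Suc (l + k)))"
proof (rule summable_comparison_test'[OF sums_summable[OF full_digits_sums[OF assms, of k]]])
  fix l
  have "d (l + k) \<le> b (l + k) - 1" using assms by (auto simp: expansion_def intro: diff_le_mono dest: spec[of _ "l + k"])
  then show "norm (real (d (l + k)) / base_prod b (Suc (l + k))) \<le> real (b (l + k) - 1) / base_prod b (Suc (l + k))"
    using base_prod_pos[OF assms, of "Suc (l + k)"] by (simp add: divide_right_mono)
qed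

lemma digit_value_split:
  assumes "expansion b d"
  shows "digit_value b d = real (cell_number b d k) / base_prod b k + expansion_tail b d k"
proof -
  have "(\<Sum>l<k. real (d l) / base_prod b (Suc l)) = real (cell_number b d k) / base_prod b k" for k
  proof (induction k)
    case (Suc k)
    have "real (b k) > 0" using assms by (auto simp: expansion_def dest: spec[of _ k])
    then show ?case using Suc base_prod_pos[OF assms, of k]
      by (simp add: base_prod_Suc field_simps)
  qed simp
  with suminf_split_initial_segment[OF summable_expansion[OF assms, of 0, simplified], of k]
  show ?thesis by (simp add: digit_value_def expansion_tail_def)
qed

lemma expansion_tail_ge_digit:
  assumes "expansion b d" "k \<le> k'"
  shows "expansion_tail b d k \<ge> real (d k') / base_prod b (Suc k')"
proof -
  have "(\<Sum>l\<in>{k' - k}. real (d (l + k)) / base_prod b (Suc (l + k))) \<le> expansion_tail b d k"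
    unfolding expansion_tail_def
    using base_prod_pos[OF assms(1)] by (intro sum_le_suminf summable_expansion assms) (auto intro: divide_nonneg_pos)
  then show ?thesis using assms by simp
qed

text \<open>Complementing all digits reflects the expansion, which turns lower bounds into upper bounds.\<close>

lemma expansion_tail_complement:
  assumes "expansion b d"
  shows "expansion b (\<lambda>l. b l - 1 - d l)"
    and "expansion_tail b d k + expansion_tail b (\<lambda>l. b l - 1 - d l) k = 1 / base_prod b k"
proof -
  let ?c = "\<lambda>l. b l - 1 - d l"
  show c: "expansion b ?c" 
    using assms unfolding expansion_def by (metis diff_le_self diff_less less_le_trans not_less zero_less_diff zero_less_one le_less_trans gr0I)
  have eq: "real (d l) + real (?c l) = real (b l - 1)" for l
    using assms by (auto simp: expansion_def of_nat_diff dest: spec[of _ l] simp flip: of_nat_add)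
  have "expansion_tail b d k + expansion_tail b ?c k =
     (\<Sum>l. real (d (l + k)) / base_prod b (Suc (l + k)) + real (?c (l + k)) / base_prod b (Suc (l + k)))"
    unfolding expansion_tail_def by (rule suminf_add[OF summable_expansion[OF assms] summable_expansion[OF c]])
  also have "\<dots> = 1 / base_prod b k"
    unfolding add_divide_distrib[symmetric] eq by (rule sums_unique[OF full_digits_sums[OF assms], symmetric])
  finally show "expansion_tail b d k + expansion_tail b ?c k = 1 / base_prod b k" .
qed

lemma expansion_tail_bounds:
  assumes "expansion b d"
  shows "0 \<le> expansion_tail b d k" "expansion_tail b d k \<le> 1 / base_prod b k"
proof -
  have nonneg: "0 \<le> expansion_tail b e k" if "expansion b e" for e
    using order_trans[OF _ expansion_tail_ge_digit[OF that order_refl], of 0 k] base_prod_pos[OF that, of "Suc k"] by simp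
  show "0 \<le> expansion_tail b d k" by (rule nonneg[OF assms])
  show "expansion_tail b d k \<le> 1 / base_prod b k"
    using nonneg[OF expansion_tail_complement(1)[OF assms]] expansion_tail_complement(2)[OF assms, of k] by simp
qed

lemma cell_number_eq_iff:
  assumes "expansion b d" "expansion b e"
  shows "cell_number b d k = cell_number b e k \<longleftrightarrow> (\<forall>l<k. d l = e l)"
proof (induction k)
  case (Suc k)
  have lt: "d k < b k" "e k < b k" using assms by (auto simp: expansion_def)
  have "cell_number b d k = cell_number b e k \<and> d k = e k"
    if "cell_number b d k * b k + d k = cell_number b e k * b k + e k"
  proof -
    have "(cell_number b d k * b k + d k) div b k = (cell_number b e k * b k + e k) div b k"
         "(cell_number b d k * b k + d k) mod b k = (cell_number b e k * b k + e k) mod b k"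
      using that by simp_all
    then show ?thesis using lt by simp
  qed
  then show ?case using Suc by (auto simp: less_Suc_eq)
qed simp

text \<open>
  Values in adjacent cells of order \<open>k\<close> are close only if the larger one continues with zeros and
  the smaller one with maximal digits; any other digit at a place \<open>k'\<close> keeps them apart.
\<close>

lemma digit_value_gap:
  assumes d: "expansion b d" and e: "expansion b e" and gt: "cell_number b d k > cell_number b e k"
    and "k \<le> k'" "d k' \<noteq> 0 \<or> e k' \<noteq> b k' - 1"
  shows "digit_value b d - digit_value b e \<ge> 1 / base_prod b (Suc k')"
proof -
  let ?B = "base_prod b k"
  have pos: "?B > 0" "base_prod b (Suc k') > 0" using base_prod_pos[OF d] by auto
  have "real (cell_number b d k) / ?B \<ge> (real (cell_number b e k) + 1) / ?B"
    using gt pos by (intro divide_right_mono) auto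
  then have "digit_value b d - digit_value b e \<ge> 1 / ?B + expansion_tail b d k - expansion_tail b e k"
    using digit_value_split[OF d, of k] digit_value_split[OF e, of k] by (simp add: add_divide_distrib)
  also have "1 / ?B - expansion_tail b e k = expansion_tail b (\<lambda>l. b l - 1 - e l) k"
    using expansion_tail_complement(2)[OF e, of k] by simp
  then have "1 / ?B + expansion_tail b d k - expansion_tail b e k =
      expansion_tail b d k + expansion_tail b (\<lambda>l. b l - 1 - e l) k" by simp
  finally have main: "digit_value b d - digit_value b e \<ge>
      expansion_tail b d k + expansion_tail b (\<lambda>l. b l - 1 - e l) k" .
  have c: "expansion b (\<lambda>l. b l - 1 - e l)" by (rule expansion_tail_complement(1)[OF e])
  have "1 / base_prod b (Suc k') \<le> expansion_tail b d k + expansion_tail b (\<lambda>l. b l - 1 - e l) k"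
  proof (cases "d k' = 0")
    case False
    then have "1 / base_prod b (Suc k') \<le> real (d k') / base_prod b (Suc k')"
      using pos by (intro divide_right_mono) auto
    then show ?thesis
      using expansion_tail_ge_digit[OF d \<open>k \<le> k'\<close>] expansion_tail_bounds(1)[OF c, of k] by linarith
  next
    case True
    then have "b k' - 1 - e k' \<ge> 1"
      using assms(5) e by (auto simp: expansion_def dest: spec[of _ k'])
    then have "1 / base_prod b (Suc k') \<le> real (b k' - 1 - e k') / base_prod b (Suc k')"
      using pos by (intro divide_right_mono) auto
    then show ?thesis
      using expansion_tail_ge_digit[OF c \<open>k \<le> k'\<close>] expansion_tail_bounds(1)[OF d, of k] by linarith
  qed
  with main show ?thesis by linarith
qed

text \<open>
  A distance of two cells survives every refinement: the coarser distance is multiplied by the base,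
  and the new digits differ by less than the base.
\<close>

lemma cell_number_gap:
  assumes "expansion b d" "expansion b e" and ne: "\<And>l. l < k \<Longrightarrow> \<bar>int (d l) - int (e l)\<bar> \<noteq> 1"
    and "\<exists>l<k. d l \<noteq> e l"
  shows "\<bar>int (cell_number b d k) - int (cell_number b e k)\<bar> \<ge> 2"
  using ne assms(4)
proof (induction k)
  case (Suc k)
  define D where "D = int (cell_number b d k) - int (cell_number b e k)"
  have b: "2 \<le> int (b k)" "\<bar>int (d k) - int (e k)\<bar> \<le> int (b k) - 1"
    using assms(1,2) by (auto simp: expansion_def dest!: spec[of _ k])
  have eq: "int (cell_number b d (Suc k)) - int (cell_number b e (Suc k)) = D * int (b k) + (int (d k) - int (e k))"
    by (simp add: D_def algebra_simps)
  show ?case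
  proof (cases "\<exists>l<k. d l \<noteq> e l")
    case True
    then have "\<bar>D\<bar> \<ge> 2" unfolding D_def using Suc by auto
    then have "\<bar>D * int (b k)\<bar> \<ge> 2 * int (b k)" using b by (simp add: abs_mult mult_right_mono)
    then show ?thesis unfolding eq using b by linarith
  next
    case False
    then have "D = 0" "d k \<noteq> e k"
      using cell_number_eq_iff[OF assms(1,2), of k] Suc.prems by (auto simp: D_def less_Suc_eq)
    then show ?thesis unfolding eq using Suc.prems(1)[of k] by simp
  qed
qed simp

lemma digit_value_gap_of_cell_gap:
  assumes "expansion b d" "expansion b e"
    and gap: "\<bar>int (cell_number b d k) - int (cell_number b e k)\<bar> \<ge> 2"
  shows "\<bar>digit_value b d - digit_value b e\<bar> \<ge> 1 / base_prod b k"
proof -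
  have *: "digit_value b d - digit_value b e \<ge> 1 / base_prod b k"
    if d: "expansion b d" and e: "expansion b e" and "cell_number b d k \<ge> cell_number b e k + 2" for d e
  proof -
    have "real (cell_number b d k) / base_prod b k \<ge> (real (cell_number b e k) + 2) / base_prod b k"
      using that base_prod_pos[OF d, of k] by (intro divide_right_mono) auto
    then show ?thesis
      using digit_value_split[OF d, of k] digit_value_split[OF e, of k]
        expansion_tail_bounds[OF d, of k] expansion_tail_bounds[OF e, of k]
      by (simp add: add_divide_distrib)
  qed
  show ?thesis
    using *[OF assms(1,2)] *[OF assms(2,1)] gap by linarith
qed

lemma digit_value_close:
  assumes "expansion b d" "expansion b e" "\<forall>l<k. d l = e l"
  shows "\<bar>digit_value b d - digit_value b e\<bar> \<le> 1 / base_prod b k"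
  using digit_value_split[OF assms(1), of k] digit_value_split[OF assms(2), of k]
    expansion_tail_bounds[OF assms(1), of k] expansion_tail_bounds[OF assms(2), of k]
    cell_number_eq_iff[OF assms(1,2), of k] assms(3) by (simp; linarith)

lemma cell_number_close:
  assumes d: "expansion b d" and e: "expansion b e"
    and close: "\<bar>digit_value b d - digit_value b e\<bar> \<le> 1 / base_prod b k"
  shows "\<bar>int (cell_number b d k) - int (cell_number b e k)\<bar> \<le> 2"
proof -
  let ?B = "base_prod b k"
  have B: "?B > 0" by (rule base_prod_pos[OF d])
  have "\<bar>real (cell_number b d k) / ?B - real (cell_number b e k) / ?B\<bar> \<le> 2 / ?B"
    using close digit_value_split[OF d, of k] digit_value_split[OF e, of k]
      expansion_tail_bounds[OF d, of k] expansion_tail_bounds[OF e, of k] by (simp; linarith)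
  then have "\<bar>real (cell_number b d k) - real (cell_number b e k)\<bar> / ?B \<le> 2 / ?B"
    using B by (simp add: diff_divide_distrib[symmetric])
  then have "\<bar>real (cell_number b d k) - real (cell_number b e k)\<bar> \<le> 2"
    using B by (simp add: divide_le_cancel)
  then show ?thesis by linarith
qed

section \<open>Averages along a sequence\<close>

text \<open>
  If the averages of \<open>a\<close> have a nonzero limit, the next nonzero place after \<open>k\<close> is \<open>k + o(k)\<close>: the
  partial sums of \<open>a\<close> at \<open>k\<close> and at that place \<open>n k\<close> coincide, so the quotient of the two averages,
  which tends to \<open>1\<close>, equals \<open>n k / k\<close>.
\<close>

lemma nonzero_place_soon:
  fixes a g :: "nat \<Rightarrow> real"
  assumes a: "(\<lambda>k. (\<Sum>i<k. a i) / real k) \<longlonglongrightarrow> c" "c \<noteq> 0"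
    and g: "(\<lambda>k. g k / real k) \<longlonglongrightarrow> \<rho>" and "\<epsilon> > 0"
  shows "\<forall>\<^sub>F k in sequentially. \<exists>k'\<ge>k. a k' \<noteq> 0 \<and> g (Suc k') < (\<rho> + \<epsilon>) * real k"
proof -
  let ?S = "\<lambda>k. \<Sum>i<k. a i"
  have const: "?S n = ?S k" if "k \<le> n" "\<And>i. k \<le> i \<Longrightarrow> i < n \<Longrightarrow> a i = 0" for k n
    using that by (intro sum.mono_neutral_right) auto
  have ex: "\<exists>i\<ge>k. a i \<noteq> 0" for k
  proof (rule ccontr)
    assume "\<not> (\<exists>i\<ge>k. a i \<noteq> 0)"
    then have eq: "?S n = ?S k" if "n \<ge> k" for n using const that by auto
    have "(\<lambda>n. ?S k / real n) \<longlonglongrightarrow> 0" by (rule lim_const_over_n)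
    moreover have "\<forall>\<^sub>F n in sequentially. ?S k / real n = ?S n / real n"
      using eventually_ge_at_top[of k] by eventually_elim (metis eq)
    ultimately have "(\<lambda>n. ?S n / real n) \<longlonglongrightarrow> 0" by (rule Lim_transform_eventually)
    with a show False using LIMSEQ_unique by blast
  qed
  define n where "n k = (LEAST i. k \<le> i \<and> a i \<noteq> 0)" for k
  have n: "k \<le> n k" "a (n k) \<noteq> 0" for k
    using LeastI_ex[of "\<lambda>i. k \<le> i \<and> a i \<noteq> 0"] ex unfolding n_def by blast+
  have "a i = 0" if "k \<le> i" "i < n k" for i k
    using not_less_Least[of i "\<lambda>i. k \<le> i \<and> a i \<noteq> 0"] that unfolding n_def by blast
  then have S_n: "?S (n k) = ?S k" for k using n(1) const by blast
  have n_top: "filterlim n at_top sequentially"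
    using n(1) by (intro filterlim_at_top_mono[OF filterlim_ident]) auto
  have "(\<lambda>k. (?S k / real k) / (?S (n k) / real (n k))) \<longlonglongrightarrow> c / c"
    by (intro tendsto_divide a filterlim_compose[OF a(1) n_top])
  moreover have "\<forall>\<^sub>F k in sequentially. ?S k / real k \<noteq> 0"
    using tendsto_imp_eventually_ne[OF a] .
  then have "\<forall>\<^sub>F k in sequentially. (?S k / real k) / (?S (n k) / real (n k)) = real (n k) / real k"
    by eventually_elim (simp add: S_n)
  ultimately have n_k: "(\<lambda>k. real (n k) / real k) \<longlonglongrightarrow> 1"
    using Lim_transform_eventually \<open>c \<noteq> 0\<close> by fastforce
  have "(\<lambda>k. (g (Suc (n k)) / real (Suc (n k))) * (real (n k) / real k + 1 / real k)) \<longlonglongrightarrow> \<rho> * (1 + 0)"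
    by (intro tendsto_mult tendsto_add n_k lim_const_over_n[of 1, simplified]
          filterlim_compose[OF g filterlim_compose[OF filterlim_Suc n_top]])
  moreover have "(g (Suc (n k)) / real (Suc (n k))) * (real (n k) / real k + 1 / real k) = g (Suc (n k)) / real k" for k
  proof -
    have "real (n k) / real k + 1 / real k = real (Suc (n k)) / real k" by (simp add: add_divide_distrib)
    then show ?thesis by (simp del: of_nat_Suc)
  qed
  ultimately have "(\<lambda>k. g (Suc (n k)) / real k) \<longlonglongrightarrow> \<rho>" by simp
  then have "\<forall>\<^sub>F k in sequentially. g (Suc (n k)) / real k < \<rho> + \<epsilon>"
    using \<open>\<epsilon> > 0\<close> by (intro order_tendstoD) auto
  with eventually_gt_at_top[of 0] show ?thesis
  proof eventually_elim
    case (elim k)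
    then have "g (Suc (n k)) < (\<rho> + \<epsilon>) * real k" by (simp add: divide_less_eq)
    then show ?case using n[of k] by blast
  qed
qed

definition scaled_level :: "real \<Rightarrow> nat \<Rightarrow> nat" where
  "scaled_level z k = nat \<lfloor>z * real k\<rfloor>"

lemma scaled_level_bounds:
  assumes "z \<ge> 0"
  shows "real (scaled_level z k) \<le> z * real k" "z * real k < real (scaled_level z k) + 1"
proof -
  have "0 \<le> \<lfloor>z * real k\<rfloor>" using assms by simp
  then show "real (scaled_level z k) \<le> z * real k" "z * real k < real (scaled_level z k) + 1"
    unfolding scaled_level_def using floor_correct[of "z * real k"] by (simp_all add: of_nat_nat)
qed

lemma scaled_level_le: "0 \<le> z \<Longrightarrow> z \<le> 1 \<Longrightarrow> scaled_level z k \<le> k"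
  using scaled_level_bounds(1)[of z k] mult_right_mono[of z 1 "real k"] by linarith

lemma scaled_level_tendsto:
  assumes "z \<ge> 0"
  shows "(\<lambda>k. real (scaled_level z k) / real k) \<longlonglongrightarrow> z"
proof (rule tendsto_sandwich[of "\<lambda>k. z - 1 / real k" _ _ "\<lambda>_. z"])
  have "(\<lambda>k. z - 1 / real k) \<longlonglongrightarrow> z - 0" by (intro tendsto_intros lim_const_over_n[of 1, simplified])
  then show "(\<lambda>k. z - 1 / real k) \<longlonglongrightarrow> z" by simp
  show "\<forall>\<^sub>F k in sequentially. z - 1 / real k \<le> real (scaled_level z k) / real k"
    using eventually_gt_at_top[of 0]
  proof eventually_elim
    case (elim k)
    have "z - 1 / real k = (z * real k - 1) / real k" using elim by (simp add: field_simps)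
    also have "\<dots> \<le> real (scaled_level z k) / real k"
      using scaled_level_bounds(2)[OF assms, of k] by (intro divide_right_mono) auto
    finally show ?case .
  qed
  show "\<forall>\<^sub>F k in sequentially. real (scaled_level z k) / real k \<le> z"
    using eventually_gt_at_top[of 0]
    by eventually_elim (use scaled_level_bounds(1)[OF assms] in \<open>auto simp: field_simps\<close>)
qed simp

lemma scaled_level_top:
  assumes "z > 0"
  shows "filterlim (scaled_level z) at_top sequentially"
proof -
  have "filterlim (\<lambda>k. z * real k) at_top sequentially"
    using assms filterlim_real_sequentially by (intro filterlim_tendsto_pos_mult_at_top[OF tendsto_const])
  then show ?thesis unfolding scaled_level_def
    by (intro filterlim_compose[OF filterlim_nat_sequentially] filterlim_compose[OF filterlim_floor_sequentially])
qed

lemma tendsto_average_scaled_level: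
  assumes "(\<lambda>k. g k / real k) \<longlonglongrightarrow> c" "z > 0"
  shows "(\<lambda>k. g (scaled_level z k) / real k) \<longlonglongrightarrow> z * c"
proof -
  have "(\<lambda>k. (real (scaled_level z k) / real k) * (g (scaled_level z k) / real (scaled_level z k))) \<longlonglongrightarrow> z * c"
    using assms by (intro tendsto_mult scaled_level_tendsto filterlim_compose[OF assms(1) scaled_level_top]) auto
  moreover have "\<forall>\<^sub>F k in sequentially. (real (scaled_level z k) / real k) * (g (scaled_level z k) / real (scaled_level z k))
      = g (scaled_level z k) / real k"
    using eventually_compose_filterlim[OF eventually_gt_at_top[of 0] scaled_level_top[OF assms(2)]]
    by eventually_elim simp
  ultimately show ?thesis by (rule Lim_transform_eventually)
qed

text \<open>
  The averages \<open>A k\<close> of a bounded sequence cannot satisfy \<open>A (scaled_level z k) < A k - c\<close> for all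
  large \<open>k\<close> with a constant \<open>c > 0\<close>.  Every index is of the form \<open>scaled_level z k\<close> with a larger \<open>k\<close>, so
  the supremum \<open>s\<close> of a tail of the averages would satisfy \<open>s \<le> s - c\<close>.
\<close>

lemma frequently_average_scaled_level:
  fixes a :: "nat \<Rightarrow> real"
  assumes z: "0 < z" "z \<le> 1" and C: "\<And>i. \<bar>a i\<bar> \<le> C" and "\<epsilon> > 0"
  shows "\<exists>\<^sub>F k in sequentially. (\<Sum>i<scaled_level z k. a i) - z * (\<Sum>i<k. a i) \<ge> - \<epsilon> * real k"
proof (rule ccontr)
  let ?S = "\<lambda>k. \<Sum>i<k. a i" and ?l = "scaled_level z"
  define A where "A k = ?S k / real k" for k
  have S_le: "\<bar>?S k\<bar> \<le> C * real k" for k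
    using order_trans[OF sum_abs sum_bounded_above[of "{..<k}" "\<lambda>i. \<bar>a i\<bar>" C]] C by (simp add: mult.commute)
  have "C \<ge> 0" using C[of 0] by linarith
  have A_le: "\<bar>A k\<bar> \<le> C" for k
    using S_le[of k] \<open>C \<ge> 0\<close> by (cases "k = 0") (auto simp: A_def abs_divide divide_le_eq)
  assume "\<not> ?thesis"
  then have "\<forall>\<^sub>F k in sequentially. ?S (?l k) - z * ?S k < - \<epsilon> * real k"
    by (simp add: frequently_def not_le)
  moreover have "\<forall>\<^sub>F k in sequentially. real k > 2 * C / \<epsilon>"
    by (rule eventually_gt_at_top[THEN eventually_compose_filterlim[OF _ filterlim_real_sequentially]])
  moreover have "\<forall>\<^sub>F k in sequentially. ?l k > 0"
    by (rule eventually_compose_filterlim[OF eventually_gt_at_top scaled_level_top[OF z(1)]])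
  ultimately have "\<forall>\<^sub>F k in sequentially. A (?l k) \<le> A k - \<epsilon> / 2"
    using eventually_gt_at_top[of 0]
  proof eventually_elim
    case (elim k)
    have l: "real (?l k) \<le> z * real k" "z * real k < real (?l k) + 1"
      using scaled_level_bounds[of z k] z by auto
    have "?S (?l k) = A (?l k) * real (?l k)" using elim by (simp add: A_def)
    also have "\<dots> = A (?l k) * (z * real k) - A (?l k) * (z * real k - real (?l k))" by (simp add: algebra_simps)
    \<comment> \<open>Rounding \<open>z * k\<close> to the integer \<open>scaled_level z k\<close> costs at most \<open>C\<close>.\<close>
    finally have S_l: "?S (?l k) = A (?l k) * (z * real k) - A (?l k) * (z * real k - real (?l k))" .
    have "?S (?l k) \<ge> A (?l k) * (z * real k) - C"
    proof -
      have "A (?l k) * (z * real k - real (?l k)) \<le> \<bar>A (?l k)\<bar> * \<bar>z * real k - real (?l k)\<bar>"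
        by (metis abs_ge_self abs_mult)
      also have "\<dots> \<le> C * 1" using A_le[of "?l k"] l \<open>C \<ge> 0\<close> by (intro mult_mono) auto
      finally show ?thesis using S_l by linarith
    qed
    moreover have "?S k = A k * real k" using elim by (simp add: A_def)
    moreover have "2 * C < \<epsilon> * real k" using elim(2) \<open>\<epsilon> > 0\<close> by (simp add: divide_less_eq mult.commute)
    ultimately have "z * real k * A (?l k) < z * real k * A k - \<epsilon> / 2 * real k"
      using elim(1) by (simp add: algebra_simps)
    also have "\<dots> \<le> z * real k * A k - \<epsilon> / 2 * (z * real k)"
      using z \<open>\<epsilon> > 0\<close> elim by (simp add: mult_le_cancel_right1)
    also have "\<dots> = z * real k * (A k - \<epsilon> / 2)" by (simp add: algebra_simps)
    finally show ?case using z elim(4) by (simp add: mult_less_cancel_left)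
  qed
  then obtain K where K: "\<And>k. k \<ge> K \<Longrightarrow> A (?l k) \<le> A k - \<epsilon> / 2"
    unfolding eventually_sequentially by blast
  define s where "s = (SUP k\<in>{K..}. A k)"
  have bdd: "bdd_above (A ` {K..})" using A_le by (intro bdd_aboveI[of _ C]) (auto simp: abs_le_iff)
  have "A m \<le> s - \<epsilon> / 2" if "m \<ge> K" for m
  proof -
    define k where "k = nat \<lceil>real m / z\<rceil>"
    have k: "real m / z \<le> real k" "real k < real m / z + 1"
      unfolding k_def using z by (auto simp: of_nat_ceiling) linarith
    then have "real m \<le> z * real k" "z * real k < real m + z"
      using z by (auto simp: field_simps)
    then have "\<lfloor>z * real k\<rfloor> = int m" using z by (intro floor_unique) auto
    then have "?l k = m" by (simp add: scaled_level_def)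
    moreover have "real m \<le> real k" using \<open>real m \<le> z * real k\<close> z mult_right_mono[of z 1 "real k"] by linarith
    ultimately have "A m \<le> A k - \<epsilon> / 2" "k \<ge> K" using K[of k] that by auto
    then show ?thesis using cSUP_upper[OF _ bdd, of k] by (auto simp: s_def)
  qed
  then have "s \<le> s - \<epsilon> / 2" unfolding s_def by (intro cSUP_least) (auto simp: s_def)
  then show False using \<open>\<epsilon> > 0\<close> by linarith
qed

section \<open>Patterns with frequencies\<close>

locale moran_structure =
  fixes pat :: "nat \<Rightarrow> pattern" and f :: "pattern \<Rightarrow> real"
  assumes moran: "moran_with_frequency pat f"
begin

abbreviation mean :: "(pattern \<Rightarrow> real) \<Rightarrow> real" where
  "mean h \<equiv> \<Sum>\<gamma>\<in>range pat. f \<gamma> * h \<gamma>"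

abbreviation log_height :: real where "log_height \<equiv> mean (\<lambda>\<gamma>. ln (real (nrows \<gamma>)))"
abbreviation log_width :: real where "log_width \<equiv> mean (\<lambda>\<gamma>. ln (real (ncols \<gamma>)))"
abbreviation zeta :: real where "zeta \<equiv> zeta_ratio pat f"

lemma valid: "valid_pattern (pat k)"
  using moran by (simp add: moran_with_frequency_def)

lemma finite_digits: "\<gamma> \<in> range pat \<Longrightarrow> finite (digits \<gamma>)"
proof -
  assume "\<gamma> \<in> range pat"
  then have "digits \<gamma> \<subseteq> {..<ncols \<gamma>} \<times> {..<nrows \<gamma>}" using valid by (auto simp: valid_pattern_def)
  then show "finite (digits \<gamma>)" by (rule finite_subset) simp
qed

lemma digits_ne: "\<gamma> \<in> range pat \<Longrightarrow> digits \<gamma> \<noteq> {}"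
  by (metis rangeE valid valid_pattern_def card.empty not_numeral_le_zero)

lemma finite_patterns: "finite (range pat)"
proof -
  obtain a b where ab: "\<And>k. ncols (pat k) \<le> a" "\<And>k. nrows (pat k) \<le> b"
    using moran unfolding moran_with_frequency_def bdd_above_def by auto
  have "range pat \<subseteq> (\<lambda>(n, m, D). Pattern n m D) ` ({..a} \<times> {..b} \<times> Pow ({..<a} \<times> {..<b}))"
  proof safe
    fix k
    have "digits (pat k) \<subseteq> {..<a} \<times> {..<b}"
      using valid[of k] ab[of k] unfolding valid_pattern_def by (blast dest: less_le_trans)
    then show "pat k \<in> (\<lambda>(n, m, D). Pattern n m D) ` ({..a} \<times> {..b} \<times> Pow ({..<a} \<times> {..<b}))"
      using ab[of k] by (intro image_eqI[of _ _ "(ncols (pat k), nrows (pat k), digits (pat k))"]) auto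
  qed
  then show ?thesis by (rule finite_subset) auto
qed

lemma frequency:
  "\<gamma> \<in> range pat \<Longrightarrow> (\<lambda>N. real (card {k. k < N \<and> pat k = \<gamma>}) / real N) \<longlonglongrightarrow> f \<gamma>"
  using moran by (auto simp: moran_with_frequency_def)

lemma f_nonneg: "\<gamma> \<in> range pat \<Longrightarrow> f \<gamma> \<ge> 0"
  using frequency by (rule tendsto_lowerbound) auto

lemma f_sum: "(\<Sum>\<gamma>\<in>range pat. f \<gamma>) = 1"
  using moran by (auto simp: moran_with_frequency_def)

lemma average_tendsto_mean: "(\<lambda>k. (\<Sum>i<k. h (pat i)) / real k) \<longlonglongrightarrow> mean h"
proof -
  have eq: "(\<Sum>i<k. h (pat i)) / real k = (\<Sum>\<gamma>\<in>range pat. real (card {i. i < k \<and> pat i = \<gamma>}) / real k * h \<gamma>)" for k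
  proof -
    have "(\<Sum>i<k. h (pat i)) = (\<Sum>\<gamma>\<in>range pat. \<Sum>i\<in>{i\<in>{..<k}. pat i = \<gamma>}. h (pat i))"
      by (rule sum.group[symmetric]) (auto simp: finite_patterns)
    also have "\<dots> = (\<Sum>\<gamma>\<in>range pat. real (card {i. i < k \<and> pat i = \<gamma>}) * h \<gamma>)"
      by (intro sum.cong refl) simp
    finally show ?thesis by (simp add: sum_divide_distrib)
  qed
  have "(\<lambda>k. \<Sum>\<gamma>\<in>range pat. real (card {i. i < k \<and> pat i = \<gamma>}) / real k * h \<gamma>) \<longlonglongrightarrow> mean h"
    by (rule tendsto_sum) (rule tendsto_mult_right, rule frequency)
  then show ?thesis unfolding eq .
qed

lemma frequent_pattern: "\<exists>\<gamma>\<in>range pat. f \<gamma> > 0"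
proof (rule ccontr)
  assume no: "\<not> ?thesis"
  have "f \<gamma> = 0" if "\<gamma> \<in> range pat" for \<gamma> 
  proof -
    have "\<not> f \<gamma> > 0" using that no by blast
    then show ?thesis using f_nonneg[OF that] by linarith
  qed
  then have "(\<Sum>\<gamma>\<in>range pat. f \<gamma>) = 0" by (intro sum.neutral) blast
  then show False using f_sum by simp
qed

lemma mean_pos_iff:
  assumes "\<And>\<gamma>. \<gamma> \<in> range pat \<Longrightarrow> h \<gamma> \<ge> 0"
  shows "mean h > 0 \<longleftrightarrow> (\<exists>\<gamma>\<in>range pat. f \<gamma> > 0 \<and> h \<gamma> > 0)"
proof -
  have nn: "f \<gamma> * h \<gamma> \<ge> 0" if "\<gamma> \<in> range pat" for \<gamma> using f_nonneg assms that by simp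
  have "mean h \<ge> 0" by (intro sum_nonneg nn)
  moreover have "mean h = 0 \<longleftrightarrow> (\<forall>\<gamma>\<in>range pat. f \<gamma> * h \<gamma> = 0)"
    by (rule sum_nonneg_eq_0_iff[OF finite_patterns nn])
  ultimately have "mean h > 0 \<longleftrightarrow> (\<exists>\<gamma>\<in>range pat. f \<gamma> * h \<gamma> \<noteq> 0)"
    by auto
  also have "\<dots> \<longleftrightarrow> (\<exists>\<gamma>\<in>range pat. f \<gamma> > 0 \<and> h \<gamma> > 0)"
  proof (rule bex_cong[OF refl])
    fix \<gamma> assume "\<gamma> \<in> range pat"
    with f_nonneg[OF this] assms[OF this] show "f \<gamma> * h \<gamma> \<noteq> 0 \<longleftrightarrow> f \<gamma> > 0 \<and> h \<gamma> > 0" by auto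
  qed
  finally show ?thesis .
qed

lemma nrows_ge: "\<gamma> \<in> range pat \<Longrightarrow> nrows \<gamma> \<ge> 2" and ncols_ge: "\<gamma> \<in> range pat \<Longrightarrow> ncols \<gamma> \<ge> 2"
  using valid by (auto simp: valid_pattern_def)

lemma log_height_pos: "log_height > 0" and log_width_pos: "log_width > 0"
proof -
  have "ln (real (nrows \<gamma>)) > 0" "ln (real (ncols \<gamma>)) > 0" if "\<gamma> \<in> range pat" for \<gamma>
    using nrows_ge[OF that] ncols_ge[OF that] by (simp_all add: ln_gt_zero)
  note pos = this
  obtain \<gamma> where \<gamma>: "\<gamma> \<in> range pat" "f \<gamma> > 0" using frequent_pattern by blast
  have mean_pos: "mean h > 0" if "\<And>\<gamma>. \<gamma> \<in> range pat \<Longrightarrow> h \<gamma> > 0" for h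
    using mean_pos_iff[of h] that \<gamma> by (meson less_imp_le)
  show "log_height > 0" "log_width > 0" by (rule mean_pos, rule pos, assumption)+
qed

lemma zeta_pos: "zeta > 0"
  unfolding zeta_ratio_def using log_height_pos log_width_pos by (intro divide_pos_pos)

lemma zeta_log_width: "zeta * log_width = log_height"
  unfolding zeta_ratio_def using log_width_pos by simp

end

section \<open>Tilted probability vectors and Gibbs' inequality\<close>

text \<open>
  \<open>beta_pattern\<close> is the logarithm of this sum to the base \<open>nrows \<gamma>\<close>; see \<open>beta_pattern_eq\<close>.
\<close>

definition pressure_sum ::
    "(pattern \<Rightarrow> nat \<times> nat \<Rightarrow> real) \<Rightarrow> real \<Rightarrow> pattern \<Rightarrow> real \<Rightarrow> real" where
  "pressure_sum p \<zeta> \<gamma> t = (\<Sum>(i, j)\<in>digits \<gamma>. p \<gamma> (i, j) powr t * u_row p t \<gamma> j powr (1 - \<zeta>))"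

definition tilted ::
    "(pattern \<Rightarrow> nat \<times> nat \<Rightarrow> real) \<Rightarrow> real \<Rightarrow> real \<Rightarrow> pattern \<Rightarrow> nat \<times> nat \<Rightarrow> real" where
  "tilted p \<zeta> t \<gamma> w = p \<gamma> w powr t * u_row p t \<gamma> (snd w) powr (1 - \<zeta>) / pressure_sum p \<zeta> \<gamma> t"

definition tilted_mean ::
    "(pattern \<Rightarrow> nat \<times> nat \<Rightarrow> real) \<Rightarrow> real \<Rightarrow> pattern \<Rightarrow> real \<Rightarrow> real" where
  "tilted_mean p \<zeta> \<gamma> t = (\<Sum>w\<in>digits \<gamma>. tilted p \<zeta> t \<gamma> w * digit_weight p \<zeta> \<gamma> w)"

locale positive_pattern =
  fixes p :: "pattern \<Rightarrow> nat \<times> nat \<Rightarrow> real" and \<gamma> :: pattern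
  assumes fin: "finite (digits \<gamma>)" and ne: "digits \<gamma> \<noteq> {}"
    and pos: "\<And>w. w \<in> digits \<gamma> \<Longrightarrow> p \<gamma> w > 0"
begin

lemma q_row_eq: "q_row P \<gamma> j = (\<Sum>w | w \<in> digits \<gamma> \<and> snd w = j. P \<gamma> w)"
  unfolding q_row_def
  by (rule sum.reindex_bij_witness[of _ fst "\<lambda>i. (i, j)"]) auto

lemma finite_row: "finite {i. (i, j) \<in> digits \<gamma>}"
  by (rule finite_subset[of _ "fst ` digits \<gamma>"]) (auto simp: fin image_iff intro!: bexI[of _ "(_, j)"])

lemma sum_by_rows: "(\<Sum>w\<in>digits \<gamma>. P \<gamma> w * h (snd w)) = (\<Sum>j\<in>snd ` digits \<gamma>. q_row P \<gamma> j * h j)"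
proof -
  have "(\<Sum>w\<in>digits \<gamma>. P \<gamma> w * h (snd w)) =
      (\<Sum>j\<in>snd ` digits \<gamma>. \<Sum>w\<in>{w\<in>digits \<gamma>. snd w = j}. P \<gamma> w * h (snd w))"
    by (rule sum.group[symmetric]) (auto simp: fin)
  also have "\<dots> = (\<Sum>j\<in>snd ` digits \<gamma>. q_row P \<gamma> j * h j)"
    by (intro sum.cong refl) (simp add: q_row_eq sum_distrib_right)
  finally show ?thesis .
qed

lemma q_row_pos:
  assumes "w \<in> digits \<gamma>"
  shows "q_row p \<gamma> (snd w) > 0"
  unfolding q_row_def using assms pos by (intro sum_pos finite_row) (auto intro: exI[of _ "fst w"])

lemma le_q_row:
  assumes "w \<in> digits \<gamma>"
  shows "p \<gamma> w \<le> q_row p \<gamma> (snd w)"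
  unfolding q_row_eq using assms fin pos by (intro member_le_sum) (auto intro: less_imp_le)

lemma row_power_sum_pos:
  assumes "w \<in> digits \<gamma>"
  shows "(\<Sum>i | (i, snd w) \<in> digits \<gamma>. p \<gamma> (i, snd w) powr t) > 0"
  using assms by (intro sum_pos finite_row) (auto intro: exI[of _ "fst w"] dest: pos)

lemma u_row_pos:
  assumes "w \<in> digits \<gamma>"
  shows "u_row p t \<gamma> (snd w) > 0"
  unfolding u_row_def using row_power_sum_pos[OF assms, of t] q_row_pos[OF assms] by (intro divide_pos_pos) auto

lemma pressure_sum_pos: "pressure_sum p \<zeta> \<gamma> t > 0"
  unfolding pressure_sum_def case_prod_beta
proof (rule sum_pos)
  fix w assume "w \<in> digits \<gamma>"
  then show "0 < p \<gamma> (fst w, snd w) powr t * u_row p t \<gamma> (snd w) powr (1 - \<zeta>)"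
    using u_row_pos[of w t] pos[of w] by simp
qed (use fin ne in auto)

lemma tilted_pos: "w \<in> digits \<gamma> \<Longrightarrow> tilted p \<zeta> t \<gamma> w > 0"
  unfolding tilted_def using u_row_pos[of w t] pos[of w] pressure_sum_pos[of \<zeta> t] by simp

lemma tilted_sum: "(\<Sum>w\<in>digits \<gamma>. tilted p \<zeta> t \<gamma> w) = 1"
  using pressure_sum_pos[of \<zeta> t]
  by (simp add: tilted_def sum_divide_distrib[symmetric]) (simp add: pressure_sum_def case_prod_beta)

lemma ln_tilted:
  assumes "w \<in> digits \<gamma>"
  shows "ln (tilted p \<zeta> t \<gamma> w) = t * ln (p \<gamma> w) + (1 - \<zeta>) * ln (u_row p t \<gamma> (snd w)) - ln (pressure_sum p \<zeta> \<gamma> t)"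
  unfolding tilted_def using assms u_row_pos[of w t] pos[of w] pressure_sum_pos[of \<zeta> t]
  by (simp add: ln_div ln_mult ln_powr)

lemma ln_q_row_tilted:
  assumes "w \<in> digits \<gamma>"
  shows "ln (q_row (tilted p \<zeta> t) \<gamma> (snd w)) =
    t * ln (q_row p \<gamma> (snd w)) - \<zeta> * ln (u_row p t \<gamma> (snd w)) - ln (pressure_sum p \<zeta> \<gamma> t)"
proof -
  let ?T = "\<Sum>i | (i, snd w) \<in> digits \<gamma>. p \<gamma> (i, snd w) powr t"
  note posw = row_power_sum_pos[OF assms, of t] q_row_pos[OF assms] u_row_pos[OF assms, of t] pressure_sum_pos[of \<zeta> t]
  have "q_row (tilted p \<zeta> t) \<gamma> (snd w) = ?T * u_row p t \<gamma> (snd w) powr (1 - \<zeta>) / pressure_sum p \<zeta> \<gamma> t"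
    by (simp add: q_row_def tilted_def sum_distrib_right sum_divide_distrib)
  then have "ln (q_row (tilted p \<zeta> t) \<gamma> (snd w)) =
      ln ?T + (1 - \<zeta>) * ln (u_row p t \<gamma> (snd w)) - ln (pressure_sum p \<zeta> \<gamma> t)"
    using posw by (simp add: ln_div ln_mult ln_powr)
  moreover have "ln (u_row p t \<gamma> (snd w)) = t * ln (q_row p \<gamma> (snd w)) - ln ?T"
    using posw by (simp add: u_row_def ln_div ln_powr)
  then have "ln ?T = t * ln (q_row p \<gamma> (snd w)) - ln (u_row p t \<gamma> (snd w))" by simp
  ultimately show ?thesis by (simp add: left_diff_distrib)
qed

text \<open>
  The exponents of the row weights in \<open>tilted\<close> are chosen such that they cancel in the following
  combination, which is linear in \<open>t\<close> up to the normalisation.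
\<close>

lemma ln_tilted_combination:
  assumes "w \<in> digits \<gamma>"
  shows "\<zeta> * ln (tilted p \<zeta> t \<gamma> w) + (1 - \<zeta>) * ln (q_row (tilted p \<zeta> t) \<gamma> (snd w)) =
    - t * digit_weight p \<zeta> \<gamma> w - ln (pressure_sum p \<zeta> \<gamma> t)"
  unfolding ln_tilted[OF assms] ln_q_row_tilted[OF assms] digit_weight_def by (simp add: algebra_simps)

lemma positive_pattern_tilted: "positive_pattern (tilted p \<zeta> t) \<gamma>"
  by unfold_locales (auto simp: fin ne tilted_pos)

end

text \<open>
  Gibbs' inequality from \<open>ln x \<le> x - 1\<close>.  The normalisation is assumed for the ratios \<open>b / a\<close>, so that
  it can also be applied to row marginals averaged over digits.
\<close>

lemma sum_ln_ratio_le: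
  fixes P R :: "'a \<Rightarrow> real"
  assumes fin: "finite D" and P: "\<And>w. w \<in> D \<Longrightarrow> P w > 0" and a: "\<And>w. w \<in> D \<Longrightarrow> a w > 0" "\<And>w. w \<in> D \<Longrightarrow> b w > 0"
    and sum: "(\<Sum>w\<in>D. P w * (b w / a w)) \<le> (\<Sum>w\<in>D. P w)"
  shows "(\<Sum>w\<in>D. P w * ln (b w)) \<le> (\<Sum>w\<in>D. P w * ln (a w))"
    and "(\<Sum>w\<in>D. P w * ln (b w)) = (\<Sum>w\<in>D. P w * ln (a w)) \<Longrightarrow> w \<in> D \<Longrightarrow> a w = b w"
proof -
  have le: "P w * ln (b w) - P w * ln (a w) \<le> P w * (b w / a w) - P w" if "w \<in> D" for w
  proof -
    have "ln (b w / a w) \<le> b w / a w - 1" using a that by (intro ln_le_minus_one) auto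
    then have "P w * ln (b w / a w) \<le> P w * (b w / a w - 1)" using P[OF that] by simp
    then show ?thesis using a(1)[OF that] a(2)[OF that] by (simp add: ln_div right_diff_distrib)
  qed
  from sum_mono[OF this, of D "\<lambda>w. w"] have D: "(\<Sum>w\<in>D. P w * ln (b w)) - (\<Sum>w\<in>D. P w * ln (a w)) \<le>
     (\<Sum>w\<in>D. P w * (b w / a w)) - (\<Sum>w\<in>D. P w)" by (simp add: sum_subtractf)
  with sum show "(\<Sum>w\<in>D. P w * ln (b w)) \<le> (\<Sum>w\<in>D. P w * ln (a w))" by simp
  show "a w = b w" if eq: "(\<Sum>w\<in>D. P w * ln (b w)) = (\<Sum>w\<in>D. P w * ln (a w))" and w: "w \<in> D"
  proof -
    have "(\<Sum>w\<in>D. (P w * (b w / a w) - P w) - (P w * ln (b w) - P w * ln (a w))) \<le> 0"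
      using eq sum by (simp add: sum_subtractf)
    moreover have nn: "\<And>w. w \<in> D \<Longrightarrow> 0 \<le> (P w * (b w / a w) - P w) - (P w * ln (b w) - P w * ln (a w))"
      using le by auto
    ultimately have "(\<Sum>w\<in>D. (P w * (b w / a w) - P w) - (P w * ln (b w) - P w * ln (a w))) = 0"
      using sum_nonneg[of D, OF nn] by (intro antisym) auto
    then have "(P w * (b w / a w) - P w) - (P w * ln (b w) - P w * ln (a w)) = 0"
      by (intro sum_nonneg_0[OF fin nn _ w])
    then have "P w * ln (b w / a w) = P w * (b w / a w - 1)"
      using a(1)[OF w] a(2)[OF w] by (simp add: ln_div right_diff_distrib)
    then have "ln (b w / a w) = b w / a w - 1" using P[OF w] by simp
    then have "b w / a w = 1" using a w by (intro ln_eq_minus_one) auto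
    then show ?thesis using a(1)[OF w] by simp
  qed
qed

context positive_pattern
begin

text \<open>
  By Gibbs' inequality the average of \<open>\<zeta> ln P + (1 - \<zeta>) ln R\<close>, where \<open>P\<close> is a probability vector
  with row marginal \<open>R\<close>, is largest under \<open>P\<close> itself.  Comparing the tilted vectors for \<open>s\<close> and \<open>t\<close>
  under the one for \<open>s\<close> gives the tangent to \<open>ln (pressure_sum p \<zeta> \<gamma> _)\<close> at \<open>s\<close>.
\<close>

lemma pressure_tangent:
  assumes \<zeta>: "0 < \<zeta>" "\<zeta> \<le> 1"
  shows "ln (pressure_sum p \<zeta> \<gamma> t) \<ge> ln (pressure_sum p \<zeta> \<gamma> s) - (t - s) * tilted_mean p \<zeta> \<gamma> s"
    and "ln (pressure_sum p \<zeta> \<gamma> t) = ln (pressure_sum p \<zeta> \<gamma> s) - (t - s) * tilted_mean p \<zeta> \<gamma> s \<Longrightarrow>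
      s \<noteq> t \<Longrightarrow> w \<in> digits \<gamma> \<Longrightarrow> v \<in> digits \<gamma> \<Longrightarrow> digit_weight p \<zeta> \<gamma> w = digit_weight p \<zeta> \<gamma> v"
proof -
  let ?P = "tilted p \<zeta>" and ?S = "\<lambda>t. ln (pressure_sum p \<zeta> \<gamma> t)"
  let ?R = "\<lambda>t w. q_row (?P t) \<gamma> (snd w)"
  interpret tilted: positive_pattern "?P r" \<gamma> for r by (rule positive_pattern_tilted)
  define X where "X r = (\<Sum>w\<in>digits \<gamma>. ?P s \<gamma> w * ln (?P r \<gamma> w))" for r
  define Y where "Y r = (\<Sum>w\<in>digits \<gamma>. ?P s \<gamma> w * ln (?R r w))" for r
  have comb: "\<zeta> * X r + (1 - \<zeta>) * Y r = - r * tilted_mean p \<zeta> \<gamma> s - ?S r" for r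
  proof -
    have "\<zeta> * X r + (1 - \<zeta>) * Y r = (\<Sum>w\<in>digits \<gamma>. ?P s \<gamma> w * (\<zeta> * ln (?P r \<gamma> w) + (1 - \<zeta>) * ln (?R r w)))"
      unfolding X_def Y_def sum_distrib_left sum.distrib[symmetric] by (intro sum.cong refl) (simp add: algebra_simps)
    also have "\<dots> = (\<Sum>w\<in>digits \<gamma>. - r * (?P s \<gamma> w * digit_weight p \<zeta> \<gamma> w) - ?P s \<gamma> w * ?S r)"
      by (intro sum.cong refl) (simp add: ln_tilted_combination right_diff_distrib mult.left_commute)
    also have "\<dots> = - r * tilted_mean p \<zeta> \<gamma> s - ?S r"
      by (simp add: sum_subtractf sum_negf tilted_mean_def sum_distrib_left sum_distrib_right[symmetric] tilted_sum)
    finally show ?thesis .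
  qed
  have sumX: "(\<Sum>w\<in>digits \<gamma>. ?P s \<gamma> w * (?P t \<gamma> w / ?P s \<gamma> w)) \<le> (\<Sum>w\<in>digits \<gamma>. ?P s \<gamma> w)"
  proof -
    have "(\<Sum>w\<in>digits \<gamma>. ?P s \<gamma> w * (?P t \<gamma> w / ?P s \<gamma> w)) = (\<Sum>w\<in>digits \<gamma>. ?P t \<gamma> w)"
      by (intro sum.cong refl) (use tilted_pos[of _ \<zeta> s] in force)
    then show ?thesis by (simp add: tilted_sum)
  qed
  have sumY: "(\<Sum>w\<in>digits \<gamma>. ?P s \<gamma> w * (?R t w / ?R s w)) \<le> (\<Sum>w\<in>digits \<gamma>. ?P s \<gamma> w)"
  proof -
    have "(\<Sum>w\<in>digits \<gamma>. ?P s \<gamma> w * (?R t w / ?R s w)) =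
        (\<Sum>j\<in>snd ` digits \<gamma>. q_row (?P s) \<gamma> j * (q_row (?P t) \<gamma> j / q_row (?P s) \<gamma> j))"
      by (rule sum_by_rows)
    also have "\<dots> = (\<Sum>j\<in>snd ` digits \<gamma>. q_row (?P t) \<gamma> j * 1)"
      using tilted.q_row_pos[of _ s] by (intro sum.cong refl) force
    also have "\<dots> = (\<Sum>w\<in>digits \<gamma>. ?P t \<gamma> w * 1)" by (rule sum_by_rows[symmetric])
    finally show ?thesis by (simp add: tilted_sum)
  qed
  note X = sum_ln_ratio_le[of "digits \<gamma>" "?P s \<gamma>" "?P s \<gamma>" "?P t \<gamma>", OF fin tilted_pos tilted_pos tilted_pos sumX]
  note Y = sum_ln_ratio_le[of "digits \<gamma>" "?P s \<gamma>" "?R s" "?R t", OF fin tilted_pos tilted.q_row_pos tilted.q_row_pos sumY]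
  have XY: "X t \<le> X s" "(1 - \<zeta>) * Y t \<le> (1 - \<zeta>) * Y s"
    using X(1) Y(1) \<zeta> by (auto simp: X_def Y_def intro!: mult_left_mono)
  then have "\<zeta> * X t + (1 - \<zeta>) * Y t \<le> \<zeta> * X s + (1 - \<zeta>) * Y s"
    using \<zeta> by (intro add_mono) auto
  then show "?S t \<ge> ?S s - (t - s) * tilted_mean p \<zeta> \<gamma> s" unfolding comb by (simp add: algebra_simps)
  assume eq: "?S t = ?S s - (t - s) * tilted_mean p \<zeta> \<gamma> s" and "s \<noteq> t" and wv: "w \<in> digits \<gamma>" "v \<in> digits \<gamma>"
  have "\<zeta> * X t + (1 - \<zeta>) * Y t = \<zeta> * X s + (1 - \<zeta>) * Y s"
    unfolding comb using eq by (simp add: algebra_simps)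
  then have "\<zeta> * X t \<ge> \<zeta> * X s" using XY(2) by linarith
  then have "X s \<le> X t" using \<zeta>(1) by (rule mult_left_le_imp_le)
  then have "X t = X s" using XY(1) by linarith
  then have P_eq: "?P s \<gamma> w = ?P t \<gamma> w" if "w \<in> digits \<gamma>" for w
    using X(2)[OF _ _ _ _ that] unfolding X_def by blast
  have "- t * digit_weight p \<zeta> \<gamma> w - ?S t = - s * digit_weight p \<zeta> \<gamma> w - ?S s" if "w \<in> digits \<gamma>" for w
  proof -
    have "?R s w = ?R t w" unfolding q_row_eq by (intro sum.cong refl) (use P_eq in auto)
    then show ?thesis unfolding ln_tilted_combination[OF that, symmetric] using P_eq[OF that] by simp
  qed
  from this[OF wv(1)] this[OF wv(2)] have "(t - s) * (digit_weight p \<zeta> \<gamma> w - digit_weight p \<zeta> \<gamma> v) = 0"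
    by (simp add: algebra_simps)
  then show "digit_weight p \<zeta> \<gamma> w = digit_weight p \<zeta> \<gamma> v" using \<open>s \<noteq> t\<close> by simp
qed

text \<open>
  The left-hand side of \<open>ln_tilted_combination\<close> is not positive, since probabilities are at most \<open>1\<close>.
\<close>

lemma ln_pressure_sum_ge:
  assumes \<zeta>: "0 < \<zeta>" "\<zeta> \<le> 1" and w: "w \<in> digits \<gamma>"
  shows "ln (pressure_sum p \<zeta> \<gamma> t) \<ge> - t * digit_weight p \<zeta> \<gamma> w"
proof -
  interpret tilted: positive_pattern "tilted p \<zeta> t" \<gamma> by (rule positive_pattern_tilted)
  have "q_row (tilted p \<zeta> t) \<gamma> (snd w) \<le> (\<Sum>w\<in>digits \<gamma>. tilted p \<zeta> t \<gamma> w)"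
    unfolding q_row_eq using tilted_pos fin by (intro sum_mono2) (auto intro: less_imp_le)
  then have "q_row (tilted p \<zeta> t) \<gamma> (snd w) \<le> 1" by (simp add: tilted_sum)
  then have "ln (q_row (tilted p \<zeta> t) \<gamma> (snd w)) \<le> 0" "ln (tilted p \<zeta> t \<gamma> w) \<le> 0"
    using tilted.q_row_pos[OF w] tilted.le_q_row[OF w] tilted_pos[OF w, of \<zeta> t] by auto
  then have "\<zeta> * ln (tilted p \<zeta> t \<gamma> w) + (1 - \<zeta>) * ln (q_row (tilted p \<zeta> t) \<gamma> (snd w)) \<le> 0"
    using \<zeta> by (intro add_nonpos_nonpos mult_nonneg_nonpos) auto
  then show ?thesis unfolding ln_tilted_combination[OF w] by simp
qed

lemma continuous_tilted_mean: "continuous_on UNIV (tilted_mean p \<zeta> \<gamma>)"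
proof -
  have u: "continuous_on UNIV (\<lambda>t. u_row p t \<gamma> (snd w))" if w: "w \<in> digits \<gamma>" for w
    unfolding u_row_def using row_power_sum_pos[OF w] q_row_pos[OF w]
    by (intro continuous_intros) (auto dest: pos simp: less_imp_neq[symmetric])
  have num: "continuous_on UNIV (\<lambda>t. p \<gamma> w powr t * u_row p t \<gamma> (snd w) powr (1 - \<zeta>))" if w: "w \<in> digits \<gamma>" for w
    using u_row_pos[OF w] pos[OF w] by (intro continuous_intros u[OF w]) (auto simp: less_imp_neq[symmetric])
  have "continuous_on UNIV (\<lambda>t. pressure_sum p \<zeta> \<gamma> t)"
    unfolding pressure_sum_def case_prod_beta using num by (intro continuous_on_sum) auto
  then have "continuous_on UNIV (\<lambda>t. tilted p \<zeta> t \<gamma> w)" if w: "w \<in> digits \<gamma>" for w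
    unfolding tilted_def using pressure_sum_pos by (intro continuous_on_divide num[OF w]) (auto simp: less_imp_neq[symmetric])
  then show ?thesis unfolding tilted_mean_def
    by (intro continuous_on_sum continuous_on_mult continuous_on_const) auto
qed

lemma beta_pattern_eq:
  assumes "nrows \<gamma> \<ge> 2"
  shows "beta_pattern p \<zeta> \<gamma> t * ln (real (nrows \<gamma>)) = ln (pressure_sum p \<zeta> \<gamma> t)"
proof -
  let ?m = "real (nrows \<gamma>)" and ?S = "pressure_sum p \<zeta> \<gamma> t"
  have m: "ln ?m > 0" "?m > 0" using assms by auto
  have "?m powr (- b) * ?S = 1 \<longleftrightarrow> b = ln ?S / ln ?m" for b
  proof -
    have "?m powr (- b) * ?S = 1 \<longleftrightarrow> ln (?m powr (- b) * ?S) = ln 1"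
      using m pressure_sum_pos[of \<zeta> t] by (intro ln_inj_iff[symmetric]) auto
    also have "\<dots> \<longleftrightarrow> b = ln ?S / ln ?m"
      using m pressure_sum_pos[of \<zeta> t] by (auto simp: ln_mult ln_powr field_simps)
    finally show ?thesis .
  qed
  then have "beta_pattern p \<zeta> \<gamma> t = ln ?S / ln ?m"
    unfolding beta_pattern_def pressure_sum_def[symmetric] by simp
  then show ?thesis using m by simp
qed

end

section \<open>Product measures on the code space\<close>

text \<open>
  These codes are mapped into a rectangle with the width of a column cell of order \<open>l\<close> and the height
  of a row cell of order \<open>k\<close>, which are about equal for a suitable \<open>l\<close>.
\<close>

definition approx_square ::
    "(nat \<Rightarrow> pattern) \<Rightarrow> nat \<Rightarrow> nat \<Rightarrow> (nat \<Rightarrow> nat \<times> nat) \<Rightarrow> (nat \<Rightarrow> nat \<times> nat) set" where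
  "approx_square pat l k w =
     {v \<in> code_space pat. (\<forall>i<l. v i = w i) \<and> (\<forall>i<k. snd (v i) = snd (w i))}"

definition code_sum ::
    "(nat \<Rightarrow> pattern) \<Rightarrow> (pattern \<Rightarrow> nat \<times> nat \<Rightarrow> real) \<Rightarrow> (nat \<Rightarrow> nat \<times> nat) \<Rightarrow> nat \<Rightarrow> real" where
  "code_sum pat g w k = (\<Sum>i<k. g (pat i) (w i))"

locale moran_weights = moran_structure +
  fixes P :: "pattern \<Rightarrow> nat \<times> nat \<Rightarrow> real"
  assumes weights: "positive_prob_vectors pat P"
begin

abbreviation \<nu> :: "(nat \<Rightarrow> nat \<times> nat) measure" where "\<nu> \<equiv> code_measure pat P"

abbreviation digit_measure :: "nat \<Rightarrow> (nat \<times> nat) measure" where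
  "digit_measure k \<equiv> point_measure (digits (pat k)) (\<lambda>w. ennreal (P (pat k) w))"

lemma P_pos: "\<gamma> \<in> range pat \<Longrightarrow> w \<in> digits \<gamma> \<Longrightarrow> P \<gamma> w > 0"
  using weights by (auto simp: positive_prob_vectors_def)

lemma P_sum: "\<gamma> \<in> range pat \<Longrightarrow> (\<Sum>w\<in>digits \<gamma>. P \<gamma> w) = 1"
  using weights by (auto simp: positive_prob_vectors_def)

lemma positive_pattern_P: "\<gamma> \<in> range pat \<Longrightarrow> positive_pattern P \<gamma>"
  by unfold_locales (auto simp: P_pos finite_digits digits_ne)

lemma emeasure_digit_measure:
  assumes "A \<subseteq> digits (pat k)"
  shows "emeasure (digit_measure k) A = ennreal (\<Sum>w\<in>A. P (pat k) w)"
  using assms P_pos[of "pat k"] finite_digits[of "pat k"]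
  by (subst emeasure_point_measure_finite) (auto intro!: sum_ennreal less_imp_le)

lemma prob_space_digit_measure: "prob_space (digit_measure k)"
  by (rule prob_spaceI) (simp add: space_point_measure emeasure_digit_measure P_sum)

lemma product_prob_space_digit_measure: "product_prob_space digit_measure"
  by (intro product_prob_spaceI prob_space_digit_measure)

lemma prob_space_\<nu>: "prob_space \<nu>"
proof -
  interpret product_prob_space digit_measure UNIV by (rule product_prob_space_digit_measure)
  show ?thesis unfolding code_measure_def by (rule P.prob_space_axioms)
qed

lemma space_\<nu>: "space \<nu> = code_space pat" by (rule space_code_measure)

lemma measurable_digit [measurable]: "(\<lambda>w. g (w k)) \<in> borel_measurable \<nu>" for g :: "_ \<Rightarrow> real"
proof -
  have "(\<lambda>w. w k) \<in> measurable \<nu> (digit_measure k)"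
    unfolding code_measure_def by (rule measurable_component_singleton) simp
  moreover have "g \<in> borel_measurable (digit_measure k)" by (simp add: measurable_point_measure_eq1)
  ultimately show ?thesis by (rule measurable_compose)
qed

lemma codeD: "w \<in> code_space pat \<Longrightarrow> w i \<in> digits (pat i)"
  by (auto simp: code_space_def)

lemma measure_approx_square:
  assumes w: "w \<in> code_space pat"
  shows "approx_square pat l k w \<in> sets \<nu>"
    and "l \<le> k \<Longrightarrow> measure \<nu> (approx_square pat l k w) > 0"
    and "l \<le> k \<Longrightarrow> ln (measure \<nu> (approx_square pat l k w)) =
      code_sum pat (\<lambda>\<gamma> x. ln (P \<gamma> x)) w l +
      (code_sum pat (\<lambda>\<gamma> x. ln (q_row P \<gamma> (snd x))) w k - code_sum pat (\<lambda>\<gamma> x. ln (q_row P \<gamma> (snd x))) w l)"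
proof -
  interpret product_prob_space digit_measure UNIV by (rule product_prob_space_digit_measure)
  define A where "A i = (if i < l then {w i} else if i < k then {x \<in> digits (pat i). snd x = snd (w i)} else digits (pat i))" for i
  have A: "A i \<subseteq> digits (pat i)" for i using codeD[OF w] by (auto simp: A_def)
  have eq: "approx_square pat l k w = prod_emb UNIV digit_measure {..<max l k} (\<Pi>\<^sub>E i\<in>{..<max l k}. A i)"
  proof (intro set_eqI iffI)
    fix v assume "v \<in> approx_square pat l k w"
    then show "v \<in> prod_emb UNIV digit_measure {..<max l k} (\<Pi>\<^sub>E i\<in>{..<max l k}. A i)"
      by (auto simp: approx_square_def prod_emb_def code_space_def space_point_measure A_def PiE_iff)
  next
    fix v assume "v \<in> prod_emb UNIV digit_measure {..<max l k} (\<Pi>\<^sub>E i\<in>{..<max l k}. A i)"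
    then have v: "v \<in> code_space pat" "\<And>i. i < max l k \<Longrightarrow> v i \<in> A i"
      by (auto simp: prod_emb_def code_space_def space_point_measure PiE_iff)
    have "v i = w i" if "i < l" for i using v(2)[of i] that by (simp add: A_def)
    moreover have "snd (v i) = snd (w i)" if "i < k" for i
      using v(2)[of i] that by (cases "i < l") (simp_all add: A_def less_max_iff_disj)
    ultimately show "v \<in> approx_square pat l k w" using v(1) by (simp add: approx_square_def)
  qed
  show "approx_square pat l k w \<in> sets \<nu>"
    unfolding eq code_measure_def by (intro sets_PiM_I) (use A in \<open>auto simp: sets_point_measure\<close>)
  assume "l \<le> k"
  define F where "F i = (if i < l then P (pat i) (w i) else q_row P (pat i) (snd (w i)))" for i
  have pp: "positive_pattern P (pat i)" for i by (rule positive_pattern_P) simp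
  have A_measure: "emeasure (digit_measure i) (A i) = ennreal (F i)" and F: "F i > 0" if "i < k" for i
  proof -
    show "emeasure (digit_measure i) (A i) = ennreal (F i)"
      unfolding emeasure_digit_measure[OF A] using that
      by (auto simp: A_def F_def positive_pattern.q_row_eq[OF pp])
    show "F i > 0" using codeD[OF w, of i] by (simp add: F_def P_pos positive_pattern.q_row_pos[OF pp])
  qed
  have "emeasure \<nu> (approx_square pat l k w) = (\<Prod>i<k. emeasure (digit_measure i) (A i))"
    unfolding code_measure_def eq using \<open>l \<le> k\<close>
    by (subst emeasure_PiM_emb) (use A in \<open>auto simp: sets_point_measure max_absorb2\<close>)
  also have "\<dots> = (\<Prod>i<k. ennreal (F i))" by (intro prod.cong) (auto simp: A_measure)
  also have "\<dots> = ennreal (\<Prod>i<k. F i)" using F by (intro prod_ennreal) (simp add: less_imp_le)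
  finally have "emeasure \<nu> (approx_square pat l k w) = ennreal (\<Prod>i<k. F i)" .
  moreover have "(\<Prod>i<k. F i) \<ge> 0" by (intro prod_nonneg less_imp_le[OF F]) simp
  ultimately have m: "measure \<nu> (approx_square pat l k w) = (\<Prod>i<k. F i)"
    by (simp add: measure_def)
  show "measure \<nu> (approx_square pat l k w) > 0" unfolding m by (intro prod_pos F) simp
  let ?q = "\<lambda>i. ln (q_row P (pat i) (snd (w i)))"
  have "ln (measure \<nu> (approx_square pat l k w)) = (\<Sum>i<k. ln (F i))"
    unfolding m by (intro ln_prod finite_lessThan) (metis F less_irrefl lessThan_iff)
  also have "\<dots> = (\<Sum>i<l. ln (F i)) + (\<Sum>i\<in>{l..<k}. ln (F i))"
    using \<open>l \<le> k\<close> by (subst sum.union_disjoint[symmetric]) (auto intro!: sum.cong)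
  also have "\<dots> = (\<Sum>i<l. ln (P (pat i) (w i))) + (\<Sum>i\<in>{l..<k}. ?q i)"
    by (intro arg_cong2[of _ _ _ _ "(+)"] sum.cong) (auto simp: F_def)
  also have "(\<Sum>i\<in>{l..<k}. ?q i) = (\<Sum>i<k. ?q i) - (\<Sum>i<l. ?q i)"
    using sum_diff_nat_ivl[of 0 l k ?q] \<open>l \<le> k\<close> by (simp add: atLeast0LessThan)
  finally show "ln (measure \<nu> (approx_square pat l k w)) =
      code_sum pat (\<lambda>\<gamma> x. ln (P \<gamma> x)) w l +
      (code_sum pat (\<lambda>\<gamma> x. ln (q_row P \<gamma> (snd x))) w k - code_sum pat (\<lambda>\<gamma> x. ln (q_row P \<gamma> (snd x))) w l)"
    by (simp add: code_sum_def)
qed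

lemma indep_digits: "prob_space.indep_vars \<nu> digit_measure (\<lambda>i w. w i) UNIV"
proof -
  interpret product_prob_space digit_measure UNIV by (rule product_prob_space_digit_measure)
  have "P.indep_vars digit_measure (\<lambda>i w. w i) UNIV"
  proof (subst P.indep_vars_iff_distr_eq_PiM)
    have "distr (Pi\<^sub>M UNIV digit_measure) (digit_measure i) (\<lambda>w. w i) = digit_measure i" for i
      by (rule PiM_component) simp
    then show "distr (Pi\<^sub>M UNIV digit_measure) (Pi\<^sub>M UNIV digit_measure) (\<lambda>x. \<lambda>i\<in>UNIV. x i) =
        (\<Pi>\<^sub>M i\<in>UNIV. distr (Pi\<^sub>M UNIV digit_measure) (digit_measure i) (\<lambda>w. w i))"
      by (simp add: restrict_UNIV distr_id)
  qed auto
  then show ?thesis by (simp add: code_measure_def)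
qed

lemma expectation_digit:
  fixes g :: "nat \<times> nat \<Rightarrow> real"
  shows "integral\<^sup>L \<nu> (\<lambda>w. g (w i)) = (\<Sum>x\<in>digits (pat i). P (pat i) x * g x)"
proof -
  interpret product_prob_space digit_measure UNIV by (rule product_prob_space_digit_measure)
  have "integral\<^sup>L \<nu> (\<lambda>w. g (w i)) = integral\<^sup>L (distr (Pi\<^sub>M UNIV digit_measure) (digit_measure i) (\<lambda>w. w i)) g"
    unfolding code_measure_def
    by (subst integral_distr) (auto simp: measurable_point_measure_eq1)
  also have "\<dots> = integral\<^sup>L (digit_measure i) g" by (subst PiM_component) auto
  also have "\<dots> = (\<Sum>x\<in>digits (pat i). P (pat i) x * g x)"
    using P_pos[of "pat i"] finite_digits[of "pat i"]
    by (subst lebesgue_integral_point_measure_finite) (auto intro: less_imp_le)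
  finally show ?thesis .
qed

end

lemma (in moran_structure) bounded_on_digits:
  obtains C :: real where "C > 0" "\<And>\<gamma> x. \<gamma> \<in> range pat \<Longrightarrow> x \<in> digits \<gamma> \<Longrightarrow> \<bar>g \<gamma> x\<bar> \<le> C"
proof
  let ?C = "(\<Sum>\<gamma>\<in>range pat. \<Sum>x\<in>digits \<gamma>. \<bar>g \<gamma> x\<bar>) + 1"
  have nn: "(\<Sum>x\<in>digits \<gamma>. \<bar>g \<gamma> x\<bar>) \<ge> 0" for \<gamma> by (intro sum_nonneg) auto
  show "?C > 0" using sum_nonneg[of "range pat" "\<lambda>\<gamma>. \<Sum>x\<in>digits \<gamma>. \<bar>g \<gamma> x\<bar>"] nn by force
  fix \<gamma> x assume \<gamma>: "\<gamma> \<in> range pat" "x \<in> digits \<gamma>"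
  have "\<bar>g \<gamma> x\<bar> \<le> (\<Sum>x\<in>digits \<gamma>. \<bar>g \<gamma> x\<bar>)"
    using \<gamma> finite_digits by (intro member_le_sum) auto
  also have "\<dots> \<le> (\<Sum>\<gamma>\<in>range pat. \<Sum>x\<in>digits \<gamma>. \<bar>g \<gamma> x\<bar>)"
    using \<gamma> finite_patterns nn by (intro member_le_sum) auto
  finally show "\<bar>g \<gamma> x\<bar> \<le> ?C" by simp
qed

context moran_weights
begin

text \<open>
  The digits are independent but not identically distributed; Hoeffding's inequality bounds the
  deviation of the sums from their means exponentially, so the Borel--Cantelli lemma applies.
\<close>

lemma strong_law:
  "AE w in \<nu>. (\<lambda>k. code_sum pat g w k / real k) \<longlonglongrightarrow> mean (\<lambda>\<gamma>. \<Sum>x\<in>digits \<gamma>. P \<gamma> x * g \<gamma> x)"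
proof -
  interpret prob_space \<nu> by (rule prob_space_\<nu>)
  let ?h = "\<lambda>\<gamma>. \<Sum>x\<in>digits \<gamma>. P \<gamma> x * g \<gamma> x"
  let ?D = "\<lambda>w k. code_sum pat g w k - (\<Sum>i<k. ?h (pat i))"
  obtain C where C: "C > 0" "\<And>\<gamma> x. \<gamma> \<in> range pat \<Longrightarrow> x \<in> digits \<gamma> \<Longrightarrow> \<bar>g \<gamma> x\<bar> \<le> C"
    using bounded_on_digits[of g] by blast
  have meas: "(\<lambda>w. code_sum pat g w k) \<in> borel_measurable \<nu>" for k
    unfolding code_sum_def by (intro borel_measurable_sum measurable_digit)
  have indep: "indep_vars (\<lambda>_. borel) (\<lambda>i w. g (pat i) (w i)) {..<k}" for k
    by (rule indep_vars_subset[OF indep_vars_compose2[OF indep_digits]])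
       (auto simp: measurable_point_measure_eq1)
  have ev: "AE w in \<nu>. \<forall>\<^sub>F k in sequentially. \<bar>?D w (Suc k)\<bar> < \<epsilon> * real (Suc k)" if "\<epsilon> > 0" for \<epsilon>
  proof -
    define A where "A k = {w \<in> space \<nu>. \<bar>?D w (Suc k)\<bar> \<ge> \<epsilon> * real (Suc k)}" for k
    have A: "A k \<in> sets \<nu>" for k unfolding A_def using meas by measurable
    define c where "c = \<epsilon>\<^sup>2 / (2 * C\<^sup>2)"
    have "c > 0" unfolding c_def using C(1) \<open>\<epsilon> > 0\<close> by simp
    have bound: "prob (A k) \<le> 2 * exp (- c) ^ Suc k" for k
    proof -
      interpret H: Hoeffding_ineq \<nu> "{..<Suc k}" "\<lambda>i w. g (pat i) (w i)" "\<lambda>_. - C" "\<lambda>_. C" "\<Sum>i<Suc k. ?h (pat i)"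
      proof unfold_locales
        show "(\<Sum>i<Suc k. ?h (pat i)) \<equiv> \<Sum>i<Suc k. expectation (\<lambda>w. g (pat i) (w i))"
          by (simp only: expectation_digit)
        fix i
        have "g (pat i) (w i) \<in> {- C..C}" if "w \<in> space \<nu>" for w
          using C(2)[of "pat i" "w i"] codeD[of w i] that by (auto simp: space_\<nu> abs_le_iff)
        then show "AE w in \<nu>. g (pat i) (w i) \<in> {- C..C}" by (rule AE_I2)
      qed (auto simp: indep)
      have "prob (A k) \<le> 2 * exp (- 2 * (\<epsilon> * real (Suc k))\<^sup>2 / (\<Sum>i<Suc k. (C - - C)\<^sup>2))"
        unfolding A_def code_sum_def
        by (rule H.Hoeffding_ineq_abs_ge) (use C(1) \<open>\<epsilon> > 0\<close> in \<open>auto intro!: sum_pos mult_pos_pos\<close>)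
      also have "- 2 * (\<epsilon> * real (Suc k))\<^sup>2 / (\<Sum>i<Suc k. (C - - C)\<^sup>2) = real (Suc k) * (- c)"
        using C(1) by (simp add: c_def power2_eq_square divide_simps del: of_nat_Suc)
      also have "exp (real (Suc k) * (- c)) = exp (- c) ^ Suc k" by (rule exp_of_nat_mult)
      finally show ?thesis .
    qed
    have "summable (\<lambda>k. 2 * exp (- c) ^ Suc k)"
      using \<open>c > 0\<close> by (intro summable_mult) (simp add: summable_geometric_iff summable_mult)
    then have "summable (\<lambda>k. prob (A k))"
      by (rule summable_comparison_test'[where N = 0]) (use bound in auto)
    from borel_cantelli_AE1[OF A _ this] have "AE w in \<nu>. \<forall>\<^sub>F k in sequentially. w \<in> space \<nu> - A k"
      by (auto simp: emeasure_eq_measure)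
    then show ?thesis by (rule AE_mp) (auto simp: A_def not_le elim: eventually_mono)
  qed
  have "AE w in \<nu>. \<forall>n. \<forall>\<^sub>F k in sequentially. \<bar>?D w (Suc k)\<bar> < 1 / real (Suc n) * real (Suc k)"
    unfolding AE_all_countable by (intro allI ev) simp
  then show ?thesis
  proof (rule AE_mp, intro AE_I2 impI)
    fix w assume w: "\<forall>n. \<forall>\<^sub>F k in sequentially. \<bar>?D w (Suc k)\<bar> < 1 / real (Suc n) * real (Suc k)"
    have "(\<lambda>k. ?D w (Suc k) / real (Suc k)) \<longlonglongrightarrow> 0"
    proof (rule tendstoI)
      fix e :: real assume "e > 0"
      then obtain n where n: "1 / real (Suc n) < e" using nat_approx_posE by blast
      show "\<forall>\<^sub>F k in sequentially. dist (?D w (Suc k) / real (Suc k)) 0 < e"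
        using w[rule_format, of n]
      proof eventually_elim
        case (elim k)
        then have "\<bar>?D w (Suc k)\<bar> / real (Suc k) < 1 / real (Suc n)"
          by (subst divide_less_eq) simp
        then show ?case using n by (simp add: dist_real_def abs_divide del: of_nat_Suc)
      qed
    qed
    then have "(\<lambda>k. ?D w k / real k) \<longlonglongrightarrow> 0" by (rule LIMSEQ_imp_Suc)
    from tendsto_add[OF this average_tendsto_mean[of ?h]]
    show "(\<lambda>k. code_sum pat g w k / real k) \<longlonglongrightarrow> mean ?h" by (simp add: diff_divide_distrib)
  qed
qed

end

section \<open>Approximate squares and balls\<close>

context moran_structure
begin

abbreviation col_base :: "nat \<Rightarrow> nat" where "col_base \<equiv> \<lambda>i. ncols (pat i)"
abbreviation row_base :: "nat \<Rightarrow> nat" where "row_base \<equiv> \<lambda>i. nrows (pat i)"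
abbreviation col_value :: "(nat \<Rightarrow> nat \<times> nat) \<Rightarrow> real" where
  "col_value w \<equiv> digit_value col_base (\<lambda>i. fst (w i))"
abbreviation row_value :: "(nat \<Rightarrow> nat \<times> nat) \<Rightarrow> real" where
  "row_value w \<equiv> digit_value row_base (\<lambda>i. snd (w i))"

abbreviation square :: "nat \<Rightarrow> (nat \<Rightarrow> nat \<times> nat) \<Rightarrow> (nat \<Rightarrow> nat \<times> nat) set" where
  "square k w \<equiv> approx_square pat (scaled_level zeta k) k w"

lemma code_digit: "w \<in> code_space pat \<Longrightarrow> w i \<in> digits (pat i)"
  by (auto simp: code_space_def)

lemma expansion_code:
  assumes "w \<in> code_space pat"
  shows "expansion col_base (\<lambda>i. fst (w i))" "expansion row_base (\<lambda>i. snd (w i))"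
proof -
  have "w i \<in> {..<ncols (pat i)} \<times> {..<nrows (pat i)}" for i
    using valid[of i] code_digit[OF assms, of i] unfolding valid_pattern_def by blast
  then have "fst (w i) < ncols (pat i) \<and> snd (w i) < nrows (pat i)" for i
    by (simp add: mem_Times_iff)
  then show "expansion col_base (\<lambda>i. fst (w i))" "expansion row_base (\<lambda>i. snd (w i))"
    using nrows_ge[of "pat _"] ncols_ge[of "pat _"] by (auto simp: expansion_def)
qed

lemma coding_map_eq:
  assumes "w \<in> code_space pat"
  shows "coding_map pat w = (col_value w, row_value w)"
proof -
  let ?a = "\<lambda>k. real (fst (w k)) / base_prod col_base (Suc k)"
  let ?b = "\<lambda>k. real (snd (w k)) / base_prod row_base (Suc k)"
  have ab: "summable ?a" "summable ?b"
    using summable_expansion[OF expansion_code(1)[OF assms], of 0] summable_expansion[OF expansion_code(2)[OF assms], of 0] by auto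
  have "(\<lambda>n. (\<Sum>k<n. ?a k, \<Sum>k<n. ?b k)) \<longlonglongrightarrow> (suminf ?a, suminf ?b)"
    using ab[THEN summable_LIMSEQ] by (intro tendsto_Pair)
  moreover have "(\<Sum>k<n. ?a k, \<Sum>k<n. ?b k) = (\<Sum>k<n. (?a k, ?b k))" for n
    by (rule prod_eqI) (simp_all add: fst_sum snd_sum)
  ultimately have "(\<lambda>k. (?a k, ?b k)) sums (suminf ?a, suminf ?b)" unfolding sums_def by simp
  then have "(\<Sum>k. (?a k, ?b k)) = (suminf ?a, suminf ?b)" by (rule sums_unique[symmetric])
  then show ?thesis by (simp add: coding_map_def digit_value_def base_prod_def lessThan_Suc_atMost)
qed

lemma ln_base_prod: "ln (base_prod col_base k) = (\<Sum>i<k. ln (real (col_base i)))"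
  "ln (base_prod row_base k) = (\<Sum>i<k. ln (real (row_base i)))"
proof -
  have "real (col_base i) \<noteq> 0" "real (row_base i) \<noteq> 0" for i
    using ncols_ge[of "pat i"] nrows_ge[of "pat i"] by auto
  then show "ln (base_prod col_base k) = (\<Sum>i<k. ln (real (col_base i)))"
    "ln (base_prod row_base k) = (\<Sum>i<k. ln (real (row_base i)))"
    unfolding base_prod_def by (intro ln_prod finite_lessThan; blast)+
qed

lemma base_prod_rates:
  "(\<lambda>k. ln (base_prod col_base k) / real k) \<longlonglongrightarrow> log_width"
  "(\<lambda>k. ln (base_prod row_base k) / real k) \<longlonglongrightarrow> log_height"
  unfolding ln_base_prod by (rule average_tendsto_mean)+

lemma base_prods_pos: "base_prod col_base k > 0" "base_prod row_base k > 0"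
  unfolding base_prod_def using ncols_ge[of "pat _"] nrows_ge[of "pat _"]
  by (auto intro!: prod_pos simp: less_le_trans[of 0 2])

lemma exp_less_inverse_iff: "b > 0 \<Longrightarrow> exp (- x) < 1 / b \<longleftrightarrow> ln b < x" for b x :: real
proof -
  assume b: "b > 0"
  have "exp (- x) < 1 / b \<longleftrightarrow> b < exp x" using b by (simp add: exp_minus field_simps)
  also have "\<dots> \<longleftrightarrow> ln b < x" using b by (metis exp_less_cancel_iff exp_ln)
  finally show ?thesis .
qed

text \<open>
  Codes in one approximate square have points at distance at most about \<open>exp (- log_height * k)\<close>:
  the width is \<open>exp (- log_width * zeta * k)\<close> up to a subexponential factor, and
  \<open>zeta * log_width = log_height\<close>.
\<close>

lemma square_small:
  assumes "\<epsilon> > 0"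
  shows "\<forall>\<^sub>F k in sequentially. \<forall>w\<in>code_space pat. \<forall>v\<in>square k w.
    dist (coding_map pat v) (coding_map pat w) \<le> exp (- (log_height - \<epsilon>) * real k)"
proof -
  let ?l = "scaled_level zeta"
  have col: "(\<lambda>k. ln (base_prod col_base (?l k)) / real k) \<longlonglongrightarrow> log_height"
    using tendsto_average_scaled_level[OF base_prod_rates(1) zeta_pos] by (simp add: zeta_log_width)
  have "\<forall>\<^sub>F k in sequentially. log_height - \<epsilon> / 2 < ln (base_prod col_base (?l k)) / real k"
    using col \<open>\<epsilon> > 0\<close> by (intro order_tendstoD(1)[OF col]) auto
  moreover have "\<forall>\<^sub>F k in sequentially. log_height - \<epsilon> / 2 < ln (base_prod row_base k) / real k"
    using \<open>\<epsilon> > 0\<close> by (intro order_tendstoD(1)[OF base_prod_rates(2)]) auto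
  moreover have "\<forall>\<^sub>F k in sequentially. real k > 2 * ln 2 / \<epsilon>"
    by (rule eventually_compose_filterlim[OF eventually_gt_at_top filterlim_real_sequentially])
  ultimately show ?thesis
    using eventually_gt_at_top[of 0]
  proof eventually_elim
    case (elim k)
    let ?r = "exp (- (log_height - \<epsilon> / 2) * real k)"
    have small: "1 / b \<le> ?r" if "b > 0" "log_height - \<epsilon> / 2 < ln b / real k" for b
    proof -
      have "exp ((log_height - \<epsilon> / 2) * real k) \<le> exp (ln b)"
        using that(2) elim(4) unfolding exp_le_cancel_iff by (simp add: less_divide_eq less_imp_le)
      then have "exp ((log_height - \<epsilon> / 2) * real k) \<le> b" using that by simp
      then have "1 / b \<le> 1 / exp ((log_height - \<epsilon> / 2) * real k)" using that by (intro divide_left_mono) auto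
      then show ?thesis by (simp only: mult_minus_left exp_minus inverse_eq_divide)
    qed
    have "2 * ?r = exp (ln 2 + - (log_height - \<epsilon> / 2) * real k)" by (simp add: exp_add)
    also have "\<dots> \<le> exp (- (log_height - \<epsilon>) * real k)"
      using elim(3) \<open>\<epsilon> > 0\<close> by (simp add: field_simps)
    finally have two: "2 * ?r \<le> exp (- (log_height - \<epsilon>) * real k)" .
    show ?case
    proof (intro ballI)
      fix w v assume w: "w \<in> code_space pat" and v: "v \<in> square k w"
      then have v': "v \<in> code_space pat" by (simp add: approx_square_def)
      have "\<bar>col_value v - col_value w\<bar> \<le> 1 / base_prod col_base (?l k)"
        using v by (intro digit_value_close expansion_code w v') (simp add: approx_square_def)
      moreover have "\<bar>row_value v - row_value w\<bar> \<le> 1 / base_prod row_base k"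
        using v by (intro digit_value_close expansion_code w v') (simp add: approx_square_def)
      ultimately have "\<bar>col_value v - col_value w\<bar> + \<bar>row_value v - row_value w\<bar> \<le> 2 * ?r"
        using small[OF base_prods_pos(1) elim(1)] small[OF base_prods_pos(2) elim(2)] by linarith
      moreover have "dist (coding_map pat v) (coding_map pat w) \<le> \<bar>col_value v - col_value w\<bar> + \<bar>row_value v - row_value w\<bar>"
        unfolding coding_map_eq[OF w] coding_map_eq[OF v'] dist_Pair_Pair dist_real_def
        using sqrt_sum_squares_le_sum_abs[of "\<bar>col_value v - col_value w\<bar>" "\<bar>row_value v - row_value w\<bar>"] by simp
      ultimately show "dist (coding_map pat v) (coding_map pat w) \<le> exp (- (log_height - \<epsilon>) * real k)"
        using two by linarith
    qed
  qed
qed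

text \<open>
  Combines \<open>nonzero_place_soon\<close> with the exponential rates of the cell sizes: the cells at the next
  place where \<open>a\<close> does not vanish are hardly smaller than those at place \<open>k\<close>.
\<close>

lemma place_soon:
  fixes a :: "nat \<Rightarrow> real"
  assumes "(\<lambda>k. (\<Sum>i<k. a i) / real k) \<longlonglongrightarrow> c" "c \<noteq> 0" "\<epsilon> > 0"
  shows "\<forall>\<^sub>F k in sequentially. \<exists>k'\<ge>k. a k' \<noteq> 0 \<and> exp (- (log_width + \<epsilon>) * real k) < 1 / base_prod col_base (Suc k')"
    and "\<forall>\<^sub>F k in sequentially. \<exists>k'\<ge>k. a k' \<noteq> 0 \<and> exp (- (log_height + \<epsilon>) * real k) < 1 / base_prod row_base (Suc k')"
  using nonzero_place_soon[OF assms(1,2) base_prod_rates(1) assms(3)]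
    nonzero_place_soon[OF assms(1,2) base_prod_rates(2) assms(3)]
  by (simp_all only: exp_less_inverse_iff[OF base_prods_pos(1)] exp_less_inverse_iff[OF base_prods_pos(2)] mult_minus_left)

lemma pattern_average:
  assumes "\<gamma> \<in> range pat"
  shows "(\<lambda>k. (\<Sum>i<k. of_bool (pat i = \<gamma>)) / real k) \<longlonglongrightarrow> f \<gamma>"
proof -
  have "mean (\<lambda>\<gamma>'. of_bool (\<gamma>' = \<gamma>)) = (\<Sum>\<gamma>'\<in>range pat. if \<gamma>' = \<gamma> then f \<gamma>' else 0)"
    by (intro sum.cong) auto
  then have "mean (\<lambda>\<gamma>'. of_bool (\<gamma>' = \<gamma>)) = f \<gamma>"
    using assms finite_patterns by (simp add: sum.delta')
  then show ?thesis using average_tendsto_mean[of "\<lambda>\<gamma>'. of_bool (\<gamma>' = \<gamma>)"] by simp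
qed

text \<open>
  Both separation conditions keep the points of different row words of length \<open>k\<close> apart, up to a
  subexponential factor: under \<open>RSC\<close> distinct rows are never adjacent, and under \<open>TBSC\<close> a pattern
  that avoids the bottom or the top row occurs soon after place \<open>k\<close>.
\<close>

lemma rows_separated:
  assumes sep: "RSC pat \<or> TBSC pat f" and "\<epsilon> > 0"
  shows "\<forall>\<^sub>F k in sequentially. \<forall>v\<in>code_space pat. \<forall>w\<in>code_space pat. (\<exists>i<k. snd (v i) \<noteq> snd (w i)) \<longrightarrow>
    exp (- (log_height + \<epsilon>) * real k) < \<bar>row_value v - row_value w\<bar>"
  using sep
proof
  assume rsc: "RSC pat"
  have "\<forall>\<^sub>F k in sequentially. ln (base_prod row_base k) / real k < log_height + \<epsilon>"
    using \<open>\<epsilon> > 0\<close> by (intro order_tendstoD(2)[OF base_prod_rates(2)]) auto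
  then show ?thesis
    using eventually_gt_at_top[of 0]
  proof eventually_elim
    case (elim k)
    then have k: "exp (- (log_height + \<epsilon>) * real k) < 1 / base_prod row_base k"
      unfolding mult_minus_left exp_less_inverse_iff[OF base_prods_pos(2)] by (simp add: divide_less_eq)
    show ?case
    proof (intro ballI impI)
      fix v w assume vw: "v \<in> code_space pat" "w \<in> code_space pat" "\<exists>i<k. snd (v i) \<noteq> snd (w i)"
      have "\<bar>int (snd (v i)) - int (snd (w i))\<bar> \<noteq> 1" for i
      proof (cases "v i = w i")
        case False
        have "pat i \<in> range pat" by simp
        then have *: "\<forall>x\<in>digits (pat i). \<forall>y\<in>digits (pat i). x \<noteq> y \<longrightarrow> \<bar>int (snd x) - int (snd y)\<bar> \<noteq> 1"
          using rsc unfolding RSC_def by fastforce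
        show ?thesis
          using * code_digit[OF vw(1), of i] code_digit[OF vw(2), of i] False by blast
      qed simp
      from digit_value_gap_of_cell_gap[OF expansion_code(2)[OF vw(1)] expansion_code(2)[OF vw(2)]
          cell_number_gap[OF expansion_code(2)[OF vw(1)] expansion_code(2)[OF vw(2)] this vw(3)]]
      show "exp (- (log_height + \<epsilon>) * real k) < \<bar>row_value v - row_value w\<bar>" using k by linarith
    qed
  qed
next
  assume "TBSC pat f"
  then obtain \<gamma> where \<gamma>: "\<gamma> \<in> range pat" "f \<gamma> > 0"
    and free: "(\<forall>x\<in>digits \<gamma>. snd x \<noteq> 0) \<or> (\<forall>x\<in>digits \<gamma>. snd x \<noteq> nrows \<gamma> - 1)"
    unfolding TBSC_def by fastforce
  show ?thesis
    using place_soon(2)[OF pattern_average[OF \<gamma>(1)] less_imp_neq[OF \<gamma>(2), symmetric] \<open>\<epsilon> > 0\<close>]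
  proof eventually_elim
    case (elim k)
    then obtain k' where k': "k' \<ge> k" "pat k' = \<gamma>" "exp (- (log_height + \<epsilon>) * real k) < 1 / base_prod row_base (Suc k')"
      by auto
    show ?case
    proof (intro ballI impI)
      fix v w assume vw: "v \<in> code_space pat" "w \<in> code_space pat" "\<exists>i<k. snd (v i) \<noteq> snd (w i)"
      have gap: "1 / base_prod row_base (Suc k') \<le> row_value v - row_value w"
        if "v \<in> code_space pat" "w \<in> code_space pat"
          "cell_number row_base (\<lambda>i. snd (v i)) k > cell_number row_base (\<lambda>i. snd (w i)) k" for v w
        using that k'(1,2) free code_digit[OF that(1), of k'] code_digit[OF that(2), of k']
        by (intro digit_value_gap[OF expansion_code(2) expansion_code(2)]) auto
      have "cell_number row_base (\<lambda>i. snd (v i)) k \<noteq> cell_number row_base (\<lambda>i. snd (w i)) k"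
        using cell_number_eq_iff[OF expansion_code(2)[OF vw(1)] expansion_code(2)[OF vw(2)], of k] vw(3) by auto
      then consider "1 / base_prod row_base (Suc k') \<le> row_value v - row_value w"
        | "1 / base_prod row_base (Suc k') \<le> row_value w - row_value v"
        using gap[OF vw(1,2)] gap[OF vw(2,1)] by (meson linorder_neqE_nat)
      then show "exp (- (log_height + \<epsilon>) * real k) < \<bar>row_value v - row_value w\<bar>"
        using k'(3) by cases linarith+
    qed
  qed
qed

lemma continuous_coding_map: "continuous_on (code_space pat) (coding_map pat)"
proof (rule continuous_on_topological[THEN iffD2], intro ballI allI impI)
  fix w B assume w: "w \<in> code_space pat" and B: "open B" "coding_map pat w \<in> B"
  obtain e where e: "e > 0" "ball (coding_map pat w) e \<subseteq> B" by (rule openE[OF B])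
  have "(\<lambda>k. 1 / base_prod col_base k + 1 / base_prod row_base k) \<longlonglongrightarrow> 0 + 0"
    by (intro tendsto_add tendsto_inverse_base_prod[OF expansion_code(1)[OF w]]
      tendsto_inverse_base_prod[OF expansion_code(2)[OF w]])
  then have "\<forall>\<^sub>F k in sequentially. 1 / base_prod col_base k + 1 / base_prod row_base k < e"
    by (rule order_tendstoD(2)) (use e in simp)
  then obtain k where k: "1 / base_prod col_base k + 1 / base_prod row_base k < e"
    using eventually_happens'[OF sequentially_bot] by blast
  define A where "A = (\<Inter>i<k. (\<lambda>v. v i) -` {w i})"
  have "open {x}" for x :: "nat \<times> nat"
    using open_Times[OF Topological_Spaces.open_discrete[of "{fst x}"] Topological_Spaces.open_discrete[of "{snd x}"]] by simp
  then have "open A" unfolding A_def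
    by (intro open_INT finite_lessThan ballI open_vimage) auto
  moreover have "coding_map pat v \<in> B" if v: "v \<in> code_space pat" "v \<in> A" for v
  proof -
    have agree: "v i = w i" if "i < k" for i using v(2) that by (auto simp: A_def)
    have "\<bar>col_value w - col_value v\<bar> \<le> 1 / base_prod col_base k"
      "\<bar>row_value w - row_value v\<bar> \<le> 1 / base_prod row_base k"
      using agree by (intro digit_value_close expansion_code w v; simp)+
    moreover have "dist (coding_map pat w) (coding_map pat v) \<le> \<bar>col_value w - col_value v\<bar> + \<bar>row_value w - row_value v\<bar>"
      unfolding coding_map_eq[OF w] coding_map_eq[OF v(1)] dist_Pair_Pair dist_real_def
      using sqrt_sum_squares_le_sum_abs[of "\<bar>col_value w - col_value v\<bar>" "\<bar>row_value w - row_value v\<bar>"] by simp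
    ultimately have "dist (coding_map pat w) (coding_map pat v) < e" using k by linarith
    then show ?thesis using e(2) by auto
  qed
  ultimately show "\<exists>A. open A \<and> w \<in> A \<and> (\<forall>y\<in>code_space pat. y \<in> A \<longrightarrow> coding_map pat y \<in> B)"
    by (intro exI[of _ A]) (auto simp: A_def)
qed

lemma compact_moran_set: "compact (moran_set pat)"
proof -
  have "compactin (product_topology (\<lambda>_. euclidean) UNIV) (code_space pat)"
    unfolding code_space_def compactin_PiE by (auto simp: finite_imp_compact finite_digits)
  then have "compact (code_space pat)" by (simp add: euclidean_product_topology)
  then show ?thesis unfolding moran_set_def by (intro compact_continuous_image continuous_coding_map)
qed

end

context moran_weights
begin

abbreviation ball_codes :: "real \<times> real \<Rightarrow> real \<Rightarrow> (nat \<Rightarrow> nat \<times> nat) set" where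
  "ball_codes x r \<equiv> {v \<in> space \<nu>. coding_map pat v \<in> cball x r}"

lemma ball_codes_eq: "ball_codes x r = coding_map pat -` cball x r \<inter> space \<nu>"
  by blast

lemma ball_codes_sets: "ball_codes x r \<in> sets \<nu>"
  unfolding ball_codes_eq by (rule measurable_sets[OF measurable_coding_map]) simp

lemma measure_moran_measure_cball: "measure (moran_measure pat P) (cball x r) = measure \<nu> (ball_codes x r)"
  unfolding moran_measure_def ball_codes_eq by (rule measure_distr[OF measurable_coding_map]) simp

text \<open>
  Small balls around a point outside the compact set \<open>moran_set pat\<close> have mass \<open>0\<close>.
\<close>

lemma local_dim_level_in_moran_set:
  assumes "has_local_dim (moran_measure pat P) x \<alpha>"
  shows "x \<in> moran_set pat"
proof (rule ccontr)
  assume "x \<notin> moran_set pat"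
  then have "x \<in> - moran_set pat" by simp
  then obtain e where e: "e > 0" "ball x e \<subseteq> - moran_set pat"
    by (rule openE[OF open_Compl[OF compact_imp_closed[OF compact_moran_set]]])
  have "ball_codes x (e / 2) = {}"
  proof (rule equals0I)
    fix v assume v: "v \<in> ball_codes x (e / 2)"
    then have "coding_map pat v \<in> ball x e" using e(1) by (simp add: dist_commute)
    then show False using e(2) v by (auto simp: space_\<nu> moran_set_def)
  qed
  then have "measure (moran_measure pat P) (cball x (e / 2)) = 0"
    unfolding measure_moran_measure_cball by (simp only: measure_empty)
  moreover have "measure (moran_measure pat P) (cball x (e / 2)) > 0"
    using assms half_gt_zero[OF e(1)] unfolding has_local_dim_def by blast
  ultimately show False by linarith
qed

text \<open>
  If some frequent pattern has a digit satisfying \<open>Q\<close>, almost every code has such digits at places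
  of positive density; otherwise all digits of a frequent pattern satisfy \<open>Q'\<close>.
\<close>

lemma AE_place_soon:
  assumes QQ': "\<And>\<gamma> x. \<gamma> \<in> range pat \<Longrightarrow> x \<in> digits \<gamma> \<Longrightarrow> Q \<gamma> x \<or> Q' \<gamma> x"
  shows "AE w in \<nu>. \<forall>\<epsilon>>0. \<forall>\<^sub>F k in sequentially. \<exists>k'\<ge>k.
     (Q (pat k') (w k') \<or> (\<forall>x\<in>digits (pat k'). Q' (pat k') x)) \<and>
     exp (- (log_width + \<epsilon>) * real k) < 1 / base_prod col_base (Suc k')"
proof -
  define h where "h \<gamma> = (\<Sum>x\<in>digits \<gamma>. P \<gamma> x * of_bool (Q \<gamma> x))" for \<gamma>
  have h_nonneg: "h \<gamma> \<ge> 0" if "\<gamma> \<in> range pat" for \<gamma>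
    unfolding h_def using P_pos[OF that] by (intro sum_nonneg) (auto intro: less_imp_le)
  show ?thesis
  proof (cases "mean h > 0")
    case True
    show ?thesis using strong_law[of "\<lambda>\<gamma> x. of_bool (Q \<gamma> x)"]
    proof (rule AE_mp, intro AE_I2 impI allI)
      fix w and \<epsilon> :: real
      assume "(\<lambda>k. code_sum pat (\<lambda>\<gamma> x. of_bool (Q \<gamma> x)) w k / real k) \<longlonglongrightarrow>
        mean (\<lambda>\<gamma>. \<Sum>x\<in>digits \<gamma>. P \<gamma> x * of_bool (Q \<gamma> x))" and "\<epsilon> > 0"
      then have "(\<lambda>k. (\<Sum>i<k. of_bool (Q (pat i) (w i))) / real k) \<longlonglongrightarrow> mean h"
        unfolding code_sum_def h_def by simp
      from place_soon(1)[OF this less_imp_neq[OF True, symmetric] \<open>\<epsilon> > 0\<close>]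
      show "\<forall>\<^sub>F k in sequentially. \<exists>k'\<ge>k.
         (Q (pat k') (w k') \<or> (\<forall>x\<in>digits (pat k'). Q' (pat k') x)) \<and>
         exp (- (log_width + \<epsilon>) * real k) < 1 / base_prod col_base (Suc k')"
        by eventually_elim auto
    qed
  next
    case False
    obtain \<gamma> where \<gamma>: "\<gamma> \<in> range pat" "f \<gamma> > 0" using frequent_pattern by blast
    with False have "h \<gamma> \<le> 0" using mean_pos_iff[of h, OF h_nonneg] by (meson not_le)
    then have "h \<gamma> = 0" using h_nonneg[OF \<gamma>(1)] by linarith
    then have "P \<gamma> x * of_bool (Q \<gamma> x) = 0" if "x \<in> digits \<gamma>" for x
      unfolding h_def using P_pos[OF \<gamma>(1)] finite_digits[OF \<gamma>(1)] that
      by (intro sum_nonneg_0[of "digits \<gamma>" "\<lambda>x. P \<gamma> x * of_bool (Q \<gamma> x)"]) (auto intro: less_imp_le)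
    then have "\<not> Q \<gamma> x" if "x \<in> digits \<gamma>" for x
      using P_pos[OF \<gamma>(1) that] that by fastforce
    then have Q': "Q' \<gamma> x" if "x \<in> digits \<gamma>" for x using QQ'[OF \<gamma>(1) that] that by blast
    show ?thesis
    proof (intro AE_I2 impI allI)
      fix w and \<epsilon> :: real assume "\<epsilon> > 0"
      from place_soon(1)[OF pattern_average[OF \<gamma>(1)] less_imp_neq[OF \<gamma>(2), symmetric] this]
      show "\<forall>\<^sub>F k in sequentially. \<exists>k'\<ge>k.
         (Q (pat k') (w k') \<or> (\<forall>x\<in>digits (pat k'). Q' (pat k') x)) \<and>
         exp (- (log_width + \<epsilon>) * real k) < 1 / base_prod col_base (Suc k')"
      proof eventually_elim
        case (elim k)
        then obtain k' where "k' \<ge> k" "pat k' = \<gamma>" "exp (- (log_width + \<epsilon>) * real k) < 1 / base_prod col_base (Suc k')"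
          by auto
        then show ?case using Q' by blast
      qed
    qed
  qed
qed

text \<open>
  Horizontally, cells may be adjacent, but almost no code stays close to the boundary of its
  column cells, unless the neighbouring cells have no points near that boundary.
\<close>

lemma AE_columns_separated:
  "AE w in \<nu>. \<forall>\<epsilon>>0. \<forall>\<^sub>F k in sequentially. \<forall>v\<in>code_space pat. (\<exists>i<k. fst (v i) \<noteq> fst (w i)) \<longrightarrow>
    exp (- (log_width + \<epsilon>) * real k) < \<bar>col_value v - col_value w\<bar>"
proof -
  let ?top = "\<lambda>\<gamma> x. fst x \<noteq> ncols \<gamma> - 1"
  have tb: "fst x \<noteq> ncols \<gamma> - 1 \<or> fst x \<noteq> 0" if "\<gamma> \<in> range pat" for \<gamma> and x :: "nat \<times> nat"
    using ncols_ge[OF that] by auto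
  have A: "AE w in \<nu>. \<forall>\<epsilon>>0. \<forall>\<^sub>F k in sequentially. \<exists>k'\<ge>k.
     (?top (pat k') (w k') \<or> (\<forall>x\<in>digits (pat k'). fst x \<noteq> 0)) \<and>
     exp (- (log_width + \<epsilon>) * real k) < 1 / base_prod col_base (Suc k')"
    by (rule AE_place_soon) (rule tb)
  have B: "AE w in \<nu>. \<forall>\<epsilon>>0. \<forall>\<^sub>F k in sequentially. \<exists>k'\<ge>k.
     (fst (w k') \<noteq> 0 \<or> (\<forall>x\<in>digits (pat k'). ?top (pat k') x)) \<and>
     exp (- (log_width + \<epsilon>) * real k) < 1 / base_prod col_base (Suc k')"
    by (rule AE_place_soon) (use tb in blast)
  show ?thesis
    using A B AE_space
  proof eventually_elim
    case (elim w)
    show ?case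
    proof (intro allI impI)
      fix \<epsilon> :: real assume "\<epsilon> > 0"
      have w: "w \<in> code_space pat" using elim(3) by (simp add: space_\<nu>)
      show "\<forall>\<^sub>F k in sequentially. \<forall>v\<in>code_space pat. (\<exists>i<k. fst (v i) \<noteq> fst (w i)) \<longrightarrow>
          exp (- (log_width + \<epsilon>) * real k) < \<bar>col_value v - col_value w\<bar>"
        using elim(1)[rule_format, OF \<open>\<epsilon> > 0\<close>] elim(2)[rule_format, OF \<open>\<epsilon> > 0\<close>]
      proof eventually_elim
        case (elim k)
        show ?case
        proof (intro ballI impI)
          fix v assume v: "v \<in> code_space pat" and diff: "\<exists>i<k. fst (v i) \<noteq> fst (w i)"
          let ?c = "\<lambda>v. cell_number col_base (\<lambda>i. fst (v i)) k"
          have "?c v \<noteq> ?c w"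
            using cell_number_eq_iff[OF expansion_code(1)[OF v] expansion_code(1)[OF w], of k] diff by auto
          then consider "?c v > ?c w" | "?c w > ?c v" by linarith
          then show "exp (- (log_width + \<epsilon>) * real k) < \<bar>col_value v - col_value w\<bar>"
          proof cases
            case 1
            obtain k' where k': "k' \<ge> k" "?top (pat k') (w k') \<or> (\<forall>x\<in>digits (pat k'). fst x \<noteq> 0)"
              "exp (- (log_width + \<epsilon>) * real k) < 1 / base_prod col_base (Suc k')" using elim(1) by blast
            have "1 / base_prod col_base (Suc k') \<le> col_value v - col_value w"
              using 1 k'(1,2) code_digit[OF v, of k']
              by (intro digit_value_gap[OF expansion_code(1)[OF v] expansion_code(1)[OF w]]) auto
            then show ?thesis using k'(3) by linarith
          next
            case 2
            obtain k' where k': "k' \<ge> k" "fst (w k') \<noteq> 0 \<or> (\<forall>x\<in>digits (pat k'). ?top (pat k') x)"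
              "exp (- (log_width + \<epsilon>) * real k) < 1 / base_prod col_base (Suc k')" using elim(2) by blast
            have "1 / base_prod col_base (Suc k') \<le> col_value w - col_value v"
              using 2 k'(1,2) code_digit[OF v, of k']
              by (intro digit_value_gap[OF expansion_code(1)[OF w] expansion_code(1)[OF v]]) auto
            then show ?thesis using k'(3) by linarith
          qed
        qed
      qed
    qed
  qed
qed

end

section \<open>From scales \<open>exp (- c k)\<close> to all radii\<close>

lemma log_radius_top:
  assumes "(c::real) > 0"
  shows "filterlim (\<lambda>r. nat \<lfloor>- ln r / c\<rfloor>) at_top (at_right 0)"
proof -
  have "filterlim (\<lambda>r. inverse c * - ln r) at_top (at_right (0::real))"
    using assms ln_at_0 by (intro filterlim_tendsto_pos_mult_at_top[OF tendsto_const])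
      (auto simp: filterlim_uminus_at_bot[symmetric] filterlim_uminus_at_top)
  then have "filterlim (\<lambda>r. - ln r / c) at_top (at_right (0::real))"
    by (simp add: divide_inverse mult.commute)
  then show ?thesis
    by (intro filterlim_compose[OF filterlim_nat_sequentially] filterlim_compose[OF filterlim_floor_sequentially])
qed

text \<open>
  Here \<open>m r\<close> is the mass of the ball of radius \<open>r\<close> around a fixed point and \<open>S k\<close> the mass of its
  approximate square at scale \<open>exp (- L k)\<close>.  Comparisons of balls with squares at neighbouring
  scales turn the rate of \<open>S\<close> into a local dimension.
\<close>

locale scaled_masses =
  fixes m :: "real \<Rightarrow> real" and S :: "nat \<Rightarrow> real" and L D :: real
  assumes mono: "\<And>r r'. r \<le> r' \<Longrightarrow> m r \<le> m r'" and le1: "\<And>r. m r \<le> 1"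
    and S_pos: "\<And>k. S k > 0" and S_rate: "(\<lambda>k. ln (S k) / real k) \<longlonglongrightarrow> - D" and L: "L > 0"
begin

lemma mass_le_powr:
  assumes inner: "\<And>\<epsilon>. \<epsilon> > 0 \<Longrightarrow> \<forall>\<^sub>F k in sequentially. m (exp (- (L + \<epsilon>) * real k)) \<le> S k"
    and s: "s < D / L"
  shows "\<forall>\<^sub>F r in at_right 0. m r \<le> r powr s"
proof (cases "s < 0")
  case True
  have "\<forall>\<^sub>F r in at_right (0::real). 0 < r \<and> r < 1" by (rule eventually_at_rightI[of 0 1]) auto
  then show ?thesis
  proof eventually_elim
    case (elim r)
    then have "1 powr s \<le> r powr s" using True by (intro powr_mono2') auto
    then show ?case using le1[of r] by simp
  qed
next
  case False
  \<comment> \<open>Half of the available exponent is lost to \<open>\<epsilon>\<close>; the rest absorbs the rounding of \<open>- ln r / (L + \<epsilon>)\<close>.\<close>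
  define \<epsilon> where "\<epsilon> = (D - s * L) / (2 * (s + 1))"
  have D: "D - s * L > 0" using s L by (simp add: less_divide_eq)
  then have \<epsilon>: "\<epsilon> > 0" using False by (simp add: \<epsilon>_def)
  have "2 * (s + 1) * \<epsilon> = D - s * L" using False by (simp add: \<epsilon>_def)
  then have gap: "(D - \<epsilon>) - s * (L + \<epsilon>) = (s + 1) * \<epsilon>" by (simp add: algebra_simps)
  have gap_pos: "(s + 1) * \<epsilon> > 0" using False \<epsilon> by simp
  let ?c = "L + \<epsilon>"
  have c: "?c > 0" using L \<epsilon> by simp
  have "\<forall>\<^sub>F k in sequentially. ln (S k) / real k < - D + \<epsilon>"
    using \<epsilon> by (intro order_tendstoD(2)[OF S_rate]) auto
  moreover have "\<forall>\<^sub>F k in sequentially. real k > s * ?c / ((s + 1) * \<epsilon>)"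
    by (rule eventually_compose_filterlim[OF eventually_gt_at_top filterlim_real_sequentially])
  ultimately have "\<forall>\<^sub>F k in sequentially. \<forall>r. 0 < r \<and> real k * ?c \<le> - ln r \<and> - ln r < (real k + 1) * ?c \<longrightarrow> m r \<le> r powr s"
    using inner[OF \<epsilon>] eventually_gt_at_top[of 0]
  proof eventually_elim
    case (elim k)
    show ?case
    proof (intro allI impI)
      fix r :: real assume r: "0 < r \<and> real k * ?c \<le> - ln r \<and> - ln r < (real k + 1) * ?c"
      then have "ln r \<le> - ?c * real k" by (simp only: mult_minus_left mult.commute[of ?c]) linarith
      then have "exp (ln r) \<le> exp (- ?c * real k)" by (simp only: exp_le_cancel_iff)
      then have "r \<le> exp (- ?c * real k)" using r by simp
      then have "m r \<le> S k" using mono elim(3) order_trans by blast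
      also have "S k = exp (ln (S k))" using S_pos by simp
      also have "\<dots> \<le> exp (s * ln r)"
        unfolding exp_le_cancel_iff
      proof -
        have "ln (S k) \<le> (- D + \<epsilon>) * real k" using elim(1,4) by (simp add: divide_less_eq)
        also have "(- D + \<epsilon>) * real k = - (s * ?c) * real k - (s + 1) * \<epsilon> * real k"
          using arg_cong[OF gap, of "\<lambda>x. x * real k"] by (simp add: algebra_simps)
        also have "\<dots> \<le> - (s * ?c) * real k - s * ?c"
          using elim(2) gap_pos by (simp add: divide_less_eq mult.commute)
        also have "\<dots> = s * (- ((real k + 1) * ?c))" by (simp add: algebra_simps)
        also have "\<dots> \<le> s * ln r" using r False by (intro mult_left_mono) auto
        finally show "ln (S k) \<le> s * ln r" .
      qed
      finally show "m r \<le> r powr s" using r by (simp add: powr_def)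
    qed
  qed
  from eventually_compose_filterlim[OF this log_radius_top[OF c]]
  have "\<forall>\<^sub>F r in at_right 0. \<forall>r'. 0 < r' \<and> real (nat \<lfloor>- ln r / ?c\<rfloor>) * ?c \<le> - ln r' \<and>
      - ln r' < (real (nat \<lfloor>- ln r / ?c\<rfloor>) + 1) * ?c \<longrightarrow> m r' \<le> r' powr s" .
  moreover have "\<forall>\<^sub>F r in at_right (0::real). 0 < r \<and> r < 1" by (rule eventually_at_rightI[of 0 1]) auto
  ultimately show ?thesis
  proof eventually_elim
    case (elim r)
    let ?k = "nat \<lfloor>- ln r / ?c\<rfloor>"
    have "- ln r / ?c \<ge> 0" using elim(2) c by (intro divide_nonneg_pos) auto
    then have "real ?k \<le> - ln r / ?c" "- ln r / ?c < real ?k + 1"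
      using floor_correct[of "- ln r / ?c"] by (simp_all add: of_nat_nat)
    then have "real ?k * ?c \<le> - ln r" "- ln r < (real ?k + 1) * ?c"
      using pos_le_divide_eq[OF c] pos_divide_less_eq[OF c] by blast+
    then show ?case using elim by blast
  qed
qed

lemma mass_ge_powr:
  assumes outer: "\<And>\<epsilon>. \<epsilon> > 0 \<Longrightarrow> \<forall>\<^sub>F k in sequentially. S k \<le> m (exp (- (L - \<epsilon>) * real k))"
    and s: "s > D / L" "s > 0"
  shows "\<forall>\<^sub>F r in at_right 0. r powr s \<le> m r"
proof -
  define \<epsilon> where "\<epsilon> = min (L / 2) ((s * L - D) / (2 * (s + 1)))"
  have D: "s * L - D > 0" using s L by (simp add: divide_less_eq)
  have "\<epsilon> \<le> L / 2" unfolding \<epsilon>_def by (rule min.cobounded1)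
  moreover have "\<epsilon> > 0" using D L s by (simp add: \<epsilon>_def)
  ultimately have \<epsilon>: "\<epsilon> > 0" "\<epsilon> < L" using L by linarith+
  have "\<epsilon> \<le> (s * L - D) / (2 * (s + 1))" unfolding \<epsilon>_def by (rule min.cobounded2)
  then have "2 * (s + 1) * \<epsilon> \<le> s * L - D" using s by (simp add: le_divide_eq mult.commute)
  then have gap: "s * (L - \<epsilon>) - (D + \<epsilon>) \<ge> (s + 1) * \<epsilon>" by (simp add: algebra_simps)
  have gap_pos: "(s + 1) * \<epsilon> > 0" using s \<epsilon> by simp
  let ?c = "L - \<epsilon>"
  have c: "?c > 0" using \<epsilon> by simp
  have "\<forall>\<^sub>F k in sequentially. - D - \<epsilon> < ln (S k) / real k"
    using \<epsilon> by (intro order_tendstoD(1)[OF S_rate]) auto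
  moreover have "\<forall>\<^sub>F k in sequentially. real k > s * ?c / ((s + 1) * \<epsilon>)"
    by (rule eventually_compose_filterlim[OF eventually_gt_at_top filterlim_real_sequentially])
  ultimately have "\<forall>\<^sub>F k in sequentially. \<forall>r. 0 < r \<and> - ln r \<le> real k * ?c \<and> (real k - 1) * ?c \<le> - ln r \<longrightarrow> r powr s \<le> m r"
    using outer[OF \<epsilon>(1)] eventually_gt_at_top[of 0]
  proof eventually_elim
    case (elim k)
    show ?case
    proof (intro allI impI)
      fix r :: real assume r: "0 < r \<and> - ln r \<le> real k * ?c \<and> (real k - 1) * ?c \<le> - ln r"
      then have "- ?c * real k \<le> ln r" by (simp only: mult_minus_left mult.commute[of ?c]) linarith
      then have "exp (- ?c * real k) \<le> exp (ln r)" by (simp only: exp_le_cancel_iff)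
      then have "exp (- ?c * real k) \<le> r" using r by simp
      then have Sm: "S k \<le> m r" using mono elim(3) order_trans by blast
      have "s * ln r \<le> s * (- ((real k - 1) * ?c))" using r s by (intro mult_left_mono) auto
      also have "\<dots> = s * ?c - s * ?c * real k" by (simp add: algebra_simps)
      also have "\<dots> \<le> (s + 1) * \<epsilon> * real k - s * ?c * real k"
        using elim(2) gap_pos by (simp add: divide_less_eq mult.commute)
      also have "\<dots> \<le> - (D + \<epsilon>) * real k"
        using mult_right_mono[OF gap, of "real k"] by (simp add: algebra_simps)
      also have "\<dots> \<le> ln (S k)" using elim(1,4) by (simp add: less_divide_eq)
      finally have "exp (s * ln r) \<le> exp (ln (S k))" by simp
      then show "r powr s \<le> m r" using r S_pos[of k] Sm by (simp add: powr_def)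
    qed
  qed
  from eventually_compose_filterlim[OF this filterlim_compose[OF filterlim_Suc log_radius_top[OF c]]]
  have "\<forall>\<^sub>F r in at_right 0. \<forall>r'. 0 < r' \<and> - ln r' \<le> real (Suc (nat \<lfloor>- ln r / ?c\<rfloor>)) * ?c \<and>
      (real (Suc (nat \<lfloor>- ln r / ?c\<rfloor>)) - 1) * ?c \<le> - ln r' \<longrightarrow> r' powr s \<le> m r'" .
  moreover have "\<forall>\<^sub>F r in at_right (0::real). 0 < r \<and> r < 1" by (rule eventually_at_rightI[of 0 1]) auto
  ultimately show ?thesis
  proof eventually_elim
    case (elim r)
    let ?k = "nat \<lfloor>- ln r / ?c\<rfloor>"
    have "- ln r / ?c \<ge> 0" using elim(2) c by (intro divide_nonneg_pos) auto
    then have "real (Suc ?k) = real_of_int \<lfloor>- ln r / ?c\<rfloor> + 1" by (simp add: of_nat_nat)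
    then have "real (Suc ?k) - 1 \<le> - ln r / ?c" "- ln r / ?c \<le> real (Suc ?k)"
      using floor_correct[of "- ln r / ?c"] by linarith+
    then have "(real (Suc ?k) - 1) * ?c \<le> - ln r" "- ln r \<le> real (Suc ?k) * ?c"
      using pos_le_divide_eq[OF c] pos_divide_le_eq[OF c] by blast+
    then show ?case using elim by blast
  qed
qed

lemma log_mass_tendsto:
  assumes inner: "\<And>\<epsilon>. \<epsilon> > 0 \<Longrightarrow> \<forall>\<^sub>F k in sequentially. m (exp (- (L + \<epsilon>) * real k)) \<le> S k"
    and outer: "\<And>\<epsilon>. \<epsilon> > 0 \<Longrightarrow> \<forall>\<^sub>F k in sequentially. S k \<le> m (exp (- (L - \<epsilon>) * real k))"
    and pos: "\<And>r. r > 0 \<Longrightarrow> m r > 0"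
  shows "((\<lambda>r. ln (m r) / ln r) \<longlongrightarrow> D / L) (at_right 0)"
proof -
  have small: "\<forall>\<^sub>F r in at_right (0::real). 0 < r \<and> r < 1" by (rule eventually_at_rightI[of 0 1]) auto
  have "0 \<le> D / L"
  proof (rule ccontr)
    assume "\<not> 0 \<le> D / L"
    then have "D < 0" using L by (simp add: divide_less_0_iff not_le)
    then have "\<forall>\<^sub>F k in sequentially. - D / 2 < ln (S k) / real k"
      by (intro order_tendstoD(1)[OF S_rate]) auto
    moreover have "\<forall>\<^sub>F k in sequentially. S k \<le> 1"
      using outer[OF zero_less_one] by eventually_elim (rule order_trans[OF _ le1])
    ultimately have "\<forall>\<^sub>F k in sequentially. False"
    proof eventually_elim
      case (elim k)
      have "ln (S k) \<le> 0" using elim(2) S_pos[of k] by simp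
      then have "ln (S k) / real k \<le> 0" by (simp add: divide_nonpos_nonneg)
      then show ?case using elim(1) \<open>D < 0\<close> by simp
    qed
    then show False by simp
  qed
  show ?thesis
  proof (rule order_tendstoI)
    fix a assume "a < D / L"
    then obtain s where s: "a < s" "s < D / L" using dense by blast
    have "\<forall>\<^sub>F r in at_right 0. m r \<le> r powr s" by (rule mass_le_powr[OF _ s(2)]) (rule inner)
    then show "\<forall>\<^sub>F r in at_right 0. a < ln (m r) / ln r"
      using small
    proof eventually_elim
      case (elim r)
      then have "ln (m r) \<le> s * ln r" using pos[of r] by (metis ln_mono ln_powr powr_gt_zero)
      then have "s \<le> ln (m r) / ln r" using elim(2) by (subst neg_le_divide_eq) auto
      then show ?case using s by linarith
    qed
  next
    fix a assume "D / L < a"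
    then obtain s where s: "D / L < s" "s < a" using dense by blast
    have "s > 0" using \<open>0 \<le> D / L\<close> s(1) by linarith
    have "\<forall>\<^sub>F r in at_right 0. r powr s \<le> m r" by (rule mass_ge_powr[OF _ s(1) \<open>s > 0\<close>]) (rule outer)
    then show "\<forall>\<^sub>F r in at_right 0. ln (m r) / ln r < a"
      using small
    proof eventually_elim
      case (elim r)
      then have "s * ln r \<le> ln (m r)" using pos[of r] by (metis ln_mono ln_powr powr_gt_zero order_less_irrefl)
      then have "ln (m r) / ln r \<le> s" using elim by (subst neg_divide_le_eq) auto
      then show ?case using s by linarith
    qed
  qed
qed

end

lemma local_dim_mass_at_scales:
  assumes x: "has_local_dim M x \<alpha>" and "c > 0" "e > 0"
  shows "\<forall>\<^sub>F k in sequentially. measure M (cball x (exp (- c * real k))) > 0 \<and>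
    - (\<alpha> + e) * c * real k \<le> ln (measure M (cball x (exp (- c * real k)))) \<and>
    ln (measure M (cball x (exp (- c * real k)))) \<le> - (\<alpha> - e) * c * real k"
proof -
  have "filterlim (\<lambda>k. c * real k) at_top sequentially"
    using \<open>c > 0\<close> by (intro filterlim_tendsto_pos_mult_at_top[OF tendsto_const] filterlim_real_sequentially) auto
  then have "filterlim (\<lambda>k. - (c * real k)) at_bot sequentially" by (simp add: filterlim_uminus_at_bot)
  then have "filterlim (\<lambda>k. exp (- c * real k)) (at_right 0) sequentially"
    using filterlim_compose[OF exp_at_bot] by (auto simp: filterlim_at intro!: always_eventually elim: filterlim_compose)
  moreover have lim: "((\<lambda>r. ln (measure M (cball x r)) / ln r) \<longlongrightarrow> \<alpha>) (at_right 0)"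
    using x by (simp add: has_local_dim_def)
  ultimately have "((\<lambda>k. ln (measure M (cball x (exp (- c * real k)))) / ln (exp (- c * real k))) \<longlongrightarrow> \<alpha>) sequentially"
    by (rule filterlim_compose[rotated])
  then have *: "((\<lambda>k. ln (measure M (cball x (exp (- c * real k)))) / (- c * real k)) \<longlongrightarrow> \<alpha>) sequentially"
    by (simp only: ln_exp)
  have "\<forall>\<^sub>F k in sequentially. \<alpha> - e < ln (measure M (cball x (exp (- c * real k)))) / (- c * real k)"
    using \<open>e > 0\<close> by (intro order_tendstoD(1)[OF *]) auto
  moreover have "\<forall>\<^sub>F k in sequentially. ln (measure M (cball x (exp (- c * real k)))) / (- c * real k) < \<alpha> + e"
    using \<open>e > 0\<close> by (intro order_tendstoD(2)[OF *]) auto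
  ultimately show ?thesis
    using eventually_gt_at_top[of 0]
  proof eventually_elim
    case (elim k)
    let ?m = "ln (measure M (cball x (exp (- c * real k))))"
    have neg: "- c * real k < 0" using \<open>c > 0\<close> elim(3) by simp
    have "?m < (\<alpha> - e) * (- c * real k)" "(\<alpha> + e) * (- c * real k) < ?m"
      using elim(1,2) neg_less_divide_eq[OF neg] neg_divide_less_eq[OF neg] by blast+
    moreover have "measure M (cball x (exp (- c * real k))) > 0" using x by (simp add: has_local_dim_def)
    ultimately show ?case by (simp add: algebra_simps)
  qed
qed

section \<open>The upper bound\<close>

locale moran_spectrum = moran_structure +
  fixes p :: "pattern \<Rightarrow> nat \<times> nat \<Rightarrow> real"
  assumes p_weights: "positive_prob_vectors pat p"
    and zeta_le: "zeta_ratio pat f \<le> 1"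
    and separation: "RSC pat \<or> TBSC pat f"

sublocale moran_spectrum \<subseteq> base: moran_weights pat f p
  by unfold_locales (rule p_weights)

sublocale moran_spectrum \<subseteq> tilt: moran_weights pat f "tilted p zeta t" for t
proof unfold_locales
  show "positive_prob_vectors pat (tilted p zeta t)"
    unfolding positive_prob_vectors_def
    using positive_pattern.tilted_pos[OF base.positive_pattern_P]
      positive_pattern.tilted_sum[OF base.positive_pattern_P] by blast
qed

context moran_spectrum
begin

abbreviation \<mu> :: "(nat \<Rightarrow> nat \<times> nat) measure" where "\<mu> \<equiv> code_measure pat p"
abbreviation \<nu> :: "real \<Rightarrow> (nat \<Rightarrow> nat \<times> nat) measure" where "\<nu> t \<equiv> code_measure pat (tilted p zeta t)"
abbreviation beta :: "real \<Rightarrow> real" where "beta t \<equiv> beta_fun pat f p t"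
abbreviation level :: "nat \<Rightarrow> nat" where "level \<equiv> scaled_level zeta"

abbreviation log_u :: "real \<Rightarrow> pattern \<Rightarrow> nat \<times> nat \<Rightarrow> real" where
  "log_u t \<equiv> \<lambda>\<gamma> x. ln (u_row p t \<gamma> (snd x))"

lemma level_le: "level k \<le> k"
  using zeta_pos zeta_le by (intro scaled_level_le) auto

lemma mean_pressure: "mean (\<lambda>\<gamma>. ln (pressure_sum p zeta \<gamma> t)) = log_height * beta t"
proof -
  have "mean (\<lambda>\<gamma>. ln (pressure_sum p zeta \<gamma> t)) =
      (\<Sum>\<gamma>\<in>range pat. f \<gamma> * beta_pattern p zeta \<gamma> t * ln (real (nrows \<gamma>)))"
  proof (rule sum.cong[OF refl])
    fix \<gamma> assume "\<gamma> \<in> range pat"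
    from positive_pattern.beta_pattern_eq[OF base.positive_pattern_P[OF this] nrows_ge[OF this], of zeta t]
    show "f \<gamma> * ln (pressure_sum p zeta \<gamma> t) = f \<gamma> * beta_pattern p zeta \<gamma> t * ln (real (nrows \<gamma>))"
      by (simp only: mult.assoc)
  qed
  then show ?thesis using log_height_pos unfolding beta_fun_def by simp
qed

lemma pressure_average:
  "(\<lambda>k. (\<Sum>i<k. ln (pressure_sum p zeta (pat i) t)) / real k) \<longlonglongrightarrow> log_height * beta t"
  using average_tendsto_mean[of "\<lambda>\<gamma>. ln (pressure_sum p zeta \<gamma> t)"] unfolding mean_pressure .

text \<open>
  The dependence on the column digits enters only through the mass under \<open>\<mu>\<close>: the row weights
  contribute \<open>(1 - zeta) * ln u\<close> at each of the first \<open>level k\<close> places and \<open>- zeta * ln u\<close> at the others.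
\<close>

lemma tilted_square:
  assumes w: "w \<in> code_space pat"
  shows "ln (measure (\<nu> t) (square k w)) = t * ln (measure \<mu> (square k w)) +
    (code_sum pat (log_u t) w (level k) - zeta * code_sum pat (log_u t) w k) -
    (\<Sum>i<k. ln (pressure_sum p zeta (pat i) t))"
proof -
  let ?U = "code_sum pat (log_u t) w" and ?S = "\<lambda>k. \<Sum>i<k. ln (pressure_sum p zeta (pat i) t)"
  let ?p = "code_sum pat (\<lambda>\<gamma> x. ln (p \<gamma> x)) w" and ?q = "code_sum pat (\<lambda>\<gamma> x. ln (q_row p \<gamma> (snd x))) w"
  have pp: "positive_pattern p (pat i)" for i by (rule base.positive_pattern_P) simp
  have P: "code_sum pat (\<lambda>\<gamma> x. ln (tilted p zeta t \<gamma> x)) w n = t * ?p n + (1 - zeta) * ?U n - ?S n" for n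
    unfolding code_sum_def sum_distrib_left sum.distrib[symmetric] sum_subtractf[symmetric]
    by (intro sum.cong refl positive_pattern.ln_tilted[OF pp] code_digit[OF w])
  have R: "code_sum pat (\<lambda>\<gamma> x. ln (q_row (tilted p zeta t) \<gamma> (snd x))) w n = t * ?q n - zeta * ?U n - ?S n" for n
    unfolding code_sum_def sum_distrib_left sum.distrib[symmetric] sum_subtractf[symmetric]
    by (intro sum.cong refl positive_pattern.ln_q_row_tilted[OF pp] code_digit[OF w])
  show ?thesis
    unfolding tilt.measure_approx_square(3)[OF w level_le] base.measure_approx_square(3)[OF w level_le] P R
    by (simp add: algebra_simps)
qed

text \<open>
  A ball that is narrower than the columns of order \<open>level k\<close> and meets only one row word of length
  \<open>k\<close> meets at most five approximate squares, so one of them carries at least a fifth of its mass.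
\<close>

lemma ball_has_heavy_square:
  assumes w: "w \<in> code_space pat" and r: "0 \<le> r" "r \<le> 1 / base_prod col_base (level k)"
    and rows: "\<And>v i. v \<in> base.ball_codes (coding_map pat w) r \<Longrightarrow> i < k \<Longrightarrow> snd (v i) = snd (w i)"
  shows "\<exists>v\<in>base.ball_codes (coding_map pat w) r.
    measure \<mu> (base.ball_codes (coding_map pat w) r) \<le> 5 * measure \<mu> (square k v)"
proof (rule ccontr)
  let ?A = "base.ball_codes (coding_map pat w) r" and ?l = "level k"
  interpret prob_space \<mu> by (rule base.prob_space_\<nu>)
  assume "\<not> ?thesis"
  then have light: "5 * measure \<mu> (square k v) < measure \<mu> ?A" if "v \<in> ?A" for v using that by force
  define c where "c v = cell_number col_base (\<lambda>i. fst (v i)) ?l" for v :: "nat \<Rightarrow> nat \<times> nat"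
  define N where "N = c ` ?A"
  have code: "v \<in> code_space pat" if "v \<in> ?A" for v using that by (simp add: base.space_\<nu>)
  have "c v \<in> {c w - 2..c w + 2}" if v: "v \<in> ?A" for v
  proof -
    have "\<bar>col_value v - col_value w\<bar> = dist (fst (coding_map pat v)) (fst (coding_map pat w))"
      by (simp add: coding_map_eq[OF w] coding_map_eq[OF code[OF v]] dist_real_def)
    also have "\<dots> \<le> dist (coding_map pat v) (coding_map pat w)" by (rule dist_fst_le)
    also have "\<dots> \<le> r" using v by (simp add: dist_commute)
    finally have "\<bar>col_value v - col_value w\<bar> \<le> 1 / base_prod col_base ?l" using r(2) by linarith
    from cell_number_close[OF expansion_code(1)[OF code[OF v]] expansion_code(1)[OF w] this]
    show ?thesis unfolding c_def by auto
  qed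
  then have "N \<subseteq> {c w - 2..c w + 2}" by (auto simp: N_def)
  from finite_subset[OF this] card_mono[OF _ this] have N: "finite N" "card N \<le> 5" by auto
  have "w \<in> ?A" using w r(1) by (simp add: base.space_\<nu>)
  then have "N \<noteq> {}" by (auto simp: N_def)
  have "\<forall>n\<in>N. \<exists>v. v \<in> ?A \<and> c v = n" unfolding N_def by blast
  from bchoice[OF this] obtain rep where "\<forall>n\<in>N. rep n \<in> ?A \<and> c (rep n) = n" ..
  then have rep: "rep n \<in> ?A \<and> c (rep n) = n" if "n \<in> N" for n using that by (rule bspec)
  have "?A \<subseteq> (\<Union>n\<in>N. square k (rep n))"
  proof
    fix v assume v: "v \<in> ?A"
    define n where "n = c v"
    have n: "n \<in> N" using v by (auto simp: N_def n_def)
    have rows': "snd (v i) = snd (rep n i)" if "i < k" for i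
      using rows[OF v that] rows[OF _ that, of "rep n"] rep[OF n] by simp
    have "c v = c (rep n)" using rep[OF n] by (simp add: n_def)
    then have "\<forall>i<?l. fst (v i) = fst (rep n i)"
      using cell_number_eq_iff[OF expansion_code(1)[OF code[OF v]] expansion_code(1)[OF code], of "rep n" ?l] rep[OF n]
      unfolding c_def by blast
    then have "v i = rep n i" if "i < ?l" for i
      using rows'[of i] that level_le[of k] by (intro prod_eqI) auto
    then have "v \<in> square k (rep n)" using rows' code[OF v] by (simp add: approx_square_def)
    then show "v \<in> (\<Union>n\<in>N. square k (rep n))" using n by blast
  qed
  then have "measure \<mu> ?A \<le> measure \<mu> (\<Union>n\<in>N. square k (rep n))"
    using N rep code by (intro finite_measure_mono sets.finite_UN base.measure_approx_square(1)) blast+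
  also have "\<dots> \<le> (\<Sum>n\<in>N. measure \<mu> (square k (rep n)))"
    using N rep code by (intro measure_UNION_le base.measure_approx_square(1)) blast+
  also have "\<dots> < (\<Sum>n\<in>N. measure \<mu> ?A / 5)"
    using light rep N \<open>N \<noteq> {}\<close> by (intro sum_strict_mono) (auto simp: less_divide_eq mult.commute)
  also have "\<dots> = real (card N) * (measure \<mu> ?A / 5)" by simp
  also have "\<dots> \<le> 5 * (measure \<mu> ?A / 5)" using N(2) by (intro mult_right_mono) auto
  finally show False by simp
qed

text \<open>
  Near a point of local dimension \<open>\<alpha>\<close> there are approximate squares with the same row word whose
  mass is bounded on the side that matters for the sign of \<open>t\<close>.  For \<open>t \<le> 0\<close> the square of the point
  itself lies in a slightly larger ball.  For \<open>t \<ge> 0\<close> the heaviest square that meets a slightly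
  smaller ball is taken; the row weights do not distinguish it from the square of the point.
\<close>

lemma square_near_level_point:
  assumes w: "w \<in> code_space pat" and x: "x = coding_map pat w"
    and dim: "has_local_dim (moran_measure pat p) x \<alpha>" and "\<eta> > 0"
  shows "\<forall>\<^sub>F k in sequentially. \<exists>v\<in>code_space pat. (\<forall>i<k. snd (v i) = snd (w i)) \<and>
    dist x (coding_map pat v) \<le> exp (- (log_height - \<eta>) * real k) \<and>
    t * ln (measure \<mu> (square k v)) \<ge> - (t * \<alpha> * log_height + \<eta>) * real k"
proof -
  interpret prob_space \<mu> by (rule base.prob_space_\<nu>)
  let ?L = log_height
  note m = base.measure_moran_measure_cball
  show ?thesis
  proof (cases "t \<le> 0")
    case True
    have "((\<lambda>e. t * (\<alpha> - e) * (?L - e)) \<longlongrightarrow> t * (\<alpha> - 0) * (?L - 0)) (at_right 0)"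
      by (intro tendsto_intros)
    then have "\<forall>\<^sub>F e in at_right 0. t * (\<alpha> - e) * (?L - e) < t * \<alpha> * ?L + \<eta>"
      using \<open>\<eta> > 0\<close> by (intro order_tendstoD(2)) auto
    moreover have "\<forall>\<^sub>F e in at_right 0. 0 < e \<and> e < ?L"
      using log_height_pos by (intro eventually_at_rightI[of 0 ?L]) auto
    ultimately have "\<forall>\<^sub>F e in at_right 0. t * (\<alpha> - e) * (?L - e) < t * \<alpha> * ?L + \<eta> \<and> 0 < e \<and> e < ?L"
      by (rule eventually_conj)
    then obtain e where e: "t * (\<alpha> - e) * (?L - e) < t * \<alpha> * ?L + \<eta>" "0 < e" "e < ?L"
      using eventually_happens'[OF trivial_limit_at_right_real] by blast
    have "?L - e > 0" using e by simp
    from local_dim_mass_at_scales[OF dim this e(2)] square_small[OF e(2)]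
    show ?thesis
    proof eventually_elim
      case (elim k)
      let ?r = "exp (- (?L - e) * real k)"
      have "square k w \<subseteq> base.ball_codes x ?r"
        using elim(2) w unfolding x by (auto simp: base.space_\<nu> approx_square_def dist_commute)
      then have "measure \<mu> (square k w) \<le> measure (moran_measure pat p) (cball x ?r)"
        unfolding m by (intro finite_measure_mono base.ball_codes_sets)
      then have "ln (measure \<mu> (square k w)) \<le> - (\<alpha> - e) * (?L - e) * real k"
        using elim(1) base.measure_approx_square(2)[OF w level_le] ln_mono by (meson order_trans)
      then have "t * (- (\<alpha> - e) * (?L - e) * real k) \<le> t * ln (measure \<mu> (square k w))"
        using True by (rule mult_left_mono_neg)
      moreover have "- (t * \<alpha> * ?L + \<eta>) * real k \<le> - (t * (\<alpha> - e) * (?L - e)) * real k"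
        using e(1) by (intro mult_right_mono) auto
      ultimately have "- (t * \<alpha> * ?L + \<eta>) * real k \<le> t * ln (measure \<mu> (square k w))"
        by (simp add: algebra_simps)
      then show ?case using w x by (intro bexI[of _ w]) auto
    qed
  next
    case False
    \<comment> \<open>The last summand \<open>e\<close> pays for the factor \<open>5\<close> in \<open>ball_has_heavy_square\<close>.\<close>
    have "((\<lambda>e. t * (\<alpha> + e) * (?L + e) + e) \<longlongrightarrow> t * (\<alpha> + 0) * (?L + 0) + 0) (at_right 0)"
      by (intro tendsto_intros)
    then have "\<forall>\<^sub>F e in at_right 0. t * (\<alpha> + e) * (?L + e) + e < t * \<alpha> * ?L + \<eta>"
      using \<open>\<eta> > 0\<close> by (intro order_tendstoD(2)) auto
    moreover have "\<forall>\<^sub>F e in at_right 0. 0 < (e::real) \<and> e < 1"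
      by (intro eventually_at_rightI[of 0 1]) auto
    ultimately have "\<forall>\<^sub>F e in at_right 0. t * (\<alpha> + e) * (?L + e) + e < t * \<alpha> * ?L + \<eta> \<and> 0 < e \<and> e < 1"
      by (rule eventually_conj)
    then obtain e where e: "t * (\<alpha> + e) * (?L + e) + e < t * \<alpha> * ?L + \<eta>" "0 < e" "e < 1"
      using eventually_happens'[OF trivial_limit_at_right_real] by blast
    have "?L + e > 0" using e log_height_pos by simp
    have "(\<lambda>k. ln (base_prod col_base (level k)) / real k) \<longlonglongrightarrow> ?L"
      using tendsto_average_scaled_level[OF base_prod_rates(1) zeta_pos] by (simp only: zeta_log_width)
    then have "\<forall>\<^sub>F k in sequentially. ln (base_prod col_base (level k)) / real k < ?L + e"
      using e by (intro order_tendstoD(2)) auto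
    moreover have "\<forall>\<^sub>F k in sequentially. real k > t * ln 5 / e"
      by (rule eventually_compose_filterlim[OF eventually_gt_at_top filterlim_real_sequentially])
    ultimately show ?thesis
      using local_dim_mass_at_scales[OF dim \<open>?L + e > 0\<close> e(2)] rows_separated[OF separation e(2)] eventually_gt_at_top[of 0]
    proof eventually_elim
      case (elim k)
      let ?r = "exp (- (?L + e) * real k)"
      have "ln (base_prod col_base (level k)) < (?L + e) * real k" using elim(1,5) by (simp add: divide_less_eq)
      then have r: "?r \<le> 1 / base_prod col_base (level k)"
        unfolding mult_minus_left by (intro less_imp_le) (simp only: exp_less_inverse_iff[OF base_prods_pos(1)])
      have rows: "snd (v i) = snd (w i)" if v: "v \<in> base.ball_codes x ?r" and "i < k" for v i
      proof (rule ccontr)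
        assume ne: "snd (v i) \<noteq> snd (w i)"
        have vc: "v \<in> code_space pat" using v by (simp add: base.space_\<nu>)
        have "?r < \<bar>row_value v - row_value w\<bar>" using elim(4) vc w ne \<open>i < k\<close> by blast
        also have "\<dots> = dist (snd (coding_map pat v)) (snd (coding_map pat w))"
          by (simp add: coding_map_eq[OF w] coding_map_eq[OF vc] dist_real_def)
        also have "\<dots> \<le> dist (coding_map pat v) (coding_map pat w)" by (rule dist_snd_le)
        also have "\<dots> \<le> ?r" using v by (simp add: x dist_commute)
        finally show False by simp
      qed
      obtain v where v: "v \<in> base.ball_codes x ?r"
        and heavy: "measure \<mu> (base.ball_codes x ?r) \<le> 5 * measure \<mu> (square k v)"
        using ball_has_heavy_square[OF w _ r] rows unfolding x by (meson exp_ge_zero)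
      have vc: "v \<in> code_space pat" using v by (simp add: base.space_\<nu>)
      have pos: "measure \<mu> (square k v) > 0" by (rule base.measure_approx_square(2)[OF vc level_le])
      have "- (\<alpha> + e) * (?L + e) * real k \<le> ln (measure \<mu> (base.ball_codes x ?r))"
        using elim(3) unfolding m by blast
      also have "\<dots> \<le> ln (5 * measure \<mu> (square k v))"
        using elim(3) heavy unfolding m by (intro ln_mono) auto
      also have "\<dots> = ln 5 + ln (measure \<mu> (square k v))" using pos by (simp add: ln_mult)
      finally have "t * (- (\<alpha> + e) * (?L + e) * real k) \<le> t * (ln 5 + ln (measure \<mu> (square k v)))"
        using False by (intro mult_left_mono) auto
      moreover have "- (t * \<alpha> * ?L + \<eta>) * real k \<le> - (t * (\<alpha> + e) * (?L + e) + e) * real k"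
        using e(1) by (intro mult_right_mono) auto
      moreover have "t * ln 5 < e * real k" using elim(2) e(2) by (simp add: divide_less_eq mult.commute)
      ultimately have t: "- (t * \<alpha> * ?L + \<eta>) * real k \<le> t * ln (measure \<mu> (square k v))"
        by (simp add: algebra_simps)
      have "dist x (coding_map pat v) \<le> ?r" using v by simp
      also have "\<dots> \<le> exp (- (?L - \<eta>) * real k)"
        using e(2) \<open>\<eta> > 0\<close> unfolding exp_le_cancel_iff by (intro mult_right_mono) auto
      finally show ?case using t vc rows[OF v] by (intro bexI[of _ v]) auto
    qed
  qed
qed

end

lemma (in prob_space) finite_card_disjoint_heavy:
  assumes F: "F \<subseteq> sets M" "disjoint F" and c: "c > 0" "\<And>Q. Q \<in> F \<Longrightarrow> measure M Q \<ge> c"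
  shows "finite F" and "real (card F) \<le> 1 / c"
proof -
  have bound: "real (card G) \<le> 1 / c" if G: "finite G" "G \<subseteq> F" for G
  proof -
    have "real (card G) * c = (\<Sum>Q\<in>G. c)" by simp
    also have "\<dots> \<le> (\<Sum>Q\<in>G. measure M Q)" using c G by (intro sum_mono) auto
    also have "\<dots> = measure M (\<Union>Q\<in>G. Q)"
    proof (rule finite_measure_finite_Union[symmetric])
      show "(\<lambda>Q. Q) ` G \<subseteq> sets M" using G F by auto
      show "disjoint_family_on (\<lambda>Q. Q) G"
        unfolding disjoint_family_on_def using G(2) disjointD[OF F(2)] by blast
    qed (rule G(1))
    also have "\<dots> \<le> 1" by (rule prob_le_1)
    finally show ?thesis using c(1) by (simp add: le_divide_eq)
  qed
  show "finite F"
  proof (rule ccontr)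
    assume "infinite F"
    then obtain G where G: "finite G" "card G = nat \<lceil>1 / c\<rceil> + 1" "G \<subseteq> F"
      using infinite_arbitrarily_large by blast
    have "1 / c \<le> real (nat \<lceil>1 / c\<rceil>)" by (rule real_nat_ceiling_ge)
    moreover have "real (card G) = real (nat \<lceil>1 / c\<rceil>) + 1" using G(2) by simp
    ultimately show False using bound[OF G(1,3)] by linarith
  qed
  then show "real (card F) \<le> 1 / c" by (rule bound) simp
qed

context moran_spectrum
begin

text \<open>
  The neighbourhoods of the squares of large tilted mass form the cover.  The number of these squares
  is bounded by the reciprocal of the mass, and every point of the level set is close to such a
  square at the infinitely many scales where the row weights are favourable.
\<close>

lemma hausdorff_measure_level_eq_0:
  assumes s: "s > 0" "s > \<alpha> * t + beta t"
  shows "hausdorff_measure s (local_dim_level (moran_measure pat p) \<alpha>) = 0"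
proof -
  let ?L = log_height
  define d where "d = \<alpha> * t + beta t"
  \<comment> \<open>The mass of a good square is known up to three errors \<open>\<eta>\<close> in the exponent (row weights,
    averages of the pressure, mass of the nearby square); its size is known up to one.\<close>
  define \<eta> where "\<eta> = min (?L / 2) ((s - d) * ?L / (2 * (3 + s)))"
  have gap0: "(s - d) * ?L > 0" using s(2) log_height_pos by (simp add: d_def)
  have "\<eta> \<le> ?L / 2" unfolding \<eta>_def by (rule min.cobounded1)
  moreover have "\<eta> > 0" using gap0 log_height_pos s by (simp add: \<eta>_def)
  ultimately have \<eta>: "\<eta> > 0" "\<eta> < ?L" using log_height_pos by linarith+
  have "\<eta> \<le> (s - d) * ?L / (2 * (3 + s))" unfolding \<eta>_def by (rule min.cobounded2)
  then have "2 * ((3 + s) * \<eta>) \<le> (s - d) * ?L" using s(1) by (simp add: le_divide_eq mult.commute mult.left_commute)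
  moreover have "(3 + s) * \<eta> > 0" using \<eta> s by simp
  ultimately have gap: "(3 + s) * \<eta> < (s - d) * ?L" by linarith
  define \<rho> where "\<rho> k = exp (- (?L - \<eta>) * real k)" for k
  define G where "G k = {square k v |v. v \<in> code_space pat \<and> exp (- (d * ?L + 3 * \<eta>) * real k) \<le> measure (\<nu> t) (square k v)}" for k
  define F where "F k = (\<lambda>Q. {x. \<exists>v\<in>Q. dist x (coding_map pat v) \<le> \<rho> k}) ` G k" for k
  have G: "finite (G k)" "real (card (G k)) \<le> exp ((d * ?L + 3 * \<eta>) * real k)" for k
  proof -
    interpret prob_space "\<nu> t" by (rule tilt.prob_space_\<nu>)
    have "G k \<subseteq> sets (\<nu> t)" unfolding G_def using tilt.measure_approx_square(1) by blast
    moreover have "disjoint (G k)"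
    proof (rule disjointI)
      fix A B assume "A \<in> G k" "B \<in> G k" "A \<noteq> B"
      then show "A \<inter> B = {}" unfolding G_def approx_square_def by fastforce
    qed
    ultimately have "finite (G k)" "real (card (G k)) \<le> 1 / exp (- (d * ?L + 3 * \<eta>) * real k)"
      by (rule finite_card_disjoint_heavy; auto simp: G_def)+
    then show "finite (G k)" "real (card (G k)) \<le> exp ((d * ?L + 3 * \<eta>) * real k)"
      by (simp_all only: mult_minus_left exp_minus inverse_eq_divide div_by_1 divide_divide_eq_right mult_1)
  qed
  show ?thesis
  proof (rule hausdorff_measure_eq_0_limsup_cover[where F = F and \<delta> = "\<lambda>k. 4 * \<rho> k"])
    show "s > 0" by fact
    show "finite (F k)" for k unfolding F_def using G by simp
    show "4 * \<rho> k > 0" for k by (simp add: \<rho>_def)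
    have \<rho>_power: "\<rho> k = exp (- (?L - \<eta>)) ^ k" for k
      unfolding \<rho>_def exp_of_nat_mult[symmetric] by (simp add: mult.commute)
    have "(\<lambda>k. exp (- (?L - \<eta>)) ^ k) \<longlonglongrightarrow> 0" using \<eta> by (intro LIMSEQ_power_zero) simp
    from tendsto_mult_right_zero[OF this, of 4] show "(\<lambda>k. 4 * \<rho> k) \<longlonglongrightarrow> 0" unfolding \<rho>_power .
    show "\<forall>\<^sub>F k in sequentially. \<forall>U\<in>F k. bounded U \<and> diameter U \<le> 4 * \<rho> k"
      using square_small[OF \<eta>(1)]
    proof eventually_elim
      case (elim k)
      show ?case
      proof
        fix U assume "U \<in> F k"
        then obtain w where w: "w \<in> code_space pat" "U = {x. \<exists>v\<in>square k w. dist x (coding_map pat v) \<le> \<rho> k}"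
          by (auto simp: F_def G_def)
        have near: "dist (coding_map pat w) y \<le> 2 * \<rho> k" if y: "y \<in> U" for y
        proof -
          obtain v where v: "v \<in> square k w" "dist y (coding_map pat v) \<le> \<rho> k" using y unfolding w(2) by blast
          have "dist (coding_map pat v) (coding_map pat w) \<le> \<rho> k" unfolding \<rho>_def using elim w(1) v(1) by blast
          then show ?thesis
            using v(2) dist_triangle[of "coding_map pat w" y "coding_map pat v"] by (simp add: dist_commute)
        qed
        then have "bounded U" unfolding bounded_def by blast
        moreover have "diameter U \<le> 4 * \<rho> k"
        proof (rule diameter_le)
          show "U \<noteq> {} \<or> 0 \<le> 4 * \<rho> k" by (simp add: \<rho>_def)
          fix y z assume "y \<in> U" "z \<in> U"
          then show "norm (y - z) \<le> 4 * \<rho> k"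
            using near[of y] near[of z] dist_triangle3[of y z "coding_map pat w"] by (simp add: dist_norm)
        qed
        ultimately show "bounded U \<and> diameter U \<le> 4 * \<rho> k" ..
      qed
    qed
    show "summable (\<lambda>k. real (card (F k)) * (4 * \<rho> k) powr s)"
    proof (rule summable_comparison_test')
      define q where "q = exp ((d * ?L + 3 * \<eta>) - s * (?L - \<eta>))"
      have "(d * ?L + 3 * \<eta>) - s * (?L - \<eta>) < 0" using gap by (simp add: algebra_simps)
      then have q: "norm q < 1" by (simp add: q_def)
      show "summable (\<lambda>k. 4 powr s * q ^ k)" by (intro summable_mult summable_geometric q)
      fix k :: nat assume "k \<ge> 0"
      have "real (card (F k)) \<le> exp ((d * ?L + 3 * \<eta>) * real k)"
        using card_image_le[OF G(1)[of k]] G(2)[of k] unfolding F_def by (meson of_nat_mono order_trans)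
      then have card_le: "real (card (F k)) * (4 * \<rho> k) powr s \<le> exp ((d * ?L + 3 * \<eta>) * real k) * (4 * \<rho> k) powr s"
        by (intro mult_right_mono) auto
      have "(4 * \<rho> k) powr s = 4 powr s * exp (- s * (?L - \<eta>) * real k)"
      proof -
        have "(4 * \<rho> k) powr s = 4 powr s * \<rho> k powr s" by (rule powr_mult)
        also have "\<rho> k powr s = exp (s * (- (?L - \<eta>) * real k))" unfolding \<rho>_def powr_def by simp
        finally show ?thesis by (simp only: mult.assoc mult_minus_left mult_minus_right)
      qed
      then have "exp ((d * ?L + 3 * \<eta>) * real k) * (4 * \<rho> k) powr s =
          4 powr s * exp (((d * ?L + 3 * \<eta>) - s * (?L - \<eta>)) * real k)"
        by (simp add: exp_add[symmetric] algebra_simps)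
      also have "exp (((d * ?L + 3 * \<eta>) - s * (?L - \<eta>)) * real k) = q ^ k"
        unfolding q_def exp_of_nat_mult[symmetric] by (simp add: mult.commute)
      finally show "norm (real (card (F k)) * (4 * \<rho> k) powr s) \<le> 4 powr s * q ^ k" using card_le by simp
    qed
    fix x assume "x \<in> local_dim_level (moran_measure pat p) \<alpha>"
    then have dim: "has_local_dim (moran_measure pat p) x \<alpha>" by (simp add: local_dim_level_def)
    then obtain w where w: "w \<in> code_space pat" "x = coding_map pat w"
      using base.local_dim_level_in_moran_set unfolding moran_set_def by blast
    obtain C where C: "\<And>\<gamma> y. \<gamma> \<in> range pat \<Longrightarrow> y \<in> digits \<gamma> \<Longrightarrow> \<bar>log_u t \<gamma> y\<bar> \<le> C"
      using bounded_on_digits[of "log_u t"] by blast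
    have "\<exists>\<^sub>F k in sequentially. code_sum pat (log_u t) w (level k) - zeta * code_sum pat (log_u t) w k \<ge> - \<eta> * real k"
      unfolding code_sum_def
      by (rule frequently_average_scaled_level[OF zeta_pos zeta_le _ \<eta>(1), where C = C])
         (intro C rangeI code_digit[OF w(1)])
    then show "\<exists>\<^sub>F k in sequentially. x \<in> \<Union>(F k)"
    proof (rule frequently_rev_mp)
      have "\<forall>\<^sub>F k in sequentially. (\<Sum>i<k. ln (pressure_sum p zeta (pat i) t)) / real k < ?L * beta t + \<eta>"
        using \<eta> by (intro order_tendstoD(2)[OF pressure_average]) auto
      then show "\<forall>\<^sub>F k in sequentially. - \<eta> * real k \<le> code_sum pat (log_u t) w (level k) - zeta * code_sum pat (log_u t) w k \<longrightarrow> x \<in> \<Union>(F k)"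
        using square_near_level_point[OF w dim \<eta>(1), of t] eventually_gt_at_top[of 0]
      proof eventually_elim
        case (elim k)
        show ?case
        proof
          assume freq: "- \<eta> * real k \<le> code_sum pat (log_u t) w (level k) - zeta * code_sum pat (log_u t) w k"
          let ?U = "\<lambda>w. code_sum pat (log_u t) w (level k) - zeta * code_sum pat (log_u t) w k"
          obtain v where v: "v \<in> code_space pat" "\<forall>i<k. snd (v i) = snd (w i)"
            "dist x (coding_map pat v) \<le> \<rho> k"
            "t * ln (measure \<mu> (square k v)) \<ge> - (t * \<alpha> * ?L + \<eta>) * real k"
            using elim(2) unfolding \<rho>_def by blast
          have "code_sum pat (log_u t) v n = code_sum pat (log_u t) w n" if "n \<le> k" for n
            unfolding code_sum_def using v(2) that by (intro sum.cong) auto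
          then have "?U v = ?U w" using level_le[of k] by simp
          then have "?U v \<ge> - \<eta> * real k" using freq by simp
          moreover have "(\<Sum>i<k. ln (pressure_sum p zeta (pat i) t)) \<le> (?L * beta t + \<eta>) * real k"
            using elim(1,3) by (simp add: divide_less_eq)
          ultimately have "ln (measure (\<nu> t) (square k v)) \<ge> - (d * ?L + 3 * \<eta>) * real k"
            using v(4) tilted_square[OF v(1), of t k] unfolding d_def by (simp add: algebra_simps)
          moreover have pos: "measure (\<nu> t) (square k v) > 0" by (rule tilt.measure_approx_square(2)[OF v(1) level_le])
          ultimately have "exp (- (d * ?L + 3 * \<eta>) * real k) \<le> measure (\<nu> t) (square k v)"
            by (metis exp_le_cancel_iff exp_ln)
          then have "square k v \<in> G k" using v(1) by (auto simp: G_def)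
          moreover have "v \<in> square k v" using v(1) by (simp add: approx_square_def)
          ultimately show "x \<in> \<Union>(F k)" using v(3) by (auto simp: F_def)
        qed
      qed
    qed
  qed
qed

end

section \<open>The lower bound\<close>

context moran_spectrum
begin

text \<open>
  The almost sure local dimension of the Moran measure under the \<open>t\<close>-tilted measure, and minus the
  slope of \<open>beta\<close> at \<open>t\<close>.
\<close>

definition typical_dim :: "real \<Rightarrow> real" where
  "typical_dim t = mean (\<lambda>\<gamma>. tilted_mean p zeta \<gamma> t) / log_height"

abbreviation near :: "real \<times> real \<Rightarrow> real \<Rightarrow> (nat \<Rightarrow> nat \<times> nat) set" where
  "near x r \<equiv> {v \<in> code_space pat. coding_map pat v \<in> cball x r}"

lemma near_sets: "near x r \<in> sets \<mu>" "near x r \<in> sets (\<nu> t)"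
  using base.ball_codes_sets[of x r] tilt.ball_codes_sets[where t = t and x = x and r = r]
  unfolding base.space_\<nu> tilt.space_\<nu> by blast+

text \<open>
  By the strong law, the contribution of the row weights to \<open>tilted_square\<close> is \<open>o(k)\<close> for almost
  every code.
\<close>

lemma AE_square_rates:
  "AE w in \<nu> t. (\<lambda>k. ln (measure \<mu> (square k w)) / real k) \<longlonglongrightarrow> - (log_height * typical_dim t) \<and>
    (\<lambda>k. ln (measure (\<nu> t) (square k w)) / real k) \<longlonglongrightarrow> - (log_height * (typical_dim t * t + beta t))"
proof -
  let ?lp = "\<lambda>\<gamma> x. ln (p \<gamma> x)" and ?lq = "\<lambda>\<gamma> x. ln (q_row p \<gamma> (snd x))"
  define m where "m g = mean (\<lambda>\<gamma>. \<Sum>x\<in>digits \<gamma>. tilted p zeta t \<gamma> x * g \<gamma> x)" for g :: "pattern \<Rightarrow> nat \<times> nat \<Rightarrow> real"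
  have mean_eq: "zeta * m ?lp + (m ?lq - zeta * m ?lq) = - (log_height * typical_dim t)"
  proof -
    have "- tilted_mean p zeta \<gamma> t = zeta * (\<Sum>x\<in>digits \<gamma>. tilted p zeta t \<gamma> x * ?lp \<gamma> x) +
        (1 - zeta) * (\<Sum>x\<in>digits \<gamma>. tilted p zeta t \<gamma> x * ?lq \<gamma> x)" for \<gamma>
      unfolding tilted_mean_def digit_weight_def sum_distrib_left sum.distrib[symmetric] sum_negf[symmetric]
      by (intro sum.cong refl) (simp add: algebra_simps)
    moreover have "mean (\<lambda>\<gamma>. z * X \<gamma> + z' * Y \<gamma>) = z * mean X + z' * mean Y" for z z' X Y
      unfolding sum_distrib_left sum.distrib[symmetric] by (intro sum.cong refl) (simp add: algebra_simps)
    ultimately have "mean (\<lambda>\<gamma>. - tilted_mean p zeta \<gamma> t) = zeta * m ?lp + (1 - zeta) * m ?lq"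
      unfolding m_def by (simp only:)
    moreover have "mean (\<lambda>\<gamma>. - tilted_mean p zeta \<gamma> t) = - (log_height * typical_dim t)"
      using log_height_pos by (simp add: typical_dim_def sum_negf)
    ultimately show ?thesis by (simp add: algebra_simps)
  qed
  show ?thesis
    using tilt.strong_law[where t = t and g = ?lp] tilt.strong_law[where t = t and g = ?lq] tilt.strong_law[where t = t and g = "log_u t"] AE_space
  proof eventually_elim
    case (elim w)
    then have w: "w \<in> code_space pat" by (simp add: tilt.space_\<nu>)
    have avg: "(\<lambda>k. code_sum pat ?lp w k / real k) \<longlonglongrightarrow> m ?lp" "(\<lambda>k. code_sum pat ?lq w k / real k) \<longlonglongrightarrow> m ?lq"
      "(\<lambda>k. code_sum pat (log_u t) w k / real k) \<longlonglongrightarrow> m (log_u t)"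
      using elim(1-3) unfolding m_def by blast+
    note lev = tendsto_average_scaled_level[OF _ zeta_pos]
    have "(\<lambda>k. code_sum pat ?lp w (level k) / real k +
        (code_sum pat ?lq w k / real k - code_sum pat ?lq w (level k) / real k)) \<longlonglongrightarrow> zeta * m ?lp + (m ?lq - zeta * m ?lq)"
      by (intro tendsto_add tendsto_diff lev avg)
    then have \<mu>_rate: "(\<lambda>k. ln (measure \<mu> (square k w)) / real k) \<longlonglongrightarrow> - (log_height * typical_dim t)"
      unfolding mean_eq base.measure_approx_square(3)[OF w level_le] by (simp only: add_divide_distrib diff_divide_distrib)
    have "(\<lambda>k. t * (ln (measure \<mu> (square k w)) / real k) +
        (code_sum pat (log_u t) w (level k) / real k - zeta * (code_sum pat (log_u t) w k / real k)) -
        (\<Sum>i<k. ln (pressure_sum p zeta (pat i) t)) / real k)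
      \<longlonglongrightarrow> t * (- (log_height * typical_dim t)) + (zeta * m (log_u t) - zeta * m (log_u t)) - log_height * beta t"
      by (intro tendsto_add tendsto_diff tendsto_mult_left lev avg \<mu>_rate pressure_average)
    then have "(\<lambda>k. ln (measure (\<nu> t) (square k w)) / real k) \<longlonglongrightarrow> - (log_height * (typical_dim t * t + beta t))"
      unfolding tilted_square[OF w] by (simp add: add_divide_distrib diff_divide_distrib distrib_left mult_ac)
    with \<mu>_rate show ?case ..
  qed
qed

lemma ball_in_square:
  assumes w: "w \<in> code_space pat" and "\<epsilon> > 0"
    and cols: "\<forall>\<epsilon>>0. \<forall>\<^sub>F k in sequentially. \<forall>v\<in>code_space pat. (\<exists>i<k. fst (v i) \<noteq> fst (w i)) \<longrightarrow>
      exp (- (log_width + \<epsilon>) * real k) < \<bar>col_value v - col_value w\<bar>"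
  shows "\<forall>\<^sub>F k in sequentially. near (coding_map pat w) (exp (- (log_height + \<epsilon>) * real k)) \<subseteq> square k w"
  using rows_separated[OF separation \<open>\<epsilon> > 0\<close>]
    eventually_compose_filterlim[OF cols[rule_format, OF \<open>\<epsilon> > 0\<close>] scaled_level_top[OF zeta_pos]]
proof eventually_elim
  case (elim k)
  let ?r = "exp (- (log_height + \<epsilon>) * real k)"
  have r: "?r \<le> exp (- (log_width + \<epsilon>) * real (level k))"
  proof -
    have "(log_width + \<epsilon>) * real (level k) \<le> (log_width + \<epsilon>) * (zeta * real k)"
      using scaled_level_bounds(1)[of zeta k] zeta_pos log_width_pos \<open>\<epsilon> > 0\<close> by (intro mult_left_mono) auto
    also have "\<dots> = (zeta * log_width + zeta * \<epsilon>) * real k" by (simp add: algebra_simps)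
    also have "\<dots> \<le> (log_height + \<epsilon>) * real k"
      unfolding zeta_log_width using zeta_le \<open>\<epsilon> > 0\<close> by (intro mult_right_mono) (auto simp: mult_le_cancel_right1)
    finally show ?thesis by (simp only: exp_le_cancel_iff mult_minus_left neg_le_iff_le)
  qed
  show ?case
  proof
    fix v assume v: "v \<in> near (coding_map pat w) ?r"
    then have vc: "v \<in> code_space pat" and d: "dist (coding_map pat v) (coding_map pat w) \<le> ?r"
      by (simp_all add: dist_commute)
    have "\<bar>row_value v - row_value w\<bar> \<le> ?r" "\<bar>col_value v - col_value w\<bar> \<le> ?r"
      using order_trans[OF dist_snd_le d] order_trans[OF dist_fst_le d]
      by (simp_all add: coding_map_eq[OF w] coding_map_eq[OF vc] dist_real_def)
    then have "\<not> (\<exists>i<k. snd (v i) \<noteq> snd (w i))" "\<not> (\<exists>i<level k. fst (v i) \<noteq> fst (w i))"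
      using elim(1)[rule_format, OF vc w] elim(2)[rule_format, OF vc] r by (meson not_le order_trans)+
    then show "v \<in> square k w"
      using vc level_le[of k] by (auto simp: approx_square_def intro!: prod_eqI)
  qed
qed

lemma square_in_ball:
  assumes w: "w \<in> code_space pat" and "\<epsilon> > 0"
  shows "\<forall>\<^sub>F k in sequentially. square k w \<subseteq> near (coding_map pat w) (exp (- (log_height - \<epsilon>) * real k))"
  using square_small[OF \<open>\<epsilon> > 0\<close>]
proof eventually_elim
  case (elim k)
  show ?case
  proof
    fix v assume v: "v \<in> square k w"
    then have "v \<in> code_space pat" by (simp add: approx_square_def)
    moreover have "dist (coding_map pat v) (coding_map pat w) \<le> exp (- (log_height - \<epsilon>) * real k)"
      using elim w v by blast
    ultimately show "v \<in> near (coding_map pat w) (exp (- (log_height - \<epsilon>) * real k))"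
      by (simp add: dist_commute)
  qed
qed

text \<open>
  Almost every code for the tilted measure is typical both for \<open>\<mu>\<close> and for the tilted measure
  itself, and its balls are comparable with approximate squares from inside and outside.
\<close>

lemma AE_local_dims:
  "AE w in \<nu> t. coding_map pat w \<in> local_dim_level (moran_measure pat p) (typical_dim t) \<and>
    (\<forall>s<typical_dim t * t + beta t. \<forall>\<^sub>F r in at_right 0. measure (\<nu> t) (near (coding_map pat w) r) \<le> r powr s)"
  using AE_square_rates tilt.AE_columns_separated AE_space
proof eventually_elim
  case (elim w)
  let ?x = "coding_map pat w" and ?L = log_height
  have w: "w \<in> code_space pat" using elim(3) by (simp add: tilt.space_\<nu>)
  note inner = ball_in_square[OF w _ elim(2)] and outer = square_in_ball[OF w]
  interpret base: prob_space \<mu> by (rule base.prob_space_\<nu>)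
  interpret tilt: prob_space "\<nu> t" by (rule tilt.prob_space_\<nu>)
  have near_mono: "near ?x r \<subseteq> near ?x r'" if "r \<le> r'" for r r' using that by auto
  interpret B: scaled_masses "\<lambda>r. measure \<mu> (near ?x r)" "\<lambda>k. measure \<mu> (square k w)" ?L "?L * typical_dim t"
  proof
    show "measure \<mu> (near ?x r) \<le> measure \<mu> (near ?x r')" if "r \<le> r'" for r r'
      using near_mono[OF that] near_sets by (intro base.finite_measure_mono)
  qed (use elim(1) log_height_pos base.measure_approx_square(2)[OF w level_le] in auto)
  interpret T: scaled_masses "\<lambda>r. measure (\<nu> t) (near ?x r)" "\<lambda>k. measure (\<nu> t) (square k w)" ?L "?L * (typical_dim t * t + beta t)"
  proof
    show "measure (\<nu> t) (near ?x r) \<le> measure (\<nu> t) (near ?x r')" if "r \<le> r'" for r r'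
      using near_mono[OF that] near_sets by (intro tilt.finite_measure_mono)
  qed (use elim(1) log_height_pos tilt.measure_approx_square(2)[OF w level_le] in auto)
  have inner_\<mu>: "\<forall>\<^sub>F k in sequentially. measure \<mu> (near ?x (exp (- (?L + \<epsilon>) * real k))) \<le> measure \<mu> (square k w)"
    if "\<epsilon> > 0" for \<epsilon>
    using inner[OF that] by eventually_elim (intro base.finite_measure_mono base.measure_approx_square(1)[OF w])
  have inner_\<nu>: "\<forall>\<^sub>F k in sequentially. measure (\<nu> t) (near ?x (exp (- (?L + \<epsilon>) * real k))) \<le> measure (\<nu> t) (square k w)"
    if "\<epsilon> > 0" for \<epsilon>
    using inner[OF that] by eventually_elim (intro tilt.finite_measure_mono tilt.measure_approx_square(1)[OF w])
  have outer_\<mu>: "\<forall>\<^sub>F k in sequentially. measure \<mu> (square k w) \<le> measure \<mu> (near ?x (exp (- (?L - \<epsilon>) * real k)))"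
    if "\<epsilon> > 0" for \<epsilon>
    using outer[OF that] by eventually_elim (intro base.finite_measure_mono near_sets)
  have pos: "measure \<mu> (near ?x r) > 0" if "r > 0" for r
  proof -
    have "?L / 2 > 0" using log_height_pos by simp
    have "(\<lambda>k. exp (- (?L - ?L / 2)) ^ k) \<longlonglongrightarrow> 0" using log_height_pos by (intro LIMSEQ_power_zero) simp
    then have "\<forall>\<^sub>F k in sequentially. exp (- (?L - ?L / 2)) ^ k < r" using that by (intro order_tendstoD(2)) auto
    with outer_\<mu>[OF \<open>?L / 2 > 0\<close>] have "\<forall>\<^sub>F k in sequentially. measure \<mu> (near ?x r) > 0"
    proof eventually_elim
      case (elim k)
      have "exp (- (?L - ?L / 2) * real k) \<le> r"
        using elim(2) unfolding exp_of_nat_mult[symmetric] by (simp add: mult.commute)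
      then have "measure \<mu> (near ?x (exp (- (?L - ?L / 2) * real k))) \<le> measure \<mu> (near ?x r)" by (rule B.mono)
      then show ?case using elim(1) B.S_pos[of k] by linarith
    qed
    then show ?thesis by simp
  qed
  have ball: "measure (moran_measure pat p) (cball ?x r) = measure \<mu> (near ?x r)" for r
    unfolding base.measure_moran_measure_cball base.space_\<nu> by simp
  have "((\<lambda>r. ln (measure \<mu> (near ?x r)) / ln r) \<longlongrightarrow> ?L * typical_dim t / ?L) (at_right 0)"
    by (rule B.log_mass_tendsto) (intro inner_\<mu> outer_\<mu> pos; assumption)+
  then have "?x \<in> local_dim_level (moran_measure pat p) (typical_dim t)"
    unfolding local_dim_level_def mem_Collect_eq has_local_dim_def ball using pos log_height_pos by simp
  moreover have "\<forall>\<^sub>F r in at_right 0. measure (\<nu> t) (near ?x r) \<le> r powr s"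
    if "s < typical_dim t * t + beta t" for s
    by (rule T.mass_le_powr) (use inner_\<nu> that log_height_pos in auto)
  ultimately show ?case by blast
qed

lemma tilted_entropy_nonneg: "typical_dim t * t + beta t \<ge> 0"
proof -
  interpret prob_space "\<nu> t" by (rule tilt.prob_space_\<nu>)
  have "AE w in \<nu> t. typical_dim t * t + beta t \<ge> 0"
    using AE_square_rates AE_space
  proof eventually_elim
    case (elim w)
    then have w: "w \<in> code_space pat" by (simp add: tilt.space_\<nu>)
    have "ln (measure (\<nu> t) (square k w)) / real k \<le> 0" for k
      using tilt.measure_approx_square(2)[OF w level_le, where t = t and k = k] by (intro divide_nonpos_nonneg) auto
    then have "- (log_height * (typical_dim t * t + beta t)) \<le> 0"
      using elim(1) by (intro tendsto_upperbound[of _ _ sequentially 0]) auto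
    then show ?case using log_height_pos by (simp add: zero_le_mult_iff)
  qed
  then show ?thesis by simp
qed

lemma hausdorff_measure_level_ne_0:
  assumes "0 \<le> s" "s < typical_dim t * t + beta t"
  shows "hausdorff_measure s (local_dim_level (moran_measure pat p) (typical_dim t)) \<noteq> 0"
proof -
  obtain s' where s': "s < s'" "s' < typical_dim t * t + beta t" using dense[OF assms(2)] by blast
  show ?thesis
  proof (rule mass_distribution_principle[OF tilt.prob_space_\<nu>[of t] _ _ assms(1) s'(1)])
    show "{v \<in> space (\<nu> t). coding_map pat v \<in> cball x r} \<in> sets (\<nu> t)" for x r
      by (rule tilt.ball_codes_sets)
    show "AE w in \<nu> t. coding_map pat w \<in> local_dim_level (moran_measure pat p) (typical_dim t) \<and>
      (\<forall>\<^sub>F r in at_right 0. measure (\<nu> t) {v \<in> space (\<nu> t). coding_map pat v \<in> cball (coding_map pat w) r} \<le> r powr s')"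
      unfolding tilt.space_\<nu> using AE_local_dims by eventually_elim (use s'(2) in blast)
  qed
qed

lemma spectrum_typical_dim: "spectrum_dim pat p (typical_dim t) = ereal (typical_dim t * t + beta t)"
  unfolding spectrum_dim_def
  using tilted_entropy_nonneg[of t] hausdorff_measure_level_ne_0[of _ t] hausdorff_measure_level_eq_0[of _ "typical_dim t" t]
  by (intro hausdorff_dim_eqI) auto

end

section \<open>Legendre transforms\<close>

text \<open>
  A function \<open>b\<close> that lies strictly above the line of slope \<open>- a t\<close> through each of its points
  \<open>(t, b t)\<close> is strictly convex.  The bounds \<open>lower\<close> and \<open>upper\<close> make the slopes exhaust the interval
  from \<open>l\<close> to \<open>u\<close>: comparing the tangent at \<open>t\<close> with \<open>b 0\<close> shows that \<open>a t\<close> is at most \<open>l + b 0 / t\<close>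
  for \<open>t > 0\<close>, and similarly for \<open>t < 0\<close>.
\<close>

locale strict_tangents =
  fixes b a :: "real \<Rightarrow> real" and l u :: real
  assumes tangent: "\<And>s t. s \<noteq> t \<Longrightarrow> b t - (s - t) * a t < b s"
    and cont: "continuous_on UNIV a"
    and lower: "\<And>t. b t \<ge> - t * l" and upper: "\<And>t. b t \<ge> - t * u"
begin

lemma slope_strict_antimono: "s < t \<Longrightarrow> a t < a s"
proof -
  assume "s < t"
  then have "b t - (s - t) * a t < b s" "b s - (t - s) * a s < b t" using tangent by auto
  then have "(t - s) * a t < (t - s) * a s" by (simp add: algebra_simps)
  then show "a t < a s" using \<open>s < t\<close> by simp
qed

lemma slope_onto:
  assumes "l < \<alpha>" "\<alpha> < u"
  shows "\<exists>t. a t = \<alpha>"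
proof -
  have b0: "b 0 \<ge> 0" using lower[of 0] by simp
  have tangent0: "b t + t * a t \<le> b 0" for t using tangent[of 0 t] by (cases "t = 0") (auto simp: less_imp_le)
  define t1 where "t1 = b 0 / (\<alpha> - l) + 1"
  define t2 where "t2 = b 0 / (u - \<alpha>) + 1"
  have t: "t1 > 0" "t2 > 0" unfolding t1_def t2_def using b0 assms by (auto intro!: add_nonneg_pos)
  have "t1 * (\<alpha> - l) = b 0 + (\<alpha> - l)" "t2 * (u - \<alpha>) = b 0 + (u - \<alpha>)"
    unfolding t1_def t2_def using assms by (simp_all add: field_simps)
  then have big: "t1 * (\<alpha> - l) > b 0" "t2 * (u - \<alpha>) > b 0" using assms by linarith+
  have "t1 * (a t1 - l) \<le> b 0" using tangent0[of t1] lower[of t1] by (simp add: algebra_simps)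
  then have "t1 * (a t1 - l) < t1 * (\<alpha> - l)" using big by linarith
  then have "a t1 \<le> \<alpha>" using t by simp
  moreover have "t2 * (u - a (- t2)) \<le> b 0" using tangent0[of "- t2"] upper[of "- t2"] by (simp add: algebra_simps)
  then have "t2 * (u - a (- t2)) < t2 * (u - \<alpha>)" using big by linarith
  then have "\<alpha> \<le> a (- t2)" using t by simp
  ultimately have "\<exists>t\<ge>- t2. t \<le> t1 \<and> a t = \<alpha>"
    using t by (intro IVT2' continuous_on_subset[OF cont]) auto
  then show ?thesis by blast
qed

definition slope_inv :: "real \<Rightarrow> real" where "slope_inv \<alpha> = (SOME t. a t = \<alpha>)"
definition legendre :: "real \<Rightarrow> real" where "legendre \<alpha> = \<alpha> * slope_inv \<alpha> + b (slope_inv \<alpha>)"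

lemma slope_inv: "l < \<alpha> \<Longrightarrow> \<alpha> < u \<Longrightarrow> a (slope_inv \<alpha>) = \<alpha>"
  unfolding slope_inv_def using slope_onto by (rule someI_ex)

lemma legendre_le: "l < \<alpha> \<Longrightarrow> \<alpha> < u \<Longrightarrow> legendre \<alpha> \<le> \<alpha> * t + b t"
  using tangent[of t "slope_inv \<alpha>"] slope_inv[of \<alpha>]
  by (cases "t = slope_inv \<alpha>") (auto simp: legendre_def algebra_simps)

lemma legendre_eq_INF: "l < \<alpha> \<Longrightarrow> \<alpha> < u \<Longrightarrow> ereal (legendre \<alpha>) = (INF t. ereal (\<alpha> * t + b t))"
  using legendre_le by (intro antisym INF_greatest INF_lower2[of "slope_inv \<alpha>"]) (auto simp: legendre_def)

lemma legendre_concave: "concave_on {l<..<u} legendre"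
  unfolding concave_on_iff
proof (intro conjI ballI allI impI)
  fix x y v w :: real
  assume x: "x \<in> {l<..<u}" and y: "y \<in> {l<..<u}" and vw: "0 \<le> v" "0 \<le> w" "v + w = 1"
  let ?z = "v *\<^sub>R x + w *\<^sub>R y"
  let ?t = "slope_inv ?z"
  have "?z \<in> {l<..<u}" by (rule convexD[OF convex_real_interval(8) x y vw])
  have "v * legendre x + w * legendre y \<le> v * (x * ?t + b ?t) + w * (y * ?t + b ?t)"
    using x y vw legendre_le by (intro add_mono mult_left_mono) auto
  also have "\<dots> = ?z * ?t + (v + w) * b ?t" by (simp add: algebra_simps)
  also have "\<dots> = legendre ?z" by (simp add: vw legendre_def)
  finally show "v * legendre x + w * legendre y \<le> legendre ?z" .
qed simp

text \<open>
  Since \<open>legendre\<close> is a minimum of affine functions, its increments at \<open>\<alpha>\<close> lie between those of the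
  minimisers at both ends; the minimiser depends continuously on \<open>\<alpha>\<close> because the slope is strictly
  monotone.
\<close>

lemma legendre_has_derivative:
  assumes \<alpha>: "l < \<alpha>" "\<alpha> < u"
  shows "(legendre has_real_derivative slope_inv \<alpha>) (at \<alpha>)"
  unfolding DERIV_def
proof (rule tendstoI)
  fix e :: real assume "e > 0"
  let ?t = "slope_inv \<alpha>"
  define lo where "lo = max l (a (?t + e / 2))"
  define hi where "hi = min u (a (?t - e / 2))"
  have "a (?t + e / 2) < \<alpha>" "\<alpha> < a (?t - e / 2)"
    using slope_strict_antimono[of ?t "?t + e / 2"] slope_strict_antimono[of "?t - e / 2" ?t] slope_inv[OF \<alpha>] \<open>e > 0\<close> by auto
  then have lohi: "lo < \<alpha>" "\<alpha> < hi" using \<alpha> by (auto simp: lo_def hi_def)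
  have "\<forall>\<^sub>F h in at 0. \<alpha> + h > lo \<and> \<alpha> + h < hi \<and> h \<noteq> 0"
  proof -
    have "((\<lambda>h. \<alpha> + h) \<longlongrightarrow> \<alpha> + 0) (at 0)" by (intro tendsto_intros)
    from order_tendstoD(1)[OF this, of lo] order_tendstoD(2)[OF this, of hi] lohi eventually_neq_at_within[of 0 0 UNIV]
    show ?thesis by (simp add: eventually_conj_iff)
  qed
  then show "\<forall>\<^sub>F h in at 0. dist ((legendre (\<alpha> + h) - legendre \<alpha>) / h) ?t < e"
  proof eventually_elim
    case (elim h)
    let ?s = "slope_inv (\<alpha> + h)"
    have h: "l < \<alpha> + h" "\<alpha> + h < u" "a (?t + e / 2) < \<alpha> + h" "\<alpha> + h < a (?t - e / 2)"
      using elim by (auto simp: lo_def hi_def)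
    have s: "a ?s = \<alpha> + h" by (rule slope_inv[OF h(1,2)])
    have "?t - e / 2 < ?s"
      using h(4) s slope_strict_antimono[of ?s "?t - e / 2"] by (cases "?s = ?t - e / 2") (auto simp: not_less_iff_gr_or_eq[symmetric] intro: ccontr)
    moreover have "?s < ?t + e / 2"
      using h(3) s slope_strict_antimono[of "?t + e / 2" ?s] by (cases "?s = ?t + e / 2") (auto intro: ccontr)
    ultimately have close: "\<bar>?s - ?t\<bar> < e" using \<open>e > 0\<close> by linarith
    have up: "legendre (\<alpha> + h) - legendre \<alpha> \<le> h * ?t"
      using legendre_le[OF h(1,2), of ?t] by (simp add: legendre_def algebra_simps)
    have low: "h * ?s \<le> legendre (\<alpha> + h) - legendre \<alpha>"
      using legendre_le[OF \<alpha>, of ?s] by (simp add: legendre_def algebra_simps)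
    have "\<bar>legendre (\<alpha> + h) - legendre \<alpha> - h * ?t\<bar> \<le> \<bar>h * ?s - h * ?t\<bar>" using up low by linarith
    also have "\<dots> = \<bar>h\<bar> * \<bar>?s - ?t\<bar>" by (simp add: abs_mult[symmetric] right_diff_distrib)
    also have "\<dots> < \<bar>h\<bar> * e" using close elim by simp
    finally have "\<bar>legendre (\<alpha> + h) - legendre \<alpha> - h * ?t\<bar> / \<bar>h\<bar> < e" using elim by (simp add: divide_less_eq mult.commute)
    then show ?case using elim by (simp add: dist_real_def abs_divide[symmetric] diff_divide_distrib)
  qed
qed

end

context moran_spectrum
begin

text \<open>
  The tangents of the patterns add up.  If the total tangent meets \<open>beta\<close> at another point, so does
  the tangent of every pattern of positive frequency, whose digit weights are then constant.
\<close>

lemma tangent_beta: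
  "beta t - (s - t) * typical_dim t \<le> beta s"
  "beta t - (s - t) * typical_dim t = beta s \<Longrightarrow> s \<noteq> t \<Longrightarrow> alpha_min pat f p = alpha_max pat f p"
proof -
  let ?S = "\<lambda>\<gamma> t. ln (pressure_sum p zeta \<gamma> t)"
  let ?gap = "\<lambda>\<gamma>. ?S \<gamma> s - (?S \<gamma> t - (s - t) * tilted_mean p zeta \<gamma> t)"
  note pp = base.positive_pattern_P
  have gap_nonneg: "?gap \<gamma> \<ge> 0" if "\<gamma> \<in> range pat" for \<gamma>
    using positive_pattern.pressure_tangent(1)[OF pp[OF that] zeta_pos zeta_le, of t s] by simp
  have "mean ?gap = mean (\<lambda>\<gamma>. ?S \<gamma> s) - (mean (\<lambda>\<gamma>. ?S \<gamma> t) - (s - t) * mean (\<lambda>\<gamma>. tilted_mean p zeta \<gamma> t))"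
    unfolding sum_distrib_left sum_subtractf[symmetric] by (intro sum.cong refl) (simp add: algebra_simps)
  also have "\<dots> = log_height * (beta s - (beta t - (s - t) * typical_dim t))"
    unfolding mean_pressure typical_dim_def using log_height_pos by (simp add: field_simps)
  finally have gap: "mean ?gap = log_height * (beta s - (beta t - (s - t) * typical_dim t))" .
  have nn: "f \<gamma> * ?gap \<gamma> \<ge> 0" if "\<gamma> \<in> range pat" for \<gamma>
    using f_nonneg[OF that] gap_nonneg[OF that] by (rule mult_nonneg_nonneg)
  have "mean ?gap \<ge> 0" by (intro sum_nonneg nn)
  then show "beta t - (s - t) * typical_dim t \<le> beta s"
    unfolding gap using log_height_pos by (simp add: zero_le_mult_iff)
  assume eq: "beta t - (s - t) * typical_dim t = beta s" and "s \<noteq> t"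
  have gap_0: "mean ?gap = 0" unfolding gap using eq by simp
  have zero: "f \<gamma> * ?gap \<gamma> = 0" if "\<gamma> \<in> range pat" for \<gamma>
    by (rule sum_nonneg_0[OF finite_patterns nn gap_0 that])
  have "f \<gamma> * Min (digit_weight p zeta \<gamma> ` digits \<gamma>) = f \<gamma> * Max (digit_weight p zeta \<gamma> ` digits \<gamma>)"
    if \<gamma>: "\<gamma> \<in> range pat" for \<gamma>
  proof (cases "f \<gamma> = 0")
    case False
    then have "?S \<gamma> s = ?S \<gamma> t - (s - t) * tilted_mean p zeta \<gamma> t" using zero[OF \<gamma>] by simp
    then have const: "digit_weight p zeta \<gamma> w = digit_weight p zeta \<gamma> v" if "w \<in> digits \<gamma>" "v \<in> digits \<gamma>" for w v
      using positive_pattern.pressure_tangent(2)[OF pp[OF \<gamma>] zeta_pos zeta_le _ _ that] \<open>s \<noteq> t\<close> by blast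
    obtain w where w: "w \<in> digits \<gamma>" using digits_ne[OF \<gamma>] by blast
    have "digit_weight p zeta \<gamma> ` digits \<gamma> = {digit_weight p zeta \<gamma> w}" using const w by blast
    then show ?thesis by simp
  qed simp
  then show "alpha_min pat f p = alpha_max pat f p"
    unfolding alpha_min_def alpha_max_def by (intro arg_cong2[of _ _ _ _ "(/)"] sum.cong refl)
qed

lemma beta_ge: "beta t \<ge> - t * alpha_min pat f p" "beta t \<ge> - t * alpha_max pat f p"
proof -
  have bound: "beta t \<ge> - t * (mean (\<lambda>\<gamma>. e \<gamma>) / log_height)"
    if e: "\<And>\<gamma>. \<gamma> \<in> range pat \<Longrightarrow> e \<gamma> \<in> digit_weight p zeta \<gamma> ` digits \<gamma>" for e
  proof -
    have "mean (\<lambda>\<gamma>. - t * e \<gamma>) \<le> mean (\<lambda>\<gamma>. ln (pressure_sum p zeta \<gamma> t))"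
    proof (intro sum_mono mult_left_mono)
      fix \<gamma> assume \<gamma>: "\<gamma> \<in> range pat"
      from e[OF \<gamma>] obtain w where "w \<in> digits \<gamma>" "e \<gamma> = digit_weight p zeta \<gamma> w" by blast
      then show "- t * e \<gamma> \<le> ln (pressure_sum p zeta \<gamma> t)"
        using positive_pattern.ln_pressure_sum_ge[OF base.positive_pattern_P[OF \<gamma>] zeta_pos zeta_le] by simp
      show "0 \<le> f \<gamma>" by (rule f_nonneg[OF \<gamma>])
    qed
    moreover have "mean (\<lambda>\<gamma>. - t * e \<gamma>) = - t * mean (\<lambda>\<gamma>. e \<gamma>)"
      unfolding sum_distrib_left by (intro sum.cong refl) simp
    ultimately have "- t * mean (\<lambda>\<gamma>. e \<gamma>) \<le> log_height * beta t" unfolding mean_pressure by simp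
    then have "(- t * mean (\<lambda>\<gamma>. e \<gamma>)) / log_height \<le> beta t"
      using pos_divide_le_eq[OF log_height_pos, of "- t * mean (\<lambda>\<gamma>. e \<gamma>)" "beta t"] by (simp only: mult.commute)
    then show ?thesis by simp
  qed
  have "Min (digit_weight p zeta \<gamma> ` digits \<gamma>) \<in> digit_weight p zeta \<gamma> ` digits \<gamma>"
    "Max (digit_weight p zeta \<gamma> ` digits \<gamma>) \<in> digit_weight p zeta \<gamma> ` digits \<gamma>" if "\<gamma> \<in> range pat" for \<gamma>
    using finite_digits[OF that] digits_ne[OF that] by (auto intro: Min_in Max_in)
  from bound[OF this(1)] bound[OF this(2)]
  show "beta t \<ge> - t * alpha_min pat f p" "beta t \<ge> - t * alpha_max pat f p"
    unfolding alpha_min_def alpha_max_def by simp_all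
qed

lemma continuous_typical_dim: "continuous_on UNIV typical_dim"
proof -
  have "continuous_on UNIV (\<lambda>t. mean (\<lambda>\<gamma>. tilted_mean p zeta \<gamma> t) / log_height)"
    using log_height_pos positive_pattern.continuous_tilted_mean[OF base.positive_pattern_P]
    by (intro continuous_on_divide continuous_on_sum continuous_on_mult continuous_on_const) auto
  then show ?thesis unfolding typical_dim_def .
qed

end

theorem theorem2p1:
  fixes pat :: "nat \<Rightarrow> pattern"
    and f :: "pattern \<Rightarrow> real"
    and p :: "pattern \<Rightarrow> nat \<times> nat \<Rightarrow> real"
  assumes "moran_with_frequency pat f"
    and "positive_prob_vectors pat p"
    and "zeta_ratio pat f \<le> 1"
    and "RSC pat \<or> TBSC pat f"
  shows "(\<forall>\<alpha> \<in> {alpha_min pat f p<..<alpha_max pat f p}.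
            spectrum_dim pat p \<alpha> = (INF t::real. ereal (\<alpha> * t + beta_fun pat f p t))) \<and>
         (\<forall>\<alpha> \<in> {alpha_min pat f p<..<alpha_max pat f p}.
            (\<lambda>a. real_of_ereal (spectrum_dim pat p a)) differentiable (at \<alpha>)) \<and>
         concave_on {alpha_min pat f p<..<alpha_max pat f p}
            (\<lambda>a. real_of_ereal (spectrum_dim pat p a))"
proof (cases "alpha_min pat f p < alpha_max pat f p")
  case False
  then have "{alpha_min pat f p<..<alpha_max pat f p} = {}" by simp
  then show ?thesis by (simp add: concave_on_iff)
next
  case True
  interpret moran_spectrum pat f p by unfold_locales (fact assms)+
  let ?l = "alpha_min pat f p" and ?u = "alpha_max pat f p"
  interpret strict_tangents "beta_fun pat f p" typical_dim ?l ?u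
  proof
    fix s t :: real assume "s \<noteq> t"
    then show "beta_fun pat f p t - (s - t) * typical_dim t < beta_fun pat f p s"
      using tangent_beta[of t s] True by linarith
  qed (rule continuous_typical_dim beta_ge)+
  have dim: "spectrum_dim pat p \<alpha> = ereal (legendre \<alpha>)" if "\<alpha> \<in> {?l<..<?u}" for \<alpha>
  proof -
    have "typical_dim (slope_inv \<alpha>) = \<alpha>" using that by (intro slope_inv) auto
    then show ?thesis using spectrum_typical_dim[of "slope_inv \<alpha>"] by (simp add: legendre_def)
  qed
  show ?thesis
  proof (intro conjI ballI)
    fix \<alpha> assume \<alpha>: "\<alpha> \<in> {?l<..<?u}"
    then show "spectrum_dim pat p \<alpha> = (INF t. ereal (\<alpha> * t + beta_fun pat f p t))"
      unfolding dim[OF \<alpha>] by (intro legendre_eq_INF) auto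
    have "(legendre has_real_derivative slope_inv \<alpha>) (at \<alpha>)" using \<alpha> by (intro legendre_has_derivative) auto
    then have "((\<lambda>a. real_of_ereal (spectrum_dim pat p a)) has_real_derivative slope_inv \<alpha>) (at \<alpha>)"
      by (rule has_field_derivative_transform_within_open[OF _ open_greaterThanLessThan \<alpha>]) (simp add: dim)
    then show "(\<lambda>a. real_of_ereal (spectrum_dim pat p a)) differentiable (at \<alpha>)"
      unfolding real_differentiable_def by blast
  next
    show "concave_on {?l<..<?u} (\<lambda>a. real_of_ereal (spectrum_dim pat p a))"
      unfolding concave_on_iff
    proof (intro conjI ballI allI impI)
      fix x y v w :: real
      assume x: "x \<in> {?l<..<?u}" and y: "y \<in> {?l<..<?u}" and vw: "0 \<le> v" "0 \<le> w" "v + w = 1"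
      have z: "v *\<^sub>R x + w *\<^sub>R y \<in> {?l<..<?u}" by (rule convexD[OF convex_real_interval(8) x y vw])
      have "v * legendre x + w * legendre y \<le> legendre (v *\<^sub>R x + w *\<^sub>R y)"
        using legendre_concave x y vw unfolding concave_on_iff by blast
      then show "v * real_of_ereal (spectrum_dim pat p x) + w * real_of_ereal (spectrum_dim pat p y)
          \<le> real_of_ereal (spectrum_dim pat p (v *\<^sub>R x + w *\<^sub>R y))"
        unfolding dim[OF x] dim[OF y] dim[OF z] by simp
    qed simp
  qed
qed

end
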